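(* Let $\omega\in\widetilde L_N^1(\mathbb S_1)$ be the weight of a cyclic Pólya ensemble on $\mathrm U(N)$. Set $\mathbb J_l=\{0,1,\ldots,l-1\}$ for $l>0$, $\mathbb J_0=\emptyset$, and $\mathbb J_l^{\rm c}=\mathbb Z\setminus\mathbb J_l$. A bi-orthonormal pair of functions $\{(P_j,Q_j)\}_{j=0,\ldots,N-1}$ of this ensemble is given by $$P_j(z_1)=\sum_{k\in\mathbb J_{j+1}}\frac{1}{(j-k)!\,k!}\frac{(-z_1)^k}{\mathcal S\omega(k)},\qquad Q_j(z_2)=z_2\partial_{z_2}^jz_2^{j-1}\omega(z_2)=\lim_{t\to0^+}\sum_{l\in\mathbb J_j^{\rm c}}\frac{\Gamma[j-l]}{\Gamma[-l]}\,\mathcal S\omega(l)\,z_2^{-l}e^{-t(l+1-N)l}$$ for $j=0,\ldots,N-1$. The kernel $K_N(z_1,z_2)=\sum_{j=0}^{N-1}P_j(z_1)Q_j(z_2)$ is then the double sum $$K_N(z_1,z_2)=\sum_{k\in\mathbb J_N}(z_1z_2^{-1})^k+\lim_{t\to0^+}\sum_{k\in\mathbb J_N}\sum_{l\in\mathbb J_N^{\rm c}}\frac{\Gamma[N-l]}{\Gamma[-l]\Gamma[N-k]\Gamma[k+1]}\,\frac{\mathcal S\omega(l)}{\mathcal S\omega(k)}\,\frac{(-z_1)^kz_2^{-l}}{k-l}\,e^{-t(l+1-N)l}.$$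
   Context: $\mathbb S_1=\{z\in\mathbb C: |z|=1\}$ carries the normalised Haar measure $\frac{dz'}{2\pi i z'}$ (i.e. $\frac{d\theta}{2\pi}$ for $z'=e^{i\theta}$); functions on $\mathbb S_1$ are identified when equal almost everywhere (pointwise identities involving derivatives of $\omega$ are meant for almost every argument). A star denotes complex conjugation, and $z'\partial_{z'}=-i\,\frac{d}{d\theta}$. The operator $z\partial_z^jz^{j-1}$ first multiplies by $z^{j-1}$, then differentiates $j$ times, then multiplies by $z$; equivalently it is $\prod_{m=0}^{j-1}(z\partial_z+m)$. For integers $j\ge0$ and $l$, the ratio $\Gamma[j-l]/\Gamma[-l]$ is understood by continuity, i.e. it equals $\prod_{m=0}^{j-1}(m-l)$. $\Delta_N(z)=\prod_{1\le a<b\le N}(z_b-z_a)$. For $w\in L^1(\mathbb S_1)$ and $s\in\mathbb Z$, $\mathcal Sw(s)=\int_{\mathbb S_1}\frac{dz'}{2\pi i z'}{z'}^{s}w(z')$. $L_N^1(\mathbb S_1)=\{w\in L^1(\mathbb S_1): [w(z)]^*=z^{N-1}w(z)\}$. $\widetilde L_N^1(\mathbb S_1)$ is the set of $w\in L_N^1(\mathbb S_1)$ that are $(N-1)$-times differentiable with $\partial^jw\in L^1(\mathbb S_1)$ for $j=0,\ldots,N-1$; here this means that for $N\ge2$ $w$ is $(N-2)$-times continuously differentiable with $\partial^{N-2}w$ absolutely continuous, so that $\partial^{N-1}w$ need only exist almost everywhere. The cyclic Pólya ensemble on $\mathrm U(N)$ with weight $\omega\in\widetilde L_N^1(\mathbb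 S_1)$ is the unitarily invariant random matrix ensemble whose eigenvalues have joint density, with respect to $\prod_{j}\frac{dz_j}{2\pi i z_j}$, $$p_N(z)=\frac{1}{N!\prod_{j=0}^{N-1}[j!\,\mathcal S\omega(j)]}\,\Delta_N(z)\det[(-z_a\partial_{z_a})^{b-1}\omega(z_a)]_{a,b=1,\ldots,N}\ge0 ,$$ where it is part of the definition that $\prod_{j=0}^{N-1}\mathcal S\omega(j)>0$. A set $\{(P_j,Q_j)\}_{j=0,\ldots,N-1}$ is a bi-orthonormal pair of functions of this ensemble if (1) $\mathrm{span}\{P_j\}_{j=0}^{N-1}=\mathrm{span}\{z^j\}_{j=0}^{N-1}$; (2) $\mathrm{span}\{Q_j\}_{j=0}^{N-1}=\mathrm{span}\{w_j\}_{j=0}^{N-1}$ with $w_j=(-z\partial_z)^j\omega$; (3) $\int_{\mathbb S_1}\frac{dz'}{2\pi i z'}P_a(z')Q_b(z')=\delta_{ab}$ for all $a,b=0,\ldots,N-1$. The kernel $K_N(z_1,z_2)=\sum_{j=0}^{N-1}P_j(z_1)Q_j(z_2)$ is the correlation kernel of the determinantal point process of the eigenvalues: the $k$-point function $\frac{N!}{(N-k)!}\int p_N(z)\prod_{j=k+1}^N\frac{dz_j}{2\pi i z_j}$ equals $\det[K_N(z_a,z_b)]_{a,b=1,\ldots,k}$. *)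

theory Defs
  imports "HOL-Analysis.Analysis" "Jordan_Normal_Form.Determinant"
begin

(* A function on the unit circle is a function complex => complex of which only the values on
   sphere 0 1 matter; the underlying space of the measure is the circle. *)

definition circle_haar :: "complex measure" where
  "circle_haar =
     distr (uniform_measure lborel {0..2 * pi}) (restrict_space borel (sphere 0 1)) cis"

definition spherical :: "(complex \<Rightarrow> complex) \<Rightarrow> int \<Rightarrow> complex" where
  "spherical w s = (LINT z|circle_haar. z powi s * w z)"

(* The derivative along the circle, normalised such that z * circle_deriv f z is the
   derivative of f at z = exp(i theta) with respect to theta, times -i; for f holomorphic near z
   it is the complex derivative. *)
definition circle_deriv :: "(complex \<Rightarrow> complex) \<Rightarrow> complex \<Rightarrow> complex" where
  "circle_deriv f z = vector_derivative (\<lambda>\<theta>. f (z * cis \<theta>)) (at 0) / (\<i> * z)"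

definition circle_differentiable :: "(complex \<Rightarrow> complex) \<Rightarrow> bool" where
  "circle_differentiable f \<longleftrightarrow> (\<forall>z\<in>sphere 0 1. (\<lambda>\<theta>. f (z * cis \<theta>)) differentiable (at 0))"

(* The finite families of non-overlapping intervals [Inf K, Sup K] are the divisions of their
   unions. *)
definition absolutely_continuous_fun :: "real \<Rightarrow> real \<Rightarrow> (real \<Rightarrow> complex) \<Rightarrow> bool" where
  "absolutely_continuous_fun a b f \<longleftrightarrow>
     (\<forall>\<epsilon>>0. \<exists>\<delta>>0. \<forall>\<D>. \<D> division_of \<Union>\<D> \<and> \<Union>\<D> \<subseteq> {a..b} \<and> (\<Sum>K\<in>\<D>. Sup K - Inf K) < \<delta> \<longrightarrow>
        (\<Sum>K\<in>\<D>. norm (f (Sup K) - f (Inf K))) < \<epsilon>)"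

definition L1_circle :: "nat \<Rightarrow> (complex \<Rightarrow> complex) set" where
  "L1_circle N = {w. integrable circle_haar w \<and> (AE z in circle_haar. cnj (w z) = z ^ (N - 1) * w z)}"

(* For N >= 2 the function w is the continuous representative of its class modulo null sets. *)
definition L1_circle_smooth :: "nat \<Rightarrow> (complex \<Rightarrow> complex) set" where
  "L1_circle_smooth N = {w \<in> L1_circle N.
     (2 \<le> N \<longrightarrow>
        (\<forall>j<N - 2. circle_differentiable ((circle_deriv ^^ j) w)) \<and>
        (\<forall>j\<le>N - 2. continuous_on (sphere 0 1) ((circle_deriv ^^ j) w)) \<and>
        absolutely_continuous_fun 0 (2 * pi) (\<lambda>\<theta>. (circle_deriv ^^ (N - 2)) w (cis \<theta>))) \<and>
     (\<forall>j<N. integrable circle_haar ((circle_deriv ^^ j) w))}"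

definition polya_w :: "(complex \<Rightarrow> complex) \<Rightarrow> nat \<Rightarrow> complex \<Rightarrow> complex" where
  "polya_w w j = ((\<lambda>f z. - (z * circle_deriv f z)) ^^ j) w"

definition vandermonde :: "nat \<Rightarrow> (nat \<Rightarrow> complex) \<Rightarrow> complex" where
  "vandermonde N z = (\<Prod>b<N. \<Prod>a<b. z b - z a)"

definition polya_density :: "nat \<Rightarrow> (complex \<Rightarrow> complex) \<Rightarrow> (nat \<Rightarrow> complex) \<Rightarrow> complex" where
  "polya_density N w z =
     1 / (fact N * (\<Prod>j<N. fact j * spherical w (int j))) * vandermonde N z *
     Determinant.det (Matrix.mat N N (\<lambda>(a, b). polya_w w b (z a)))"

(* A unitarily invariant random matrix on U(N) is determined by the joint density of its
   eigenvalues, so that the ensemble with weight w is represented by polya_density N w; this is a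
   probability density as soon as it is nonnegative, because the prefactor normalises it. *)
definition cyclic_polya_weight :: "nat \<Rightarrow> (complex \<Rightarrow> complex) \<Rightarrow> bool" where
  "cyclic_polya_weight N w \<longleftrightarrow>
     w \<in> L1_circle_smooth N \<and>
     (\<Prod>j<N. spherical w (int j)) \<in> \<real>\<^sub>\<ge>\<^sub>0 - {0} \<and>
     (AE z in Pi\<^sub>M {..<N} (\<lambda>_. circle_haar). polya_density N w z \<in> \<real>\<^sub>\<ge>\<^sub>0)"

(* Complex linear span of F 0, ..., F (N - 1), functions being identified almost everywhere. *)
definition circle_span :: "nat \<Rightarrow> (nat \<Rightarrow> complex \<Rightarrow> complex) \<Rightarrow> (complex \<Rightarrow> complex) set" where
  "circle_span N F = {g. \<exists>c. AE z in circle_haar. g z = (\<Sum>j<N. c j * F j z)}"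

definition biorthonormal_pair ::
  "nat \<Rightarrow> (complex \<Rightarrow> complex) \<Rightarrow> (nat \<Rightarrow> complex \<Rightarrow> complex) \<Rightarrow> (nat \<Rightarrow> complex \<Rightarrow> complex) \<Rightarrow> bool" where
  "biorthonormal_pair N w P Q \<longleftrightarrow>
     circle_span N P = circle_span N (\<lambda>j z. z ^ j) \<and>
     circle_span N Q = circle_span N (polya_w w) \<and>
     (\<forall>a<N. \<forall>b<N. has_bochner_integral circle_haar (\<lambda>z. P a z * Q b z) (if a = b then 1 else 0))"

definition polya_P :: "(complex \<Rightarrow> complex) \<Rightarrow> nat \<Rightarrow> complex \<Rightarrow> complex" where
  "polya_P w j z = (\<Sum>k<j + 1. 1 / (fact (j - k) * fact k) * ((- z) ^ k / spherical w (int k)))"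

definition polya_Q :: "(complex \<Rightarrow> complex) \<Rightarrow> nat \<Rightarrow> complex \<Rightarrow> complex" where
  "polya_Q w j z = z * (circle_deriv ^^ j) (\<lambda>u. u powi (int j - 1) * w u) z"

definition polya_kernel :: "nat \<Rightarrow> (complex \<Rightarrow> complex) \<Rightarrow> complex \<Rightarrow> complex \<Rightarrow> complex" where
  "polya_kernel N w z\<^sub>1 z\<^sub>2 = (\<Sum>j<N. polya_P w j z\<^sub>1 * polya_Q w j z\<^sub>2)"

definition index_set :: "nat \<Rightarrow> int set" where
  "index_set n = {0..<int n}"

(* Gamma(j - l) / Gamma(-l), extended by continuity to l >= 0. *)
definition Gamma_ratio :: "nat \<Rightarrow> int \<Rightarrow> complex" where
  "Gamma_ratio j l = pochhammer (- of_int l) j"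

definition regulator :: "nat \<Rightarrow> real \<Rightarrow> int \<Rightarrow> complex" where
  "regulator N t l = exp (- of_real t * of_int ((l + 1 - int N) * l))"

definition Q_term :: "nat \<Rightarrow> (complex \<Rightarrow> complex) \<Rightarrow> nat \<Rightarrow> real \<Rightarrow> complex \<Rightarrow> int \<Rightarrow> complex" where
  "Q_term N w j t z l = Gamma_ratio j l * spherical w l * z powi (- l) * regulator N t l"

definition kernel_term ::
  "nat \<Rightarrow> (complex \<Rightarrow> complex) \<Rightarrow> real \<Rightarrow> complex \<Rightarrow> complex \<Rightarrow> nat \<Rightarrow> int \<Rightarrow> complex" where
  "kernel_term N w t z\<^sub>1 z\<^sub>2 k l =
     Gamma_ratio N l / (Gamma (of_nat (N - k)) * Gamma (of_nat (k + 1))) *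
     (spherical w l / spherical w (int k)) *
     ((- z\<^sub>1) ^ k * z\<^sub>2 powi (- l) / of_int (int k - l)) * regulator N t l"

end

(* By integration by parts, Q_j has the Fourier coefficients Gamma(j - l) / Gamma(-l) * S w(l), so that
   biorthonormality becomes an alternating sum of binomial coefficients and the kernel coefficients
   telescope. The limits t -> 0 are then instances of one theorem: for every integrable f on the circle the
   Fourier series with the factors exp(-t (l + 1 - N) l) converges to f almost everywhere. Completing the
   square, with c = (N - 1) / 2, Poisson summation turns this series into the convolution of f with the
   periodised kernel "Gaussian times exp(i c x)", which reproduces f wherever the indefinite integral of
   exp(i c x) f(x) is differentiable with the expected derivative. The derivative of order N - 1 of w exists
   only almost everywhere; integration by parts for it needs the fundamental theorem of calculus for
   absolutely continuous functions, obtained from the Radon-Nikodym theorem applied to the measures of the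
   total variation function V and of V - f. *)
theory Submission
  imports Defs "HOL-Probability.Probability" "HOL-Real_Asymp.Real_Asymp"
begin

section \<open>Absolutely continuous functions\<close>

text \<open>The top function Q_(N-1) is only known to be integrable, so the limits are sought almost
  everywhere and rest on averages of the limit function. Because the regulator is centred at (N - 1)
  / 2 instead of 0, the convolution kernel is in general not positive. Its oscillating factor is
  therefore moved to f, and what remains is an even Gaussian that decreases in |x|: up to a
  constant, a superposition of indicators of intervals symmetric about the point. Hence only signed
  integrals over such intervals have to be small.

  The double series asks for no further analysis. For fixed k the sum over l is the regulated
  Fourier series of one integrable function of z_2, a combination of the Q_j minus a multiple of
  z_2^(-k), which has no frequency in J_N. As z_1 enters through finitely many factors, one null set
  of z_2 serves all z_1.

  Radon-Nikodym concerns positive measures, that is monotone functions, whence the detour over the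
  variation. Since the last derivative may fail to exist on a null set, the pointwise identities of
  top order take differentiability at the point as a hypothesis.\<close>

definition interval_families :: "real \<Rightarrow> real \<Rightarrow> (real \<times> real) set set" where
  "interval_families a b = {S. finite S \<and> (\<forall>p\<in>S. a \<le> fst p \<and> fst p < snd p \<and> snd p \<le> b) \<and>
     (\<forall>p\<in>S. \<forall>q\<in>S. p = q \<or> snd p \<le> fst q \<or> snd q \<le> fst p)}"

abbreviation total_length :: "(real \<times> real) set \<Rightarrow> real" where
  "total_length S \<equiv> (\<Sum>p\<in>S. snd p - fst p)"

definition jump_sum :: "(real \<Rightarrow> 'a::real_normed_vector) \<Rightarrow> (real \<times> real) set \<Rightarrow> real" where
  "jump_sum f S = (\<Sum>p\<in>S. norm (f (snd p) - f (fst p)))"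

text \<open>Intervals are encoded by their endpoints, so that families can be cut, refined and
  united by plain set operations. Values in any normed space let one notion serve for complex
  functions and for the real variation function.\<close>

definition abs_cont :: "real \<Rightarrow> real \<Rightarrow> (real \<Rightarrow> 'a::real_normed_vector) \<Rightarrow> bool" where
  "abs_cont a b f \<longleftrightarrow> (\<forall>\<epsilon>>0. \<exists>\<delta>>0. \<forall>S\<in>interval_families a b.
     total_length S < \<delta> \<longrightarrow> jump_sum f S < \<epsilon>)"

definition variation :: "(real \<Rightarrow> real) \<Rightarrow> real \<Rightarrow> real \<Rightarrow> real" where
  "variation f c d = (SUP S\<in>interval_families c d. jump_sum f S)"

text \<open>Passing from pairs to closed intervals is injective because the left endpoint is
  strictly below the right one; a family thus becomes a division with the same two sums.\<close>

lemma absolutely_continuous_fun_imp_abs_cont: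
  assumes "absolutely_continuous_fun a b f"
  shows "abs_cont a b f"
  unfolding abs_cont_def
proof (intro allI impI)
  fix \<epsilon> :: real assume "\<epsilon> > 0"
  then obtain \<delta> where "\<delta> > 0" and \<delta>: "\<And>\<D>. \<D> division_of \<Union>\<D> \<Longrightarrow> \<Union>\<D> \<subseteq> {a..b} \<Longrightarrow>
      (\<Sum>K\<in>\<D>. Sup K - Inf K) < \<delta> \<Longrightarrow> (\<Sum>K\<in>\<D>. norm (f (Sup K) - f (Inf K))) < \<epsilon>"
    using assms[unfolded absolutely_continuous_fun_def, rule_format, OF \<open>\<epsilon> > 0\<close>] by blast
  show "\<exists>\<delta>>0. \<forall>S\<in>interval_families a b. total_length S < \<delta> \<longrightarrow> jump_sum f S < \<epsilon>"
  proof (intro exI[of _ \<delta>] conjI ballI impI \<open>\<delta> > 0\<close>)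
    fix S assume S: "S \<in> interval_families a b" and len: "total_length S < \<delta>"
    define I where "I = (\<lambda>p::real\<times>real. {fst p..snd p})"
    have lt: "fst p < snd p" "a \<le> fst p" "snd p \<le> b" if "p \<in> S" for p
      using S that by (auto simp: interval_families_def)
    have inj: "inj_on I S"
    proof (rule inj_onI)
      fix p q assume "p \<in> S" "q \<in> S" "I p = I q"
      then show "p = q" using lt[of p] lt[of q] by (simp add: I_def prod_eq_iff)
    qed
    have "I ` S division_of \<Union>(I ` S)"
    proof (rule division_ofI)
      show "finite (I ` S)" using S by (auto simp: interval_families_def)
      fix K assume "K \<in> I ` S"
      then obtain p where p: "p \<in> S" "K = I p" by auto
      show "K \<subseteq> \<Union>(I ` S)" using p by blast
      show "K \<noteq> {}" using lt[OF p(1)] p by (auto simp: I_def)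
      show "\<exists>a b. K = cbox a b" using p by (auto simp: I_def)
      fix L assume "L \<in> I ` S" "K \<noteq> L"
      then obtain q where q: "q \<in> S" "L = I q" by auto
      with \<open>K \<noteq> L\<close> p have "p \<noteq> q" by auto
      with S p q have "snd p \<le> fst q \<or> snd q \<le> fst p"
        by (force simp: interval_families_def)
      then show "interior K \<inter> interior L = {}"
        using p q by (auto simp: I_def)
    qed auto
    moreover have "\<Union>(I ` S) \<subseteq> {a..b}" using lt by (force simp: I_def)
    moreover have "(\<Sum>K\<in>I ` S. Sup K - Inf K) = total_length S"
      using lt by (subst sum.reindex[OF inj]) (auto simp: I_def less_imp_le intro!: sum.cong)
    moreover have "(\<Sum>K\<in>I ` S. norm (f (Sup K) - f (Inf K))) = jump_sum f S"
      using lt by (subst sum.reindex[OF inj])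
        (auto simp: I_def jump_sum_def less_imp_le intro!: sum.cong)
    ultimately show "jump_sum f S < \<epsilon>" using \<delta>[of "I ` S"] len by simp
  qed
qed

section \<open>Interval families and the variation of a function\<close>

text \<open>Half-open intervals make neighbours with a common endpoint disjoint. Length becomes a
  measure, and its monotonicity under inclusion comes without sorting the intervals.\<close>

lemma total_length_eq_measure:
  assumes "S \<in> interval_families a b"
  shows "total_length S = measure lborel (\<Union>p\<in>S. {fst p<..snd p})"
proof -
  have "measure lborel (\<Union>p\<in>S. {fst p<..snd p}) = (\<Sum>p\<in>S. measure lborel {fst p<..snd p})"
  proof (rule measure_finite_Union)
    show "finite S" using assms by (auto simp: interval_families_def)
    show "disjoint_family_on (\<lambda>p. {fst p<..snd p}) S"
      unfolding disjoint_family_on_def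
    proof (intro ballI impI)
      fix p q assume "p \<in> S" "q \<in> S" "p \<noteq> q"
      then have "snd p \<le> fst q \<or> snd q \<le> fst p" using assms by (auto simp: interval_families_def)
      then show "{fst p<..snd p} \<inter> {fst q<..snd q} = {}" by auto
    qed
    show "emeasure lborel {fst p<..snd p} \<noteq> \<infinity>" if "p \<in> S" for p
      using assms that emeasure_lborel_Ioc[of "fst p" "snd p"]
      by (auto simp: interval_families_def less_imp_le)
  qed auto
  also have "\<dots> = total_length S"
    using assms by (intro sum.cong) (auto simp: interval_families_def less_imp_le)
  finally show ?thesis by simp
qed

lemma total_length_le:
  assumes "S \<in> interval_families a b" "a \<le> b"
  shows "total_length S \<le> b - a"
proof -
  have "total_length S \<le> measure lborel {a<..b}"
    unfolding total_length_eq_measure[OF assms(1)]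
  proof (rule measure_mono_fmeasurable)
    show "(\<Union>p\<in>S. {fst p<..snd p}) \<subseteq> {a<..b}"
      using assms(1) by (force simp: interval_families_def)
    show "(\<Union>p\<in>S. {fst p<..snd p}) \<in> sets lborel"
      using assms(1) by (auto simp: interval_families_def intro!: sets.finite_UN)
  qed (use assms(2) in \<open>auto simp: fmeasurable_def emeasure_lborel_Ioc\<close>)
  then show ?thesis using assms by simp
qed

lemma empty_interval_families [simp]: "{} \<in> interval_families c d"
  by (simp add: interval_families_def)

text \<open>An interval that crosses \<open>m\<close> is cut there and occurs in both
  \<open>L\<close> and \<open>R\<close>; the triangle inequality through \<open>f m\<close> pays for
  the cut.\<close>

lemma interval_families_split:
  fixes f :: "real \<Rightarrow> 'a::real_normed_vector"
  assumes S: "S \<in> interval_families c d" and m: "c \<le> m" "m \<le> d"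
  obtains S1 S2 where "S1 \<in> interval_families c m" "S2 \<in> interval_families m d"
    "jump_sum f S \<le> jump_sum f S1 + jump_sum f S2"
proof
  define L where "L = {p\<in>S. fst p < m}"
  define R where "R = {p\<in>S. m < snd p}"
  define l where "l = (\<lambda>p::real\<times>real. (fst p, min (snd p) m))"
  define r where "r = (\<lambda>p::real\<times>real. (max (fst p) m, snd p))"
  have fin: "finite S" and lt: "\<And>p. p \<in> S \<Longrightarrow> c \<le> fst p \<and> fst p < snd p \<and> snd p \<le> d"
    and ov: "\<And>p q. p \<in> S \<Longrightarrow> q \<in> S \<Longrightarrow> p = q \<or> snd p \<le> fst q \<or> snd q \<le> fst p"
    using S by (auto simp: interval_families_def)
  have injl: "inj_on l L"
  proof (rule inj_onI)
    fix p q assume "p \<in> L" "q \<in> L" "l p = l q"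
    then show "p = q" using ov[of p q] lt[of p] lt[of q] by (auto simp: l_def L_def)
  qed
  have injr: "inj_on r R"
  proof (rule inj_onI)
    fix p q assume "p \<in> R" "q \<in> R" "r p = r q"
    then show "p = q" using ov[of p q] lt[of p] lt[of q] by (auto simp: r_def R_def)
  qed
  show "l ` L \<in> interval_families c m" "r ` R \<in> interval_families m d"
  proof -
    show "l ` L \<in> interval_families c m"
      unfolding interval_families_def
    proof (intro CollectI conjI)
      show "finite (l ` L)" using fin by (simp add: L_def)
      show "\<forall>p\<in>l ` L. c \<le> fst p \<and> fst p < snd p \<and> snd p \<le> m"
        using lt by (auto simp: l_def L_def)
      show "\<forall>p\<in>l ` L. \<forall>q\<in>l ` L. p = q \<or> snd p \<le> fst q \<or> snd q \<le> fst p"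
      proof (intro ballI)
        fix x y assume "x \<in> l ` L" "y \<in> l ` L"
        then obtain p q where "p \<in> L" "x = l p" "q \<in> L" "y = l q" by blast
        then show "x = y \<or> snd x \<le> fst y \<or> snd y \<le> fst x"
          using ov[of p q] by (auto simp: l_def L_def)
      qed
    qed
    show "r ` R \<in> interval_families m d"
      unfolding interval_families_def
    proof (intro CollectI conjI)
      show "finite (r ` R)" using fin by (simp add: R_def)
      show "\<forall>p\<in>r ` R. m \<le> fst p \<and> fst p < snd p \<and> snd p \<le> d"
        using lt by (auto simp: r_def R_def)
      show "\<forall>p\<in>r ` R. \<forall>q\<in>r ` R. p = q \<or> snd p \<le> fst q \<or> snd q \<le> fst p"
      proof (intro ballI)
        fix x y assume "x \<in> r ` R" "y \<in> r ` R"
        then obtain p q where "p \<in> R" "x = r p" "q \<in> R" "y = r q" by blast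
        then show "x = y \<or> snd x \<le> fst y \<or> snd y \<le> fst x"
          using ov[of p q] by (auto simp: r_def R_def)
      qed
    qed
  qed
  define A where "A = (\<lambda>p. norm (f (snd (l p)) - f (fst (l p))))"
  define B where "B = (\<lambda>p. norm (f (snd (r p)) - f (fst (r p))))"
  have "jump_sum f S \<le> (\<Sum>p\<in>S. (if fst p < m then A p else 0) + (if m < snd p then B p else 0))"
    unfolding jump_sum_def
  proof (rule sum_mono)
    fix p assume "p \<in> S"
    have "f (snd p) - f (fst p) = (f m - f (fst p)) + (f (snd p) - f m)" by simp
    then have "norm (f (snd p) - f (fst p)) \<le> norm (f m - f (fst p)) + norm (f (snd p) - f m)"
      by (metis norm_triangle_ineq)
    then show "norm (f (snd p) - f (fst p)) \<le>
        (if fst p < m then A p else 0) + (if m < snd p then B p else 0)"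
      using lt[OF \<open>p \<in> S\<close>] by (auto simp: A_def B_def l_def r_def min_def max_def)
  qed
  also have "\<dots> = (\<Sum>p\<in>L. A p) + (\<Sum>p\<in>R. B p)"
    using fin by (simp add: sum.distrib L_def R_def sum.If_cases Int_def)
  also have "\<dots> = jump_sum f (l ` L) + jump_sum f (r ` R)"
    unfolding jump_sum_def A_def B_def sum.reindex[OF injl] sum.reindex[OF injr] by simp
  finally show "jump_sum f S \<le> jump_sum f (l ` L) + jump_sum f (r ` R)" .
qed

lemma interval_families_mono: "a \<le> c \<Longrightarrow> d \<le> b \<Longrightarrow> interval_families c d \<subseteq> interval_families a b"
  unfolding interval_families_def by force

text \<open>The interval is used up in steps of length \<delta>/2, each shorter than the \<delta>
  that belongs to \<epsilon> = 1, so that \<open>n\<close> steps bound every jump sum by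
  \<open>n\<close>.\<close>

lemma abs_cont_bounded_variation:
  fixes f :: "real \<Rightarrow> real"
  assumes "abs_cont a b f"
  shows "bdd_above (jump_sum f ` interval_families a b)"
proof (cases "a \<le> b")
  case True
  have "(1::real) > 0" by simp
  from assms[unfolded abs_cont_def, rule_format, OF this]
  obtain \<delta> where "\<delta> > 0" and \<delta>: "\<And>S. S \<in> interval_families a b \<Longrightarrow> total_length S < \<delta> \<Longrightarrow> jump_sum f S < 1"
    by blast
  have *: "jump_sum f S \<le> real n"
    if "S \<in> interval_families a d" "a \<le> d" "d \<le> b" "d - a \<le> real n * (\<delta> / 2)" for n S d
    using that
  proof (induction n arbitrary: S d)
    case 0
    then have "S = {}" by (force simp: interval_families_def)
    then show ?case by (simp add: jump_sum_def)
  next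
    case (Suc n)
    define m where "m = max a (d - \<delta> / 2)"
    have m: "a \<le> m" "m \<le> d" "m - a \<le> real n * (\<delta> / 2)" "d - m < \<delta>"
      using Suc.prems \<open>\<delta> > 0\<close> by (auto simp: m_def max_def algebra_simps)
    obtain S1 S2 where S12: "S1 \<in> interval_families a m" "S2 \<in> interval_families m d"
      "jump_sum f S \<le> jump_sum f S1 + jump_sum f S2"
      using interval_families_split[OF Suc.prems(1) m(1,2)] by metis
    have "jump_sum f S1 \<le> real n" using Suc.IH[OF S12(1)] m Suc.prems by simp
    moreover have "jump_sum f S2 < 1"
      using total_length_le[OF S12(2)] m Suc.prems interval_families_mono[of a m d b] S12(2)
      by (intro \<delta>) auto
    ultimately show ?case using S12(3) by simp
  qed
  obtain n where "b - a \<le> real n * (\<delta> / 2)"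
    using reals_Archimedean3[of "\<delta>/2"] \<open>\<delta> > 0\<close> by (meson half_gt_zero less_imp_le)
  then show ?thesis using *[of _ b n] True by (intro bdd_aboveI[of _ "real n"]) auto
next
  case False
  then have "interval_families a b = {{}}" by (force simp: interval_families_def)
  then show ?thesis by simp
qed

text \<open>One inequality comes from cutting a family at \<open>m\<close>, the other from uniting
  families on the two sides. Boundedness of the jump sums is what makes the suprema
  meaningful.\<close>

lemma variation_add:
  fixes f :: "real \<Rightarrow> real"
  assumes ac: "abs_cont a b f" and o: "a \<le> c" "c \<le> m" "m \<le> d" "d \<le> b"
  shows "variation f c d = variation f c m + variation f m d"
proof (rule antisym)
  have bdd: "bdd_above (jump_sum f ` interval_families x y)" if "a \<le> x" "y \<le> b" for x y
    using abs_cont_bounded_variation[OF ac] interval_families_mono[OF that]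
    by (meson bdd_above_mono image_mono)
  show "variation f c d \<le> variation f c m + variation f m d"
    unfolding variation_def[of f c d]
  proof (rule cSUP_least)
    fix S assume "S \<in> interval_families c d"
    then obtain S1 S2 where S12: "S1 \<in> interval_families c m" "S2 \<in> interval_families m d"
      "jump_sum f S \<le> jump_sum f S1 + jump_sum f S2"
      using interval_families_split o by metis
    moreover have "jump_sum f S1 \<le> variation f c m" "jump_sum f S2 \<le> variation f m d"
      unfolding variation_def using S12 bdd o by (auto intro!: cSUP_upper)
    ultimately show "jump_sum f S \<le> variation f c m + variation f m d" by simp
  qed (use empty_interval_families in blast)
  have *: "jump_sum f S1 + jump_sum f S2 \<le> variation f c d"
    if S: "S1 \<in> interval_families c m" "S2 \<in> interval_families m d" for S1 S2
  proof -
    have "S1 \<inter> S2 = {}" using S by (force simp: interval_families_def)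
    then have "jump_sum f S1 + jump_sum f S2 = jump_sum f (S1 \<union> S2)"
      using S by (auto simp: jump_sum_def interval_families_def sum.union_disjoint)
    moreover have "S1 \<union> S2 \<in> interval_families c d"
    proof -
      have "snd p \<le> fst q" if "p \<in> S1" "q \<in> S2" for p q
        using S that by (auto simp: interval_families_def intro: order_trans)
      moreover have "finite S1" "finite S2"
          "\<forall>p\<in>S1. c \<le> fst p \<and> fst p < snd p \<and> snd p \<le> m"
          "\<forall>p\<in>S2. m \<le> fst p \<and> fst p < snd p \<and> snd p \<le> d"
          "\<forall>p\<in>S1. \<forall>q\<in>S1. p = q \<or> snd p \<le> fst q \<or> snd q \<le> fst p"
          "\<forall>p\<in>S2. \<forall>q\<in>S2. p = q \<or> snd p \<le> fst q \<or> snd q \<le> fst p"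
        using S by (auto simp: interval_families_def)
      ultimately show ?thesis
        using o unfolding interval_families_def by (auto intro: order_trans)
    qed
    ultimately show ?thesis
      unfolding variation_def using bdd o by (auto intro!: cSUP_upper)
  qed
  have ne: "interval_families x y \<noteq> {}" for x y
    using empty_interval_families by blast
  have "variation f c m \<le> variation f c d - jump_sum f S2" if "S2 \<in> interval_families m d" for S2
    unfolding variation_def[of f c m] using *[OF _ that]
    by (intro cSUP_least[OF ne]) (auto simp: algebra_simps)
  then have "variation f m d \<le> variation f c d - variation f c m"
    unfolding variation_def[of f m d]
    by (intro cSUP_least[OF ne]) (auto simp: algebra_simps)
  then show "variation f c m + variation f m d \<le> variation f c d" by simp
qed

lemma variation_ge:
  fixes f :: "real \<Rightarrow> real"
  assumes ac: "abs_cont a b f" and o: "a \<le> c" "c \<le> d" "d \<le> b"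
  shows "\<bar>f d - f c\<bar> \<le> variation f c d"
proof -
  have bdd: "bdd_above (jump_sum f ` interval_families c d)"
    using abs_cont_bounded_variation[OF ac] interval_families_mono o
    by (meson bdd_above_mono image_mono)
  have "jump_sum f (if c < d then {(c,d)} else {}) \<le> variation f c d"
    unfolding variation_def by (rule cSUP_upper[OF _ bdd]) (auto simp: interval_families_def)
  then show ?thesis using o by (auto simp: jump_sum_def split: if_splits)
qed

text \<open>Refinement of a family: it lets near-optimal families, chosen separately inside the
  intervals of \<open>P\<close>, be treated as a single one.\<close>

lemma interval_families_UN:
  assumes P: "P \<in> interval_families a b"
    and S: "\<And>p. p \<in> P \<Longrightarrow> S p \<in> interval_families (fst p) (snd p)"
  shows "(\<Union>p\<in>P. S p) \<in> interval_families a b"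
    and "(\<Sum>q\<in>(\<Union>p\<in>P. S p). g q) = (\<Sum>p\<in>P. \<Sum>q\<in>S p. (g q :: real))"
proof -
  have inside: "fst p \<le> fst q \<and> fst q < snd q \<and> snd q \<le> snd p" if "p \<in> P" "q \<in> S p" for p q
    using S[OF that(1)] that(2) by (auto simp: interval_families_def)
  show "(\<Union>p\<in>P. S p) \<in> interval_families a b"
    unfolding interval_families_def
  proof (intro CollectI conjI ballI)
    show "finite (\<Union>p\<in>P. S p)" using P S by (auto simp: interval_families_def)
    fix x assume "x \<in> (\<Union>p\<in>P. S p)"
    then obtain p where p: "p \<in> P" "x \<in> S p" by auto
    show "a \<le> fst x" "fst x < snd x" "snd x \<le> b"
      using inside[OF p] P p(1) by (force simp: interval_families_def)+
    fix y assume "y \<in> (\<Union>p\<in>P. S p)"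
    then obtain q where q: "q \<in> P" "y \<in> S q" by auto
    show "x = y \<or> snd x \<le> fst y \<or> snd y \<le> fst x"
    proof (cases "p = q")
      case True
      then show ?thesis using S[OF p(1)] p q by (auto simp: interval_families_def)
    next
      case False
      then have "snd p \<le> fst q \<or> snd q \<le> fst p"
        using P p(1) q(1) by (force simp: interval_families_def)
      then show ?thesis using inside[OF p] inside[OF q] by auto
    qed
  qed
  show "(\<Sum>q\<in>(\<Union>p\<in>P. S p). g q) = (\<Sum>p\<in>P. \<Sum>q\<in>S p. g q)"
  proof (rule sum.UNION_disjoint)
    show "finite P" "\<forall>p\<in>P. finite (S p)" using P S by (auto simp: interval_families_def)
    show "\<forall>p\<in>P. \<forall>q\<in>P. p \<noteq> q \<longrightarrow> S p \<inter> S q = {}"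
    proof (intro ballI impI)
      fix p q assume pq: "p \<in> P" "q \<in> P" "p \<noteq> q"
      then have "snd p \<le> fst q \<or> snd q \<le> fst p"
        using P by (force simp: interval_families_def)
      then show "S p \<inter> S q = {}" using inside[OF pq(1)] inside[OF pq(2)] by force
    qed
  qed
qed

text \<open>The variation over each interval is nearly attained by a family inside it. The union of
  these families is no longer than the original one, so absolute continuity of f bounds its jump
  sum.\<close>

lemma abs_cont_variation:
  fixes f :: "real \<Rightarrow> real"
  assumes ac: "abs_cont a b f"
  shows "abs_cont a b (variation f a)"
  unfolding abs_cont_def
proof (intro allI impI)
  fix \<epsilon> :: real assume "\<epsilon> > 0"
  then have "\<epsilon> / 2 > 0" by simp
  from ac[unfolded abs_cont_def, rule_format, OF this]
  obtain \<delta> where "\<delta> > 0" and \<delta>: "\<And>S. S \<in> interval_families a b \<Longrightarrow> total_length S < \<delta> \<Longrightarrow>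
      jump_sum f S < \<epsilon> / 2" by blast
  show "\<exists>\<delta>>0. \<forall>S\<in>interval_families a b. total_length S < \<delta> \<longrightarrow> jump_sum (variation f a) S < \<epsilon>"
  proof (intro exI[of _ \<delta>] conjI ballI impI \<open>\<delta> > 0\<close>)
    fix P assume P: "P \<in> interval_families a b" and len: "total_length P < \<delta>"
    have Pab: "a \<le> fst p" "fst p < snd p" "snd p \<le> b" if "p \<in> P" for p
      using P that by (auto simp: interval_families_def)
    have finP: "finite P" using P by (auto simp: interval_families_def)
    \<comment> \<open>The \<open>+ 1\<close> covers the empty family and leaves the total error
      \<open>card P * \<eta>\<close> strictly below \<epsilon>/2.\<close>
    define \<eta> where "\<eta> = \<epsilon> / (2 * (card P + 1))"
    have "\<eta> > 0" using \<open>\<epsilon> > 0\<close> by (simp add: \<eta>_def)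
    have "\<exists>S\<in>interval_families (fst p) (snd p). variation f (fst p) (snd p) - \<eta> < jump_sum f S"
      if "p \<in> P" for p
    proof -
      have bdd: "bdd_above (jump_sum f ` interval_families (fst p) (snd p))"
        using abs_cont_bounded_variation[OF ac] interval_families_mono Pab[OF that]
        by (meson bdd_above_mono image_mono)
      show ?thesis
        using \<open>\<eta> > 0\<close> less_cSUP_iff[OF _ bdd, of "variation f (fst p) (snd p) - \<eta>"]
          empty_interval_families[of "fst p" "snd p"]
        unfolding variation_def by fastforce
    qed
    then obtain S where S: "\<And>p. p \<in> P \<Longrightarrow> S p \<in> interval_families (fst p) (snd p)"
      and less: "\<And>p. p \<in> P \<Longrightarrow> variation f (fst p) (snd p) < jump_sum f (S p) + \<eta>"
      by (metis diff_less_eq)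
    note U = interval_families_UN[OF P S]
    have "total_length (\<Union>p\<in>P. S p) \<le> total_length P"
      unfolding U(2)[of "\<lambda>q. snd q - fst q", simplified]
      using S Pab by (intro sum_mono total_length_le) (auto simp: less_imp_le)
    then have "jump_sum f (\<Union>p\<in>P. S p) < \<epsilon> / 2"
      using U(1) len by (intro \<delta>) auto
    moreover have "jump_sum f (\<Union>p\<in>P. S p) = (\<Sum>p\<in>P. jump_sum f (S p))"
      unfolding jump_sum_def by (rule U(2))
    moreover have "jump_sum (variation f a) P = (\<Sum>p\<in>P. variation f (fst p) (snd p))"
      unfolding jump_sum_def
    proof (rule sum.cong[OF refl])
      fix p assume p: "p \<in> P"
      have "variation f a (snd p) = variation f a (fst p) + variation f (fst p) (snd p)"
        using Pab[OF p] by (intro variation_add[OF ac]) auto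
      moreover have "0 \<le> variation f (fst p) (snd p)"
        using variation_ge[OF ac, of "fst p" "snd p"] Pab[OF p] by simp
      ultimately show "norm (variation f a (snd p) - variation f a (fst p)) = variation f (fst p) (snd p)"
        by simp
    qed
    moreover have "(\<Sum>p\<in>P. variation f (fst p) (snd p)) \<le> (\<Sum>p\<in>P. jump_sum f (S p) + \<eta>)"
      using less by (intro sum_mono less_imp_le) auto
    moreover have "(\<Sum>p\<in>P. jump_sum f (S p) + \<eta>) = (\<Sum>p\<in>P. jump_sum f (S p)) + card P * \<eta>"
      by (simp add: sum.distrib)
    moreover have "card P * \<eta> < \<epsilon> / 2"
      using \<open>\<epsilon> > 0\<close> by (simp add: \<eta>_def field_simps)
    ultimately show "jump_sum (variation f a) P < \<epsilon>" by linarith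
  qed
qed

lemma abs_cont_diff:
  fixes f g :: "real \<Rightarrow> 'a::real_normed_vector"
  assumes "abs_cont a b f" "abs_cont a b g"
  shows "abs_cont a b (\<lambda>x. f x - g x)"
  unfolding abs_cont_def
proof (intro allI impI)
  fix \<epsilon> :: real assume "\<epsilon> > 0"
  then have "\<epsilon> / 2 > 0" by simp
  obtain \<delta> where "\<delta> > 0" and \<delta>: "\<forall>S\<in>interval_families a b. total_length S < \<delta> \<longrightarrow> jump_sum f S < \<epsilon> / 2"
    using assms(1)[unfolded abs_cont_def, rule_format, OF \<open>\<epsilon> / 2 > 0\<close>] by blast
  obtain \<delta>' where "\<delta>' > 0" and \<delta>': "\<forall>S\<in>interval_families a b. total_length S < \<delta>' \<longrightarrow> jump_sum g S < \<epsilon> / 2"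
    using assms(2)[unfolded abs_cont_def, rule_format, OF \<open>\<epsilon> / 2 > 0\<close>] by blast
  have *: "jump_sum (\<lambda>x. f x - g x) S \<le> jump_sum f S + jump_sum g S" for S
    unfolding jump_sum_def sum.distrib[symmetric]
  proof (rule sum_mono)
    fix p
    have "norm (f (snd p) - g (snd p) - (f (fst p) - g (fst p))) =
        norm ((f (snd p) - f (fst p)) - (g (snd p) - g (fst p)))"
      by (rule arg_cong[of _ _ norm]) (simp add: algebra_simps)
    also have "\<dots> \<le> norm (f (snd p) - f (fst p)) + norm (g (snd p) - g (fst p))"
      by (rule norm_triangle_ineq4)
    finally show "norm (f (snd p) - g (snd p) - (f (fst p) - g (fst p))) \<le>
        norm (f (snd p) - f (fst p)) + norm (g (snd p) - g (fst p))" .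
  qed
  show "\<exists>\<delta>>0. \<forall>S\<in>interval_families a b. total_length S < \<delta> \<longrightarrow> jump_sum (\<lambda>x. f x - g x) S < \<epsilon>"
  proof (intro exI[of _ "min \<delta> \<delta>'"] conjI ballI impI)
    fix S assume "S \<in> interval_families a b" "total_length S < min \<delta> \<delta>'"
    then show "jump_sum (\<lambda>x. f x - g x) S < \<epsilon>"
      using \<delta>[rule_format, of S] \<delta>'[rule_format, of S] *[of S] by simp
  qed (use \<open>\<delta> > 0\<close> \<open>\<delta>' > 0\<close> in auto)
qed

lemma abs_cont_imp_continuous_on:
  fixes f :: "real \<Rightarrow> 'a::real_normed_vector"
  assumes "abs_cont a b f"
  shows "continuous_on {a..b} f"
  unfolding continuous_on_iff
proof (intro ballI allI impI)
  fix x and \<epsilon> :: real assume x: "x \<in> {a..b}" and "\<epsilon> > 0"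
  then obtain \<delta> where d: "\<delta> > 0"
    "\<And>S. S \<in> interval_families a b \<Longrightarrow> total_length S < \<delta> \<Longrightarrow> jump_sum f S < \<epsilon>"
    using assms[unfolded abs_cont_def, rule_format, OF \<open>\<epsilon> > 0\<close>] by blast
  show "\<exists>d>0. \<forall>x'\<in>{a..b}. dist x' x < d \<longrightarrow> dist (f x') (f x) < \<epsilon>"
  proof (intro exI[of _ \<delta>] conjI ballI impI d(1))
    fix y assume y: "y \<in> {a..b}" "dist y x < \<delta>"
    have "dist (f y) (f x) < \<epsilon>" if "x < y"
      using d(2)[of "{(x,y)}"] that x y
      by (auto simp: interval_families_def jump_sum_def dist_norm)
    moreover have "dist (f y) (f x) < \<epsilon>" if "y < x"
      using d(2)[of "{(y,x)}"] that x y
      by (auto simp: interval_families_def jump_sum_def dist_norm norm_minus_commute)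
    ultimately show "dist (f y) (f x) < \<epsilon>" using \<open>\<epsilon> > 0\<close> by (cases x y rule: linorder_cases) auto
  qed
qed

section \<open>Densities from the Radon-Nikodym theorem\<close>

text \<open>A Lebesgue null set lies in an open set of measure below \<delta>. Finite parts of a
  cover of that set by boxes divide into non-overlapping intervals, on which g increases by less
  than \<open>e\<close> in total, and exhaustion carries the bound over to the open set. Extending g
  by constants gives the function on the whole line that \<open>interval_measure\<close>
  takes.\<close>

lemma abs_cont_mono_null_sets:
  fixes g :: "real \<Rightarrow> real"
  assumes ac: "abs_cont a b g" and ab: "a \<le> b"
    and mono: "\<And>x y. a \<le> x \<Longrightarrow> x \<le> y \<Longrightarrow> y \<le> b \<Longrightarrow> g x \<le> g y"
  defines "G \<equiv> \<lambda>x. g (max a (min b x))"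
  shows "absolutely_continuous lborel (interval_measure G)"
proof -
  \<comment> \<open>Clamping to [a, b] turns an interval into its part in [a, b] or into a point, so
    clamped intervals still do not overlap and stay inside the open set when taken
    half-open.\<close>
  define cl where "cl = (\<lambda>x. max a (min b x))"
  define M where "M = interval_measure G"
  have Gcl: "G x = g (cl x)" for x by (simp add: G_def cl_def)
  have cl: "a \<le> cl x" "cl x \<le> b" "x \<le> y \<Longrightarrow> cl x \<le> cl y" "x \<le> y \<Longrightarrow> cl y - cl x \<le> y - x" for x y
    using ab by (auto simp: cl_def)
  have monoG: "G x \<le> G y" if "x \<le> y" for x y
    using mono cl that by (simp add: Gcl)
  have contG: "continuous_on UNIV G"
    unfolding G_def using ab
    by (intro continuous_on_compose2[OF abs_cont_imp_continuous_on[OF ac]] continuous_intros) auto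
  have Icc: "emeasure M {x..y} = ennreal (G y - G x)" if "x \<le> y" for x y
    unfolding M_def by (rule emeasure_interval_measure_Icc[OF that monoG contG])
  have small: "emeasure M A \<le> ennreal e" if A: "A \<in> null_sets lborel" and "e > 0" for A e
  proof -
    obtain \<delta> where "\<delta> > 0" and \<delta>: "\<forall>S\<in>interval_families a b. total_length S < \<delta> \<longrightarrow> jump_sum g S < e"
      using ac[unfolded abs_cont_def, rule_format, OF \<open>e > 0\<close>] by blast
    have "A \<in> sets borel" "emeasure lborel A = 0" using A by auto
    obtain U where U: "open U" "A \<subseteq> U" "emeasure lborel (U - A) < ennreal \<delta>"
      using outer_regular_lborel[OF \<open>A \<in> sets borel\<close> \<open>\<delta> > 0\<close>] by blast
    have "emeasure lborel U < ennreal \<delta>"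
      using U A \<open>A \<in> sets borel\<close> by (simp add: emeasure_Diff_null_set)
    obtain \<D> where D: "countable \<D>" "\<D> \<subseteq> Pow U" "\<And>X. X \<in> \<D> \<Longrightarrow> \<exists>a b. X = cbox a b" "\<Union>\<D> = U"
      using open_countable_Union_open_cbox[OF U(1)] by metis
    \<comment> \<open>The empty box keeps the cover nonempty even if \<open>U\<close> is empty, so
      that \<open>from_nat_into\<close> enumerates it.\<close>
    define E where "E = insert {} \<D>"
    have "\<exists>x y::real. {} = cbox x y" by (rule exI[of _ 1], rule exI[of _ 0]) simp
    then have E: "countable E" "E \<noteq> {}" "\<And>X. X \<in> E \<Longrightarrow> \<exists>a b. X = cbox a b" "\<Union>E = U"
      using D unfolding E_def by blast+
    define B where "B n = (\<Union>i\<le>n. from_nat_into E i)" for n :: nat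
    have "emeasure M (B n) \<le> ennreal e" for n
    proof -
      \<comment> \<open>The boxes of the cover may overlap; a finite union of them has a division
        into non-overlapping ones.\<close>
      obtain p where p: "p division_of \<Union>(from_nat_into E ` {..n})"
        using elementary_unions_intervals[of "from_nat_into E ` {..n}"] E(3) from_nat_into[OF E(2)]
        by (metis finite_atMost finite_imageI image_iff)
      have pB: "p division_of B n" using p by (simp add: B_def)
      have finp: "finite p" using pB by auto
      have K: "Inf K \<le> Sup K" "K = {Inf K..Sup K}" if Kp: "K \<in> p" for K
      proof -
        obtain x y where "K = cbox x y" "K \<noteq> {}" using division_ofD(3,4)[OF pB Kp] by blast
        then show "Inf K \<le> Sup K" "K = {Inf K..Sup K}" by auto
      qed
      define c where "c = (\<lambda>K::real set. (cl (Inf K), cl (Sup K)))"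
      \<comment> \<open>Intervals that the clamp collapses to a point are dropped: they contribute
        nothing to the increase of \<open>G\<close> and are not admissible in a family.\<close>
      define q where "q = {K\<in>p. cl (Inf K) < cl (Sup K)}"
      have sep: "Sup K \<le> Inf L \<or> Sup L \<le> Inf K" if "K \<in> q" "L \<in> q" "K \<noteq> L" for K L
      proof -
        have KL: "K \<in> p" "L \<in> p" "Inf K < Sup K" "Inf L < Sup L"
          using that cl(3)[of "Sup K" "Inf K"] cl(3)[of "Sup L" "Inf L"] by (auto simp: q_def not_le[symmetric])
        have "interior K \<inter> interior L = {}" using division_ofD(5)[OF pB KL(1,2) that(3)] .
        moreover have "interior K = {Inf K<..<Sup K}" "interior L = {Inf L<..<Sup L}"
          using K(2)[OF KL(1)] K(2)[OF KL(2)] by (metis interior_atLeastAtMost_real)+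
        ultimately have "{max (Inf K) (Inf L)<..<min (Sup K) (Sup L)} = {}" by auto
        then show ?thesis using KL(3,4) by (auto simp: greaterThanLessThan_empty_iff)
      qed
      have csep: "snd (c K) \<le> fst (c L) \<or> snd (c L) \<le> fst (c K)" if "K \<in> q" "L \<in> q" "K \<noteq> L" for K L
        using sep[OF that] cl(3) by (auto simp: c_def)
      have cq: "fst (c K) < snd (c K)" if "K \<in> q" for K
        using that by (simp add: q_def c_def)
      have inj: "inj_on c q"
        by (rule inj_onI) (use csep cq in \<open>metis less_le_not_le\<close>)
      have fam: "c ` q \<in> interval_families a b"
        unfolding interval_families_def
      proof (intro CollectI conjI ballI)
        show "finite (c ` q)" using finp by (simp add: q_def)
        fix x assume "x \<in> c ` q"
        then obtain K where K: "K \<in> q" "x = c K" by blast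
        show "fst x < snd x" using cq K by simp
        show "a \<le> fst x" "snd x \<le> b" using K cl by (simp_all add: c_def)
        fix y assume "y \<in> c ` q"
        then obtain L where L: "L \<in> q" "y = c L" by blast
        show "x = y \<or> snd x \<le> fst y \<or> snd y \<le> fst x" using csep[OF K(1) L(1)] K(2) L(2) by auto
      qed
      have "total_length (c ` q) = measure lborel (\<Union>x\<in>c ` q. {fst x<..snd x})"
        by (rule total_length_eq_measure[OF fam])
      also have "\<dots> \<le> measure lborel U"
      proof (rule measure_mono_fmeasurable)
        show "(\<Union>x\<in>c ` q. {fst x<..snd x}) \<subseteq> U"
        proof
          fix t assume "t \<in> (\<Union>x\<in>c ` q. {fst x<..snd x})"
          then obtain K where Kq: "K \<in> q" "cl (Inf K) < t" "t \<le> cl (Sup K)" by (auto simp: c_def)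
          then have "Inf K \<le> t" "t \<le> Sup K" using ab by (auto simp: cl_def)
          then have "t \<in> K" using K(2)[of K] Kq(1) by (metis (no_types, lifting) CollectD atLeastAtMost_iff q_def)
          then have "t \<in> B n" using division_ofD(2)[OF pB] Kq(1) by (auto simp: q_def)
          moreover have "B n \<subseteq> U" unfolding B_def E(4)[symmetric] using from_nat_into[OF E(2)] by auto
          ultimately show "t \<in> U" by auto
        qed
        show "(\<Union>x\<in>c ` q. {fst x<..snd x}) \<in> sets lborel"
          using finp by (auto simp: q_def intro!: sets.finite_UN)
        show "U \<in> fmeasurable lborel"
          using \<open>emeasure lborel U < ennreal \<delta>\<close> \<open>open U\<close>
          by (auto simp: fmeasurable_def elim: less_trans)
      qed
      also have "\<dots> < \<delta>"
        using \<open>emeasure lborel U < ennreal \<delta>\<close> \<open>\<delta> > 0\<close> unfolding measure_def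
        by (subst enn2real_less_iff) (auto elim: less_trans)
      finally have js: "jump_sum g (c ` q) < e" using \<delta> fam by blast
      have "emeasure M (B n) = emeasure M (\<Union>K\<in>p. K)"
        using division_ofD(6)[OF pB] by simp
      also have "\<dots> \<le> (\<Sum>K\<in>p. emeasure M K)"
        using finp K(2) by (intro emeasure_subadditive_finite) (auto simp: M_def, metis atLeastAtMost_borel)
      also have "\<dots> = (\<Sum>K\<in>p. ennreal (G (Sup K) - G (Inf K)))"
        using K by (intro sum.cong refl) (metis Icc)
      also have "\<dots> = ennreal (\<Sum>K\<in>p. G (Sup K) - G (Inf K))"
        using K(1) monoG by (intro sum_ennreal) (simp add: diff_ge_0_iff_ge)
      also have "(\<Sum>K\<in>p. G (Sup K) - G (Inf K)) = (\<Sum>K\<in>q. G (Sup K) - G (Inf K))"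
      proof (rule sum.mono_neutral_right[OF finp])
        show "\<forall>K\<in>p - q. G (Sup K) - G (Inf K) = 0"
        proof
          fix L assume "L \<in> p - q"
          then have "cl (Inf L) = cl (Sup L)" using K(1)[of L] cl(3)[of "Inf L" "Sup L"] by (auto simp: q_def)
          then show "G (Sup L) - G (Inf L) = 0" by (simp add: Gcl)
        qed
      qed (auto simp: q_def)
      also have "\<dots> = jump_sum g (c ` q)"
        unfolding jump_sum_def sum.reindex[OF inj]
      proof (rule sum.cong[OF refl])
        fix L assume "L \<in> q"
        then have "g (cl (Inf L)) \<le> g (cl (Sup L))" using K(1) by (intro mono cl) (auto simp: q_def)
        then show "G (Sup L) - G (Inf L) = ((\<lambda>x. norm (g (snd x) - g (fst x))) \<circ> c) L"
          by (simp add: c_def Gcl)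
      qed
      also have "ennreal \<dots> \<le> ennreal e" using js by (simp add: ennreal_leI)
      finally show ?thesis .
    qed
    have "U = (\<Union>n. B n)"
    proof -
      have "U = (\<Union>i. from_nat_into E i)"
        using range_from_nat_into[OF E(2,1)] E(4) by simp
      then show ?thesis unfolding B_def by blast
    qed
    moreover have "incseq B" unfolding incseq_def B_def by (intro allI impI UN_mono) auto
    moreover have "range B \<subseteq> sets M"
    proof -
      have "from_nat_into E i \<in> sets M" for i
        using E(3)[OF from_nat_into[OF E(2)], of i] unfolding M_def sets_interval_measure
        by (metis borel_closed closed_cbox)
      then show ?thesis by (auto simp: B_def)
    qed
    ultimately have "emeasure M U = (SUP n. emeasure M (B n))"
      by (simp add: SUP_emeasure_incseq)
    also have "\<dots> \<le> ennreal e" using \<open>\<And>n. emeasure M (B n) \<le> ennreal e\<close> by (rule SUP_least)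
    finally show ?thesis
      using emeasure_mono[OF U(2), of M] U(1) by (auto simp: M_def)
  qed
  show ?thesis
    unfolding absolutely_continuous_def M_def[symmetric]
  proof
    fix A :: "real set" assume A: "A \<in> null_sets lborel"
    have "emeasure M A = 0"
      using small[OF A] by (metis ennreal_zero_less_divide le_zero_eq ennreal_le_epsilon add_0)
    then show "A \<in> null_sets M" using A by (auto simp: null_sets_def M_def)
  qed
qed

lemma abs_cont_mono_density:
  fixes g :: "real \<Rightarrow> real"
  assumes ac: "abs_cont a b g" and ab: "a \<le> b"
    and mono: "\<And>x y. a \<le> x \<Longrightarrow> x \<le> y \<Longrightarrow> y \<le> b \<Longrightarrow> g x \<le> g y"
  obtains h :: "real \<Rightarrow> real" where "integrable lborel h"
    "\<And>x. x \<in> {a..b} \<Longrightarrow> g x - g a = (LINT y:{a<..x}|lborel. h y)"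
proof -
  define G where "G = (\<lambda>x. g (max a (min b x)))"
  have monoG: "G x \<le> G y" if "x \<le> y" for x y
    using mono ab that by (simp add: G_def)
  have contG: "continuous_on UNIV G"
    unfolding G_def using ab
    by (intro continuous_on_compose2[OF abs_cont_imp_continuous_on[OF ac]] continuous_intros) auto
  have rc: "continuous (at_right x) G" for x
    using contG by (auto simp: continuous_on_eq_continuous_within intro: continuous_within_subset)
  obtain f where f: "f \<in> borel_measurable lborel" "density lborel f = interval_measure G"
    using sigma_finite_measure.Radon_Nikodym[OF sigma_finite_lborel abs_cont_mono_null_sets[OF ac ab mono]] by (auto simp: G_def)
  have E: "(\<integral>\<^sup>+y. f y * indicator {a<..x} y \<partial>lborel) = ennreal (g x - g a)" if "x \<in> {a..b}" for x
  proof -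
    have "(\<integral>\<^sup>+y. f y * indicator {a<..x} y \<partial>lborel) = emeasure (density lborel f) {a<..x}"
      using f(1) by (simp add: emeasure_density)
    also have "\<dots> = ennreal (G x - G a)"
      unfolding f(2) using that by (intro emeasure_interval_measure_Ioc monoG rc) auto
    finally show ?thesis using that ab by (simp add: G_def)
  qed
  \<comment> \<open>The Radon-Nikodym derivative takes extended values. Cut off to
    \<open>{a<..b}\<close> it has the finite integral \<open>g b - g a\<close>, so passing to real
    values changes it only on a null set.\<close>
  define h where "h = (\<lambda>y. enn2real (f y * indicator {a<..b} y))"
  have [measurable]: "f \<in> borel_measurable borel" using f(1) by simp
  have [measurable]: "h \<in> borel_measurable borel" unfolding h_def by measurable
  have fin: "AE y in lborel. f y * indicator {a<..b} y \<noteq> \<infinity>"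
    using E[of b] ab by (intro nn_integral_PInf_AE) auto
  then have hf: "AE y in lborel. ennreal (h y) = f y * indicator {a<..b} y"
    by eventually_elim (auto simp: h_def ennreal_enn2real_if)
  show thesis
  proof (rule that)
    have "(\<integral>\<^sup>+y. ennreal (h y) \<partial>lborel) = (\<integral>\<^sup>+y. f y * indicator {a<..b} y \<partial>lborel)"
      using hf by (rule nn_integral_cong_AE)
    then show "integrable lborel h"
      using E[of b] ab by (intro integrableI_nonneg) (auto simp: h_def)
    fix x assume x: "x \<in> {a..b}"
    have "(LINT y:{a<..x}|lborel. h y) = enn2real (\<integral>\<^sup>+y. ennreal (indicator {a<..x} y *\<^sub>R h y) \<partial>lborel)"
      unfolding set_lebesgue_integral_def by (intro integral_eq_nn_integral) (auto simp: h_def)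
    also have "(\<integral>\<^sup>+y. ennreal (indicator {a<..x} y *\<^sub>R h y) \<partial>lborel) = (\<integral>\<^sup>+y. f y * indicator {a<..x} y \<partial>lborel)"
      by (rule nn_integral_cong_AE, use hf in eventually_elim) (use x in \<open>auto simp: indicator_def\<close>)
    also have "enn2real \<dots> = g x - g a"
      using E[OF x] mono[of a x] x by simp
    finally show "g x - g a = (LINT y:{a<..x}|lborel. h y)" by simp
  qed
qed

text \<open>The variation \<open>V\<close> dominates the increments of f, so both \<open>V\<close>
  and \<open>V - f\<close> are nondecreasing as well as absolutely continuous, and f is their
  difference.\<close>

lemma abs_cont_real_density:
  fixes f :: "real \<Rightarrow> real"
  assumes ac: "abs_cont a b f" and ab: "a \<le> b"
  obtains h :: "real \<Rightarrow> real" where "integrable lborel h"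
    "\<And>x. x \<in> {a..b} \<Longrightarrow> f x - f a = (LINT y:{a<..x}|lborel. h y)"
proof -
  define V where "V = variation f a"
  have acV: "abs_cont a b V" unfolding V_def by (rule abs_cont_variation[OF ac])
  have V: "\<bar>f y - f x\<bar> \<le> V y - V x" if "a \<le> x" "x \<le> y" "y \<le> b" for x y
    using variation_add[OF ac, of a x y] variation_ge[OF ac, of x y] that by (simp add: V_def)
  obtain h where h: "integrable lborel h"
    "\<And>x. x \<in> {a..b} \<Longrightarrow> V x - V a = (LINT y:{a<..x}|lborel. h y)"
    using abs_cont_mono_density[OF acV ab] V by (smt (verit))
  obtain k where k: "integrable lborel k"
    "\<And>x. x \<in> {a..b} \<Longrightarrow> (V x - f x) - (V a - f a) = (LINT y:{a<..x}|lborel. k y)"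
    using abs_cont_mono_density[OF abs_cont_diff[OF acV ac] ab] V by (smt (verit))
  show thesis
  proof (rule that)
    show "integrable lborel (\<lambda>y. h y - k y)" using h k by auto
    fix x assume x: "x \<in> {a..b}"
    have "f x - f a = (V x - V a) - ((V x - f x) - (V a - f a))" by simp
    also have "\<dots> = (LINT y:{a<..x}|lborel. h y) - (LINT y:{a<..x}|lborel. k y)"
      unfolding h(2)[OF x] k(2)[OF x] ..
    also have "\<dots> = (LINT y:{a<..x}|lborel. h y - k y)"
      using h(1) k(1) unfolding set_integrable_def[symmetric]
      by (intro set_integral_diff(2)[symmetric]; unfold set_integrable_def; intro integrable_mult_indicator) auto
    finally show "f x - f a = (LINT y:{a<..x}|lborel. h y - k y)" .
  qed
qed

lemma abs_cont_complex_density: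
  fixes f :: "real \<Rightarrow> complex"
  assumes ac: "abs_cont a b f" and ab: "a \<le> b"
  obtains h :: "real \<Rightarrow> complex" where "integrable lborel h"
    "\<And>x. x \<in> {a..b} \<Longrightarrow> f x - f a = (LINT y:{a<..x}|lborel. h y)"
proof -
  have part: "abs_cont a b (\<lambda>x. P (f x))" if P: "\<And>z w. \<bar>P z - P w\<bar> \<le> norm (z - w)" for P :: "complex \<Rightarrow> real"
    unfolding abs_cont_def
  proof (intro allI impI)
    fix \<epsilon> :: real assume "\<epsilon> > 0"
    have "jump_sum (\<lambda>x. P (f x)) S \<le> jump_sum f S" for S
      unfolding jump_sum_def using P by (intro sum_mono) auto
    then show "\<exists>\<delta>>0. \<forall>S\<in>interval_families a b. total_length S < \<delta> \<longrightarrow> jump_sum (\<lambda>x. P (f x)) S < \<epsilon>"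
      using ac[unfolded abs_cont_def, rule_format, OF \<open>\<epsilon> > 0\<close>] by (meson le_less_trans)
  qed
  obtain h where h: "integrable lborel h"
    "\<And>x. x \<in> {a..b} \<Longrightarrow> Re (f x) - Re (f a) = (LINT y:{a<..x}|lborel. h y)"
    by (rule abs_cont_real_density[OF part[of Re] ab]) (metis abs_Re_le_cmod minus_complex.simps(1), blast)
  obtain k where k: "integrable lborel k"
    "\<And>x. x \<in> {a..b} \<Longrightarrow> Im (f x) - Im (f a) = (LINT y:{a<..x}|lborel. k y)"
    by (rule abs_cont_real_density[OF part[of Im] ab]) (metis abs_Im_le_cmod minus_complex.simps(2), blast)
  show thesis
  proof (rule that)
    show *: "integrable lborel (\<lambda>y. complex_of_real (h y) + \<i> * complex_of_real (k y))" using h k by auto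
    fix x assume x: "x \<in> {a..b}"
    let ?I = "LINT y:{a<..x}|lborel. complex_of_real (h y) + \<i> * complex_of_real (k y)"
    have i: "set_integrable lborel {a<..x} (\<lambda>y. complex_of_real (h y))"
       "set_integrable lborel {a<..x} (\<lambda>y. \<i> * complex_of_real (k y))"
      unfolding set_integrable_def using h k by (auto intro!: integrable_mult_indicator)
    have "?I = (LINT y:{a<..x}|lborel. complex_of_real (h y)) + \<i> * (LINT y:{a<..x}|lborel. complex_of_real (k y))"
      using set_integral_add(2)[OF i] by simp
    also have "\<dots> = complex_of_real (Re (f x) - Re (f a)) + \<i> * complex_of_real (Im (f x) - Im (f a))"
      unfolding set_integral_complex_of_real h(2)[OF x] k(2)[OF x] ..
    also have "\<dots> = f x - f a" by (simp add: complex_eq_iff)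
    finally show "f x - f a = ?I" by simp
  qed
qed

section \<open>Differentiation of indefinite integrals\<close>

text \<open>Lebesgue differentiation for all intervals that contain x: those with endpoint x give
  the derivative of an absolutely continuous function, symmetric ones the convergence of heat means.
  The bound is multiplied out so that u = v is allowed.\<close>

lemma AE_integral_average:
  fixes h :: "real \<Rightarrow> complex"
  assumes h: "integrable lborel h"
  shows "AE x in lborel. \<forall>\<epsilon>>0. \<exists>\<delta>>0. \<forall>u v. u \<le> x \<longrightarrow> x \<le> v \<longrightarrow> x - \<delta> < u \<longrightarrow> v < x + \<delta> \<longrightarrow>
    norm ((LINT y:{u..v}|lborel. h y) - of_real (v - u) * h x) \<le> \<epsilon> * (v - u)"
proof -
  have si: "set_integrable lborel S h" if "S \<in> sets borel" for S
    using h that by (auto simp: set_integrable_def intro: integrable_mult_indicator)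
  have int: "h integrable_on {u..v}" and eq: "(LINT y:{u..v}|lborel. h y) = integral {u..v} h" for u v
    using set_borel_integral_eq_integral[OF si[of "{u..v}"]] by auto
  \<comment> \<open>Averages to the left of x are averages of the reflected function to the right of
    \<open>- x\<close>.\<close>
  define k where "k = (\<lambda>x. h (- x))"
  have intk: "k integrable_on {u..v}" and eqk: "integral {u..v} k = integral {-v..-u} h" for u v
    using int[of "-v" "-u"]
      Henstock_Kurzweil_Integration.integrable_reflect_real[where f=h and a="-v" and b="-u"]
      Henstock_Kurzweil_Integration.integral_reflect_real[where f=h and a="-v" and b="-u"]
    by (simp_all add: k_def)
  obtain N where N: "negligible N" "\<And>x e. x \<notin> N \<Longrightarrow> 0 < e \<Longrightarrow>
     \<exists>d>0. \<forall>r. 0 < r \<and> r < d \<longrightarrow> norm (integral (cbox x (x + r *\<^sub>R One)) h /\<^sub>R r ^ DIM(real) - h x) < e"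
    using integrable_ccontinuous_explicit[of h] int by (metis box_real(2))
  obtain N' where N': "negligible N'" "\<And>x e. x \<notin> N' \<Longrightarrow> 0 < e \<Longrightarrow>
     \<exists>d>0. \<forall>r. 0 < r \<and> r < d \<longrightarrow> norm (integral (cbox x (x + r *\<^sub>R One)) k /\<^sub>R r ^ DIM(real) - k x) < e"
    using integrable_ccontinuous_explicit[of k] intk by (metis box_real(2))
  have bound: "norm (I - of_real r * c) \<le> e * r" if "r > 0" "norm (I /\<^sub>R r - c) < e" for I c :: complex and r e :: real
  proof -
    have "I - of_real r * c = of_real r * (I /\<^sub>R r - c)"
      using that(1) by (simp add: scaleR_conv_of_real field_simps)
    then have "norm (I - of_real r * c) = r * norm (I /\<^sub>R r - c)"
      using that(1) by (simp add: norm_mult)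
    then show ?thesis using that by (simp add: mult.commute mult_left_mono)
  qed
  have right: "\<exists>d>0. \<forall>v. x \<le> v \<longrightarrow> v < x + d \<longrightarrow> norm (integral {x..v} h - of_real (v - x) * h x) \<le> e * (v - x)"
    if xe: "x \<notin> N" "e > 0" for x e
  proof -
    obtain d where d: "d > 0" "\<And>r. 0 < r \<Longrightarrow> r < d \<Longrightarrow> norm (integral {x..x + r} h /\<^sub>R r - h x) < e"
      using N(2)[OF xe] by auto
    show ?thesis
    proof (intro exI[of _ d] conjI allI impI d(1))
      fix v assume "x \<le> v" "v < x + d"
      then show "norm (integral {x..v} h - of_real (v - x) * h x) \<le> e * (v - x)"
        using bound[OF _ d(2)[of "v - x"]] by (cases "v = x") auto
    qed
  qed
  have left: "\<exists>d>0. \<forall>u. u \<le> x \<longrightarrow> x - d < u \<longrightarrow> norm (integral {u..x} h - of_real (x - u) * h x) \<le> e * (x - u)"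
    if xe: "- x \<notin> N'" "e > 0" for x e
  proof -
    obtain d where d: "d > 0" "\<And>r. 0 < r \<Longrightarrow> r < d \<Longrightarrow> norm (integral {x-r..x} h /\<^sub>R r - h x) < e"
    proof -
      have "integral {-x..r - x} k = integral {x-r..x} h" "k (- x) = h x" for r
        using eqk[of "-x" "r - x"] by (simp_all add: k_def)
      then show ?thesis using N'(2)[OF xe] that by auto
    qed
    show ?thesis
    proof (intro exI[of _ d] conjI allI impI d(1))
      fix u assume "u \<le> x" "x - d < u"
      then show "norm (integral {u..x} h - of_real (x - u) * h x) \<le> e * (x - u)"
        using bound[OF _ d(2)[of "x - u"]] by (cases "u = x") auto
    qed
  qed
  have "negligible (uminus ` N')"
    using N'(1) by (intro negligible_differentiable_image_negligible) (auto intro!: derivative_intros)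
  then have "negligible (N \<union> uminus ` N')" using N(1) by (simp add: negligible_Un)
  then have "AE x in lebesgue. x \<notin> N \<union> uminus ` N'"
    unfolding negligible_iff_null_sets by (rule AE_not_in)
  then have "AE x in lborel. x \<notin> N \<union> uminus ` N'"
    by (simp add: AE_completion_iff)
  then show ?thesis
  proof (rule AE_mp, intro AE_I2 impI allI)
    fix x e :: real assume x: "x \<notin> N \<union> uminus ` N'" and "e > 0"
    have "- x \<notin> N'" using x by (metis UnI2 image_eqI minus_minus)
    obtain d where d: "d > 0" "\<And>v. x \<le> v \<Longrightarrow> v < x + d \<Longrightarrow> norm (integral {x..v} h - of_real (v - x) * h x) \<le> e * (v - x)"
      using right[of x e] x \<open>e > 0\<close> by auto
    obtain d' where d': "d' > 0" "\<And>u. u \<le> x \<Longrightarrow> x - d' < u \<Longrightarrow> norm (integral {u..x} h - of_real (x - u) * h x) \<le> e * (x - u)"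
      using left[OF \<open>- x \<notin> N'\<close> \<open>e > 0\<close>] by auto
    show "\<exists>\<delta>>0. \<forall>u v. u \<le> x \<longrightarrow> x \<le> v \<longrightarrow> x - \<delta> < u \<longrightarrow> v < x + \<delta> \<longrightarrow>
      norm ((LINT y:{u..v}|lborel. h y) - of_real (v - u) * h x) \<le> e * (v - u)"
    proof (intro exI[of _ "min d d'"] conjI allI impI)
      fix u v assume uv: "u \<le> x" "x \<le> v" "x - min d d' < u" "v < x + min d d'"
      have "integral {u..v} h = integral {u..x} h + integral {x..v} h"
        using Henstock_Kurzweil_Integration.integral_combine[where f=h and a=u and c=x and b=v] uv int by simp
      then have "(LINT y:{u..v}|lborel. h y) - of_real (v - u) * h x =
         (integral {u..x} h - of_real (x - u) * h x) + (integral {x..v} h - of_real (v - x) * h x)"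
        by (simp add: eq algebra_simps)
      also have "norm \<dots> \<le> e * (x - u) + e * (v - x)"
        using d(2)[of v] d'(2)[of u] uv by (intro norm_triangle_mono) auto
      finally show "norm ((LINT y:{u..v}|lborel. h y) - of_real (v - u) * h x) \<le> e * (v - u)"
        by (simp add: algebra_simps)
    qed (use d(1) d'(1) in auto)
  qed
qed

text \<open>The increments of f are integrals of the density \<open>h\<close>, so its difference
  quotients at x are averages of \<open>h\<close> over intervals with endpoint x, and these converge
  almost everywhere.\<close>

theorem abs_cont_derivative:
  fixes f :: "real \<Rightarrow> complex"
  assumes ac: "abs_cont a b f" and ab: "a \<le> b"
  obtains h :: "real \<Rightarrow> complex" where "integrable lborel h"
    "f b - f a = (LINT y:{a<..b}|lborel. h y)"
    "AE x in lborel. x \<in> {a<..<b} \<longrightarrow> (f has_vector_derivative h x) (at x)"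
proof -
  obtain h where h: "integrable lborel h"
    "\<And>x. x \<in> {a..b} \<Longrightarrow> f x - f a = (LINT y:{a<..x}|lborel. h y)"
    by (rule abs_cont_complex_density[OF ac ab]) blast
  have si: "set_integrable lborel S h" if "S \<in> sets borel" for S
    using h that by (auto simp: set_integrable_def intro: integrable_mult_indicator)
  have incr: "f v - f u = (LINT y:{u..v}|lborel. h y)" if "a \<le> u" "u \<le> v" "v \<le> b" for u v
  proof -
    have "(LINT y:{a<..v}|lborel. h y) = (LINT y:{a<..u} \<union> {u<..v}|lborel. h y)"
      using that by (simp add: ivl_disj_un)
    also have "\<dots> = (LINT y:{a<..u}|lborel. h y) + (LINT y:{u<..v}|lborel. h y)"
      by (rule set_integral_Un) (auto intro: si)
    also have "(LINT y:{u<..v}|lborel. h y) = (LINT y:{u..v}|lborel. h y)"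
    proof (rule set_integral_cong_set)
      show "AE y in lborel. (y \<in> {u..v}) = (y \<in> {u<..v})"
        using AE_lborel_singleton[of u] by eventually_elim auto
    qed (use h(1) in \<open>auto simp: set_borel_measurable_def\<close>)
    finally show ?thesis using h(2)[of u] h(2)[of v] that by (auto simp: algebra_simps)
  qed
  show thesis
  proof (rule that)
    show "integrable lborel h" by fact
    show "f b - f a = (LINT y:{a<..b}|lborel. h y)" using h(2)[of b] ab by simp
    show "AE x in lborel. x \<in> {a<..<b} \<longrightarrow> (f has_vector_derivative h x) (at x)"
    proof (rule AE_mp[OF AE_integral_average[OF h(1)]], intro AE_I2 impI)
      fix x assume lp: "\<forall>\<epsilon>>0. \<exists>\<delta>>0. \<forall>u v. u \<le> x \<longrightarrow> x \<le> v \<longrightarrow> x - \<delta> < u \<longrightarrow> v < x + \<delta> \<longrightarrow>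
          norm ((LINT y:{u..v}|lborel. h y) - of_real (v - u) * h x) \<le> \<epsilon> * (v - u)" and x: "x \<in> {a<..<b}"
      show "(f has_vector_derivative h x) (at x)"
        unfolding has_vector_derivative_def has_derivative_at_alt
      proof (intro conjI allI impI bounded_linear_scaleR_left)
        fix e :: real assume "e > 0"
        then obtain d where d: "d > 0" "\<And>u v. u \<le> x \<Longrightarrow> x \<le> v \<Longrightarrow> x - d < u \<Longrightarrow> v < x + d \<Longrightarrow>
          norm ((LINT y:{u..v}|lborel. h y) - of_real (v - u) * h x) \<le> e * (v - u)"
          using lp by blast
        show "\<exists>d>0. \<forall>y. norm (y - x) < d \<longrightarrow> norm (f y - f x - (y - x) *\<^sub>R h x) \<le> e * norm (y - x)"
        proof (intro exI[of _ "min d (min (x - a) (b - x))"] conjI allI impI)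
          fix y assume y: "norm (y - x) < min d (min (x - a) (b - x))"
          show "norm (f y - f x - (y - x) *\<^sub>R h x) \<le> e * norm (y - x)"
          proof (cases "x \<le> y")
            case True
            then show ?thesis
              using d(2)[of x y] incr[of x y] x y \<open>d > 0\<close> by (auto simp: scaleR_conv_of_real)
          next
            case False
            then have "norm (f x - f y - of_real (x - y) * h x) \<le> e * (x - y)"
              using d(2)[of y x] incr[of y x] x y \<open>d > 0\<close> by auto
            moreover have "f x - f y - of_real (x - y) * h x = - (f y - f x - (y - x) *\<^sub>R h x)"
              by (simp add: scaleR_conv_of_real algebra_simps)
            ultimately show ?thesis using False by (simp only: norm_minus_cancel) simp
          qed
        qed (use d(1) x in auto)
      qed
    qed
  qed
qed

section \<open>Poisson summation for the heat kernel\<close>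

text \<open>Trigonometric polynomials, in the form they take on the circle. Generation by monomials
  and sums reduces linear statements about them to a single \<open>powi\<close>.\<close>

inductive laurent_polynomial :: "(complex \<Rightarrow> complex) \<Rightarrow> bool" where
  monomial: "laurent_polynomial (\<lambda>z. c * z powi k)"
| add: "laurent_polynomial p \<Longrightarrow> laurent_polynomial q \<Longrightarrow> laurent_polynomial (\<lambda>z. p z + q z)"

text \<open>Exponents of \<open>powi\<close> add for nonzero arguments, so the product is again a
  Laurent polynomial up to its value at 0, a point that the circle avoids.\<close>

lemma laurent_polynomial_mult:
  assumes "laurent_polynomial p" "laurent_polynomial q"
  shows "\<exists>r. laurent_polynomial r \<and> (\<forall>z. z \<noteq> 0 \<longrightarrow> r z = p z * q z)"
  using assms(1)
proof induction
  case (monomial c k)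
  from assms(2) show ?case
  proof induction
    case (monomial d l)
    show ?case
      by (rule exI[of _ "\<lambda>z. (c * d) * z powi (k + l)"])
        (auto intro: laurent_polynomial.monomial simp: power_int_add)
  next
    case (add p q)
    then obtain r s where "laurent_polynomial r" "\<forall>z. z \<noteq> 0 \<longrightarrow> r z = c * z powi k * p z"
      "laurent_polynomial s" "\<forall>z. z \<noteq> 0 \<longrightarrow> s z = c * z powi k * q z" by blast
    then show ?case
      by (intro exI[of _ "\<lambda>z. r z + s z"]) (auto intro: laurent_polynomial.add simp: algebra_simps)
  qed
next
  case (add p' q')
  then obtain r s where "laurent_polynomial r" "\<forall>z. z \<noteq> 0 \<longrightarrow> r z = p' z * q z"
      "laurent_polynomial s" "\<forall>z. z \<noteq> 0 \<longrightarrow> s z = q' z * q z" by blast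
  then show ?case
    by (intro exI[of _ "\<lambda>z. r z + s z"]) (auto intro: laurent_polynomial.add simp: algebra_simps)
qed

lemma cnj_unit: "z \<in> sphere 0 1 \<Longrightarrow> cnj z = inverse z"
  by (metis complex_div_cnj div_by_1 dist_0_norm inverse_eq_divide mem_sphere mult_1 of_real_1 power_one)

text \<open>On the circle \<open>cnj z\<close> is \<open>inverse z\<close>, so Re z and Im z, and
  with them all real polynomials in the plane, are Laurent polynomials in z.\<close>

lemma real_polynomial_function_laurent:
  assumes "real_polynomial_function (p :: complex \<Rightarrow> real)"
  shows "\<exists>r. laurent_polynomial r \<and> (\<forall>z\<in>sphere 0 1. r z = of_real (p z))"
  using assms
proof induction
  case (linear f)
  \<comment> \<open>From Re z = (z + 1/z) / 2 and Im z = (z - 1/z) / (2 i), inserted into the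
    real-linear expansion f z = Re z f(1) + Im z f(i).\<close>
  define r where "r = (\<lambda>z. ((f 1 - \<i> * f \<i>) / 2) * z powi 1 + ((f 1 + \<i> * f \<i>) / 2) * z powi (-1))"
  have "laurent_polynomial r"
    unfolding r_def by (intro laurent_polynomial.intros)
  moreover have "r z = of_real (f z)" if "z \<in> sphere 0 1" for z
  proof -
    have "f z = f (Re z *\<^sub>R 1 + Im z *\<^sub>R \<i>)"
      by (rule arg_cong[of _ _ f]) (simp add: complex_eq_iff)
    also have "\<dots> = Re z * f 1 + Im z * f \<i>"
      using linear bounded_linear.linear[OF linear] by (simp add: linear_add linear_scale)
    finally have "complex_of_real (f z) = Re z * f 1 + Im z * f \<i>" by simp
    moreover have "z powi (-1) = cnj z" using cnj_unit[OF that] by (simp add: power_int_minus)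
    then have "r z = ((f 1 - \<i> * f \<i>) / 2) * z + ((f 1 + \<i> * f \<i>) / 2) * cnj z"
      unfolding r_def by (simp only: power_int_1_right)
    ultimately show ?thesis by (simp only:) (simp add: complex_eq_iff field_simps)
  qed
  ultimately show ?case by blast
next
  case (const c)
  show ?case
    using laurent_polynomial.monomial[of "of_real c" 0] by (intro exI[of _ "\<lambda>z. of_real c"]) simp
next
  case (add f g)
  then obtain r s where "laurent_polynomial r" "\<forall>z\<in>sphere 0 1. r z = of_real (f z)"
    "laurent_polynomial s" "\<forall>z\<in>sphere 0 1. s z = of_real (g z)" by blast
  then show ?case
    by (intro exI[of _ "\<lambda>z. r z + s z"]) (auto intro: laurent_polynomial.intros)
next
  case (mult f g)
  then obtain r s where rs: "laurent_polynomial r" "\<forall>z\<in>sphere 0 1. r z = of_real (f z)"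
    "laurent_polynomial s" "\<forall>z\<in>sphere 0 1. s z = of_real (g z)" by blast
  obtain q where "laurent_polynomial q" "\<forall>z. z \<noteq> 0 \<longrightarrow> q z = r z * s z"
    using laurent_polynomial_mult[OF rs(1,3)] by blast
  moreover have "z \<noteq> 0" if "z \<in> sphere 0 1" for z :: complex using that by auto
  ultimately show ?case using rs(2,4) by (intro exI[of _ q]) simp
qed

lemma laurent_polynomial_approx:
  assumes "continuous_on (sphere 0 1) (H :: complex \<Rightarrow> complex)" "e > 0"
  shows "\<exists>r. laurent_polynomial r \<and> (\<forall>z\<in>sphere 0 1. norm (H z - r z) < e)"
proof -
  obtain g where g: "polynomial_function g" "\<forall>z\<in>sphere 0 1. norm (H z - g z) < e"
    using Stone_Weierstrass_polynomial_function[OF compact_sphere assms] by blast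
  have "real_polynomial_function (Re \<circ> g)" "real_polynomial_function (Im \<circ> g)"
    using g(1) bounded_linear_Re bounded_linear_Im by (auto simp: polynomial_function_def)
  from this[THEN real_polynomial_function_laurent]
  obtain r s where rs: "laurent_polynomial r" "\<forall>z\<in>sphere 0 1. r z = of_real (Re (g z))"
    "laurent_polynomial s" "\<forall>z\<in>sphere 0 1. s z = of_real (Im (g z))"
    unfolding o_def by blast
  obtain q where q: "laurent_polynomial q" "\<forall>z. z \<noteq> 0 \<longrightarrow> q z = (\<lambda>z. \<i> * z powi 0) z * s z"
    using laurent_polynomial_mult[OF laurent_polynomial.monomial rs(3)] by blast
  have "r z + q z = g z" if "z \<in> sphere 0 1" for z
  proof -
    have "z \<noteq> 0" using that by auto
    then have "r z + q z = of_real (Re (g z)) + \<i> * of_real (Im (g z))"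
      using rs(2,4) q(2) that by simp
    then show ?thesis by (simp only: complex_eq[symmetric])
  qed
  then show ?thesis
    using g(2) rs(1) q(1) by (intro exI[of _ "\<lambda>z. r z + q z"]) (auto intro: laurent_polynomial.add)
qed

text \<open>\<open>Arg2pi\<close> jumps at 1, so continuity does not follow from that of a
  composition. Instead, preimages of closed sets are images under \<open>cis\<close> of compact sets
  of angles.\<close>

lemma continuous_on_circle_lift:
  fixes h :: "real \<Rightarrow> complex"
  assumes h: "continuous_on {0..2 * pi} h" and ends: "h 0 = h (2 * pi)"
  shows "\<exists>H. continuous_on (sphere 0 1) H \<and> (\<forall>x\<in>{0..2*pi}. H (cis x) = h x)"
proof (intro exI conjI ballI)
  define H where "H = (\<lambda>z. h (Arg2pi z))"
  have cis: "H (cis x) = h x" if "x \<in> {0..2*pi}" for x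
  proof (cases "x = 2 * pi")
    case True
    moreover have "Arg2pi 1 = 0" by (rule Arg2pi_unique[of 1]) auto
    ultimately show ?thesis using ends by (simp add: H_def)
  next
    case False
    then have "Arg2pi (cis x) = x"
      using that by (intro Arg2pi_unique[of 1]) (auto simp: cis_conv_exp)
    then show ?thesis by (simp add: H_def)
  qed
  show "continuous_on (sphere 0 1) H"
    unfolding continuous_on_closed_vimage[OF closed_sphere]
  proof (intro allI impI)
    fix B :: "complex set" assume "closed B"
    have "H -` B \<inter> sphere 0 1 = cis ` ({0..2*pi} \<inter> h -` B)"
    proof (intro equalityI subsetI)
      fix z assume z: "z \<in> H -` B \<inter> sphere 0 1"
      then have "z = cis (Arg2pi z)" using Arg2pi_eq[of z] by (simp add: cis_conv_exp)
      moreover have "Arg2pi z \<in> {0..2*pi}" using Arg2pi[of z] by auto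
      ultimately show "z \<in> cis ` ({0..2*pi} \<inter> h -` B)" using z by (auto simp: H_def)
    next
      fix z assume "z \<in> cis ` ({0..2*pi} \<inter> h -` B)"
      then show "z \<in> H -` B \<inter> sphere 0 1" using cis by auto
    qed
    moreover have "compact ({0..2*pi} \<inter> h -` B)"
      using continuous_on_closed_vimage[of "{0..2*pi}" h] h \<open>closed B\<close>
      by (simp add: Int_commute compact_eq_bounded_closed bounded_Int)
    then have "closed (cis ` ({0..2*pi} \<inter> h -` B))"
      by (intro compact_imp_closed compact_continuous_image) (auto intro!: continuous_intros)
    ultimately show "closed (H -` B \<inter> sphere 0 1)" by simp
  qed
  show "H (cis x) = h x" if "x \<in> {0..2*pi}" for x by (rule cis[OF that])
qed

text \<open>All pairings of h with trigonometric polynomials vanish; approximating the conjugate of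
  h uniformly by such polynomials makes the integral of |h|^2 vanish.\<close>

lemma Fourier_coefficients_zero_imp_zero:
  fixes h :: "real \<Rightarrow> complex"
  assumes h: "continuous_on {0..2 * pi} h" and ends: "h 0 = h (2 * pi)"
    and zero: "\<And>k::int. integral {0..2*pi} (\<lambda>x. h x * cis (of_int k * x)) = 0"
    and x: "x \<in> {0..2*pi}"
  shows "h x = 0"
proof -
  have int: "(\<lambda>x. h x * g x) integrable_on {0..2*pi}" if "continuous_on {0..2*pi} g" for g
    using h that by (intro integrable_continuous_real continuous_intros)
  have lc: "continuous_on {0..2*pi} (\<lambda>x. r (cis x))" if "laurent_polynomial r" for r
    using that by induction (auto simp: cis_power_int intro!: continuous_intros)
  have lz: "integral {0..2*pi} (\<lambda>x. h x * r (cis x)) = 0" if "laurent_polynomial r" for r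
    using that
  proof induction
    case (monomial c k)
    have "integral {0..2*pi} (\<lambda>x. c * (h x * cis (of_int k * x))) = 0"
      unfolding integral_mult_right using zero[of k] by simp
    then show ?case by (simp add: cis_power_int mult.left_commute)
  next
    case (add p q)
    then show ?case
      using Henstock_Kurzweil_Integration.integral_add[OF int[OF lc[OF add.hyps(1)]] int[OF lc[OF add.hyps(2)]]]
      by (simp add: distrib_left)
  qed
  obtain H where H: "continuous_on (sphere 0 1) H" "\<And>x. x \<in> {0..2*pi} \<Longrightarrow> H (cis x) = h x"
    using continuous_on_circle_lift[OF h ends] by blast
  define J where "J = integral {0..2*pi} (\<lambda>x. norm (h x))"
  have "J \<ge> 0" unfolding J_def by (intro integral_nonneg integrable_continuous_real continuous_intros h) auto
  have bd: "norm (integral {0..2*pi} (\<lambda>x. h x * cnj (h x))) \<le> e * J" if e: "e > 0" for e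
  proof -
    have "continuous_on (sphere 0 1) (\<lambda>z. cnj (H z))" by (intro continuous_on_cnj H)
    then obtain r where r: "laurent_polynomial r" "\<And>z. z \<in> sphere 0 1 \<Longrightarrow> norm (cnj (H z) - r z) < e"
      using laurent_polynomial_approx[OF _ e] by blast
    have "integral {0..2*pi} (\<lambda>x. h x * cnj (h x)) =
        integral {0..2*pi} (\<lambda>x. h x * cnj (h x)) - integral {0..2*pi} (\<lambda>x. h x * r (cis x))"
      using lz[OF r(1)] by simp
    also have "\<dots> = integral {0..2*pi} (\<lambda>x. h x * cnj (h x) - h x * r (cis x))"
      by (intro Henstock_Kurzweil_Integration.integral_diff[symmetric] int lc r(1) continuous_intros h)
    also have "norm \<dots> \<le> integral {0..2*pi} (\<lambda>x. e * norm (h x))"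
    proof (rule integral_norm_bound_integral)
      show "(\<lambda>x. h x * cnj (h x) - h x * r (cis x)) integrable_on {0..2*pi}"
        by (intro integrable_diff int lc r(1) continuous_intros h)
      show "(\<lambda>x. e * norm (h x)) integrable_on {0..2*pi}"
        by (intro integrable_continuous_real continuous_intros h)
      fix x assume "x \<in> {0..2*pi}"
      then have "norm (cnj (h x) - r (cis x)) \<le> e" using r(2)[of "cis x"] H(2)[of x] by simp
      then have "norm (h x) * norm (cnj (h x) - r (cis x)) \<le> norm (h x) * e" by (intro mult_left_mono) auto
      then show "norm (h x * cnj (h x) - h x * r (cis x)) \<le> e * norm (h x)"
        by (simp add: norm_mult[symmetric] right_diff_distrib mult.commute)
    qed
    also have "\<dots> = e * J" by (simp add: J_def)
    finally show ?thesis .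
  qed
  have "norm (integral {0..2*pi} (\<lambda>x. h x * cnj (h x))) \<le> e" if "e > 0" for e
  proof -
    \<comment> \<open>Division by \<open>J + 1\<close> instead of \<open>J\<close>, since
      \<open>J\<close> may be 0.\<close>
    have "e / (J + 1) * J \<le> e" using \<open>J \<ge> 0\<close> that by (simp add: field_simps)
    then show ?thesis using bd[of "e / (J + 1)"] \<open>J \<ge> 0\<close> that by simp
  qed
  then have "norm (integral {0..2*pi} (\<lambda>x. h x * cnj (h x))) \<le> 0"
    by (rule field_le_epsilon) simp
  then have "integral {0..2*pi} (\<lambda>x. h x * cnj (h x)) = 0" by simp
  moreover have "(\<lambda>x. h x * cnj (h x)) = (\<lambda>x. complex_of_real ((norm (h x))\<^sup>2))"
    by (simp only: complex_norm_square)
  moreover have "integral {0..2*pi} (\<lambda>x. complex_of_real ((norm (h x))\<^sup>2)) = of_real (integral {0..2*pi} (\<lambda>x. (norm (h x))\<^sup>2))"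
    using integral_linear[OF _ bounded_linear_of_real[where 'a=complex], of "\<lambda>x. (norm (h x))\<^sup>2" "{0..2*pi}"]
    by (simp add: o_def integrable_continuous_real continuous_intros h)
  ultimately have "integral {0..2*pi} (\<lambda>x. (norm (h x))\<^sup>2) = 0" by simp
  then have "\<forall>x\<in>{0..2*pi}. (norm (h x))\<^sup>2 = 0"
    by (subst (asm) integral_eq_0_iff) (auto intro!: continuous_intros h)
  then show ?thesis using x by simp
qed

lemma integral_cis:
  "integral {0..2*pi} (\<lambda>x. cis (of_int k * x)) = (if k = 0 then of_real (2 * pi) else 0)"
proof (cases "k = 0")
  case False
  have "((\<lambda>x. cis (of_int k * x)) has_integral
      (cis (of_int k * (2*pi)) / (\<i> * of_int k) - cis (of_int k * 0) / (\<i> * of_int k))) {0..2*pi}"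
  proof (rule fundamental_theorem_of_calculus)
    fix x assume "x \<in> {0..2*pi}"
    have "((\<lambda>z. exp (\<i> * of_int k * z) / (\<i> * of_int k)) has_field_derivative
        exp (\<i> * of_int k * of_real x)) (at (of_real x))"
      using False by (auto intro!: derivative_eq_intros)
    from has_vector_derivative_real_field[OF this, of "{0..2*pi}"]
    show "((\<lambda>x. cis (of_int k * x) / (\<i> * of_int k)) has_vector_derivative cis (of_int k * x)) (at x within {0..2*pi})"
      by (simp add: cis_conv_exp mult.assoc)
  qed simp
  moreover have "cis (of_int k * (2*pi)) = 1"
    using cis_multiple_2pi[of "of_int k"] by (simp add: mult.commute mult.left_commute)
  ultimately show ?thesis using False by (simp add: has_integral_iff)
qed (simp add: scaleR_conv_of_real)

section \<open>The Gaussian kernel and its Fourier transform\<close>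

text \<open>The normal density of variance 2 t is the heat kernel of the second derivative: its
  Fourier transform is exp (- t u^2), the form that the regulator takes once its square is
  completed.\<close>

definition heat_kernel :: "real \<Rightarrow> real \<Rightarrow> real" where
  "heat_kernel t = normal_density 0 (sqrt (2 * t))"

lemma heat_kernel_eq: "t > 0 \<Longrightarrow> heat_kernel t x = exp (- (x\<^sup>2 / (4 * t))) / sqrt (4 * pi * t)"
  by (simp add: heat_kernel_def normal_density_def)

lemma heat_kernel_nonneg [simp]: "heat_kernel t x \<ge> 0"
  by (simp add: heat_kernel_def)

lemma heat_kernel_continuous [continuous_intros]:
  "continuous_on S f \<Longrightarrow> continuous_on S (\<lambda>x. heat_kernel t (f x))"
  unfolding heat_kernel_def normal_density_def divide_inverse by (intro continuous_intros)

lemma heat_kernel_measurable [measurable]: "heat_kernel t \<in> borel_measurable borel"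
  by (intro borel_measurable_continuous_onI continuous_intros)

lemma heat_kernel_antimono: "t > 0 \<Longrightarrow> \<bar>y\<bar> \<le> \<bar>x\<bar> \<Longrightarrow> heat_kernel t x \<le> heat_kernel t y"
  by (simp add: heat_kernel_eq divide_right_mono abs_le_square_iff)

lemma heat_kernel_integrable: "t > 0 \<Longrightarrow> integrable lborel (heat_kernel t)"
  unfolding heat_kernel_def by (intro integrable_normal_density) simp

text \<open>Scaling by the standard deviation reduces the integral to the characteristic function of
  the standard normal distribution.\<close>

lemma heat_kernel_Fourier:
  assumes t: "t > 0"
  shows "integrable lborel (\<lambda>x. of_real (heat_kernel t x) * cis (u * x))"
    and "(LINT x|lborel. of_real (heat_kernel t x) * cis (u * x)) = of_real (exp (- t * u\<^sup>2))"
proof -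
  show int: "integrable lborel (\<lambda>x. complex_of_real (heat_kernel t x) * cis (u * x))"
    by (rule Bochner_Integration.integrable_bound[OF heat_kernel_integrable[OF t]])
      (auto simp: norm_mult intro!: borel_measurable_continuous_onI continuous_intros)
  define s where "s = sqrt (2 * t)"
  have "s > 0" "s\<^sup>2 = 2 * t" using t by (auto simp: s_def)
  have scale: "s * heat_kernel t (s * x) = std_normal_density x" for x
  proof -
    have "sqrt (4 * pi * t) = s * sqrt (2 * pi)"
      unfolding s_def real_sqrt_mult[symmetric] by (simp add: mult.commute)
    then show ?thesis
      using t \<open>s > 0\<close> \<open>s\<^sup>2 = 2 * t\<close> by (simp add: heat_kernel_eq std_normal_density_def power_mult_distrib)
  qed
  have "(LINT x|lborel. of_real (heat_kernel t x) * cis (u * x)) =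
     \<bar>s\<bar> *\<^sub>R (LINT x|lborel. of_real (heat_kernel t (0 + s * x)) * cis (u * (0 + s * x)))"
    using \<open>s > 0\<close> by (intro lborel_integral_real_affine) simp
  also have "\<dots> = (LINT x|lborel. of_real s * (of_real (heat_kernel t (s * x)) * cis (u * (s * x))))"
    using \<open>s > 0\<close> by (simp add: scaleR_conv_of_real)
  also have "\<dots> = (LINT x|lborel. std_normal_density x *\<^sub>R iexp ((u * s) * x))"
    by (intro Bochner_Integration.integral_cong refl)
      (simp add: scaleR_conv_of_real cis_conv_exp mult.assoc scale[symmetric])
  also have "\<dots> = char std_normal_distribution (u * s)"
    unfolding char_def by (subst integral_density) auto
  also have "\<dots> = of_real (exp (- ((u * s)^2) / 2))"
    by (simp only: char_std_normal_distribution)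
  also have "(u * s)^2 = 2 * t * u\<^sup>2" by (simp add: power_mult_distrib \<open>s\<^sup>2 = 2 * t\<close>)
  finally show "(LINT x|lborel. of_real (heat_kernel t x) * cis (u * x)) = of_real (exp (- t * u\<^sup>2))"
    by simp
qed

section \<open>Series over the integers with a geometric majorant\<close>

lemma summable_on_int_geometric:
  fixes K q :: real
  assumes "0 \<le> q" "q < 1"
  shows "(\<lambda>l::int. K * q ^ nat \<bar>l\<bar>) summable_on UNIV"
proof -
  have s: "(\<lambda>n::nat. K * q ^ n) summable_on UNIV"
  proof (rule norm_summable_imp_summable_on)
    show "summable (\<lambda>n. norm (K * q ^ n))"
      unfolding norm_mult norm_power using assms by (intro summable_mult summable_geometric) auto
  qed
  have "(\<lambda>l::int. K * q ^ nat \<bar>l\<bar>) summable_on range int"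
    using s by (subst summable_on_reindex) (auto simp: o_def)
  moreover have "(\<lambda>l::int. K * q ^ nat \<bar>l\<bar>) summable_on range (\<lambda>n. - int n)"
    using s by (subst summable_on_reindex) (auto simp: o_def inj_def)
  ultimately have "(\<lambda>l::int. K * q ^ nat \<bar>l\<bar>) summable_on (range int \<union> range (\<lambda>n. - int n))"
    by (rule summable_on_union)
  moreover have "range int \<union> range (\<lambda>n. - int n) = UNIV"
    by (auto intro: int_cases2)
  ultimately show ?thesis by simp
qed

text \<open>Completing the square in |l| shows (l - c)^2 + (C + 1/2)^2 \<ge> |l|. A bound
  \<open>C\<close> for the shift instead of the shift itself makes the majorant uniform when c
  varies over a bounded set.\<close>

lemma exp_square_le_geometric:
  fixes c C s :: real
  assumes "\<bar>c\<bar> \<le> C" "s > 0"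
  shows "exp (- s * (of_int l - c)\<^sup>2) \<le> exp (s * (C + 1/2)\<^sup>2) * exp (- s) ^ nat \<bar>l\<bar>"
proof -
  define L where "L = \<bar>real_of_int l\<bar>"
  have "(of_int l - c)\<^sup>2 - L + (C + 1/2)\<^sup>2 \<ge> 0"
  proof -
    have "of_int l * c \<le> \<bar>of_int l * c\<bar>" by (rule abs_ge_self)
    also have "\<dots> \<le> L * C" unfolding abs_mult L_def using assms(1) by (intro mult_left_mono) auto
    finally have "of_int l * c \<le> L * C" .
    moreover have "(of_int l - c)\<^sup>2 = L\<^sup>2 - 2 * (of_int l * c) + c\<^sup>2"
      by (simp add: power2_diff L_def)
    ultimately have "(of_int l - c)\<^sup>2 \<ge> L\<^sup>2 - 2 * (L * C)"
      using zero_le_power2[of c] by linarith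
    moreover have "L\<^sup>2 - 2 * (L * C) - L + (C + 1/2)\<^sup>2 = (L - (C + 1/2))\<^sup>2"
      by (simp add: power2_eq_square field_simps)
    ultimately show ?thesis using zero_le_power2[of "L - (C + 1/2)"] by linarith
  qed
  then have "0 \<le> s * ((of_int l - c)\<^sup>2 - L + (C + 1/2)\<^sup>2)" using assms(2) by simp
  then have "- s * (of_int l - c)\<^sup>2 \<le> s * (C + 1/2)\<^sup>2 + L * (- s)"
    by (simp add: algebra_simps)
  then have "exp (- s * (of_int l - c)\<^sup>2) \<le> exp (s * (C + 1/2)\<^sup>2 + L * (- s))" by simp
  also have "\<dots> = exp (s * (C + 1/2)\<^sup>2) * exp (- s) ^ nat \<bar>l\<bar>"
  proof -
    have "L = real (nat \<bar>l\<bar>)" by (simp add: L_def)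
    then show ?thesis by (simp only: exp_add exp_of_nat_mult)
  qed
  finally show ?thesis .
qed

text \<open>Turns unconditional sums over the integers into limits of symmetric partial sums, which
  are sequences and so open to the limit theorems for integrals.\<close>

lemma filterlim_symmetric_int_intervals:
  "filterlim (\<lambda>L::nat. {- int L..int L}) (finite_subsets_at_top UNIV) sequentially"
  unfolding filterlim_finite_subsets_at_top
proof (intro allI impI)
  fix X :: "int set" assume X: "finite X \<and> X \<subseteq> UNIV"
  define B where "B = (\<Sum>x\<in>X. nat \<bar>x\<bar>)"
  have "x \<in> {- int L..int L}" if "x \<in> X" "B \<le> L" for x L
  proof -
    have "nat \<bar>x\<bar> \<le> B" unfolding B_def using X that(1) by (intro member_le_sum) auto
    then show ?thesis using that(2) by auto
  qed
  then show "\<forall>\<^sub>F y in sequentially. finite {- int y..int y} \<and> X \<subseteq> {- int y..int y} \<and> {- int y..int y} \<subseteq> UNIV"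
    by (intro eventually_sequentiallyI[of B]) auto
qed

lemma uniform_limit_symmetric_sum:
  fixes f :: "int \<Rightarrow> 'b \<Rightarrow> 'c::banach"
  assumes "\<And>l y. y \<in> Y \<Longrightarrow> norm (f l y) \<le> K * q ^ nat \<bar>l\<bar>" "0 \<le> q" "q < 1"
  shows "uniform_limit Y (\<lambda>L y. \<Sum>l=-int L..int L. f l y) (\<lambda>y. \<Sum>\<^sub>\<infinity>l. f l y) sequentially"
proof -
  have "uniform_limit Y (\<lambda>X y. \<Sum>l\<in>X. f l y) (\<lambda>y. \<Sum>\<^sub>\<infinity>l. f l y) (finite_subsets_at_top UNIV)"
    using assms by (intro Weierstrass_m_test_general[OF _ summable_on_int_geometric]) auto
  then show ?thesis
    unfolding uniform_limit_iff
    by (intro allI impI eventually_compose_filterlim[OF _ filterlim_symmetric_int_intervals]) simp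
qed

section \<open>Poisson summation\<close>

text \<open>Uniform convergence allows termwise integration. The test function has frequency k and
  not - k, so it selects the term l = - k, whence the sign in \<open>k + c\<close>.\<close>

lemma Poisson_left_Fourier:
  fixes c :: real
  assumes t: "t > 0"
  defines "T \<equiv> \<lambda>x. \<Sum>\<^sub>\<infinity>l::int. of_real (exp (- t * (of_int l - c)\<^sup>2)) * cis (of_int l * x)"
  shows "continuous_on UNIV T"
    and "integral {0..2*pi} (\<lambda>x. T x * cis (of_int k * x)) = of_real (2 * pi * exp (- t * (of_int k + c)\<^sup>2))"
proof -
  define b where "b = (\<lambda>l::int. complex_of_real (exp (- t * (of_int l - c)\<^sup>2)))"
  have ul: "uniform_limit UNIV (\<lambda>L x. \<Sum>l=-int L..int L. b l * cis (of_int l * x)) T sequentially"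
    unfolding T_def b_def
    by (rule uniform_limit_symmetric_sum[where K="exp (t * (\<bar>c\<bar> + 1/2)\<^sup>2)" and q="exp (- t)"])
      (use exp_square_le_geometric[of c "\<bar>c\<bar>" t] t in \<open>auto simp: norm_mult\<close>)
  show "continuous_on UNIV T"
    by (rule uniform_limit_theorem[OF _ ul]) (auto intro!: always_eventually continuous_intros)
  have "uniform_limit {0..2*pi} (\<lambda>L x. (\<Sum>l=-int L..int L. b l * cis (of_int l * x)) * cis (of_int k * x))
      (\<lambda>x. T x * cis (of_int k * x)) sequentially"
  proof (rule uniform_lim_mult[OF uniform_limit_on_subset[OF ul]])
    have "continuous_on {0..2*pi} T" using \<open>continuous_on UNIV T\<close> continuous_on_subset by blast
    then show "bounded (T ` {0..2*pi})"
      by (intro compact_imp_bounded compact_continuous_image) auto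
    show "bounded ((\<lambda>x. cis (of_int k * x)) ` {0..2*pi})"
      by (intro boundedI[of _ 1]) auto
  qed (auto intro: uniform_limit_const)
  then obtain I J where IJ: "\<And>n. ((\<lambda>x. (\<Sum>l=-int n..int n. b l * cis (of_int l * x)) * cis (of_int k * x)) has_integral I n) {0..2*pi}"
     "((\<lambda>x. T x * cis (of_int k * x)) has_integral J) {0..2*pi}" "I \<longlonglongrightarrow> J"
    by (rule uniform_limit_integral) (auto intro!: continuous_intros)
  have "I L = of_real (2 * pi) * b (-k)" if "L \<ge> nat \<bar>k\<bar>" for L
  proof -
    have "I L = integral {0..2*pi} (\<lambda>x. \<Sum>l=-int L..int L. b l * cis (of_int (l + k) * x))"
      unfolding IJ(1)[of L, THEN integral_unique, symmetric]
      by (simp add: sum_distrib_right mult.assoc cis_mult distrib_right)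
    also have "\<dots> = (\<Sum>l=-int L..int L. integral {0..2*pi} (\<lambda>x. b l * cis (of_int (l + k) * x)))"
      by (intro Henstock_Kurzweil_Integration.integral_sum integrable_continuous_real continuous_intros) auto
    also have "\<dots> = (\<Sum>l=-int L..int L. if l = - k then b l * of_real (2 * pi) else 0)"
      unfolding integral_mult_right integral_cis by (intro sum.cong) auto
    also have "\<dots> = of_real (2 * pi) * b (-k)"
    proof -
      have "- k \<in> {- int L..int L}" using that by auto
      then show ?thesis by (subst sum.delta) (simp_all add: mult.commute del: atLeastAtMost_iff)
    qed
    finally show ?thesis .
  qed
  then have "I \<longlonglongrightarrow> of_real (2 * pi) * b (-k)"
    by (intro tendsto_eventually eventually_sequentiallyI[of "nat \<bar>k\<bar>"]) auto
  then have "J = of_real (2 * pi) * b (-k)" using IJ(3) LIMSEQ_unique by blast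
  moreover have "(of_int (-k) - c)\<^sup>2 = (of_int k + c)\<^sup>2" by (simp add: power2_eq_square algebra_simps)
  ultimately show "integral {0..2*pi} (\<lambda>x. T x * cis (of_int k * x)) = of_real (2 * pi * exp (- t * (of_int k + c)\<^sup>2))"
    using IJ(2)[THEN integral_unique] by (simp add: b_def)
qed

text \<open>In units of 2 pi the translate is a Gaussian in n with centre - x / (2 pi). This centre
  is bounded for bounded x, so one geometric majorant in n serves all these x.\<close>

lemma heat_kernel_translate_le:
  fixes X :: real
  assumes t: "t > 0" and X: "\<bar>x\<bar> \<le> X"
  shows "heat_kernel t (x + 2 * pi * of_int n) \<le>
    exp ((pi\<^sup>2 / t) * (X / (2 * pi) + 1/2)\<^sup>2) / sqrt (4 * pi * t) * exp (- (pi\<^sup>2 / t)) ^ nat \<bar>n\<bar>"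
proof -
  have "(x + 2 * pi * of_int n)\<^sup>2 / (4 * t) = (pi\<^sup>2 / t) * (of_int n - (- x / (2 * pi)))\<^sup>2"
    using t by (simp add: field_simps power2_eq_square)
  then have "exp (- ((x + 2 * pi * of_int n)\<^sup>2 / (4 * t))) \<le>
      exp ((pi\<^sup>2 / t) * (X / (2 * pi) + 1/2)\<^sup>2) * exp (- (pi\<^sup>2 / t)) ^ nat \<bar>n\<bar>"
    using exp_square_le_geometric[of "- x / (2 * pi)" "X / (2 * pi)" "pi\<^sup>2 / t" n] t X
    by (simp add: divide_right_mono)
  then show ?thesis
    using t by (simp add: heat_kernel_eq divide_right_mono)
qed

text \<open>Unfolding: as k is an integer, the integrals of the translates over one period are
  integrals of one function over consecutive periods, and together they exhaust its Fourier integral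
  over the line.\<close>

lemma Poisson_right_Fourier:
  fixes c :: real
  assumes t: "t > 0"
  defines "P \<equiv> \<lambda>x. \<Sum>\<^sub>\<infinity>n::int. of_real (heat_kernel t (x + 2 * pi * of_int n)) * cis (c * (x + 2 * pi * of_int n))"
  shows "continuous_on {0..2*pi} P"
    and "integral {0..2*pi} (\<lambda>x. P x * cis (of_int k * x)) = of_real (exp (- t * (of_int k + c)\<^sup>2))"
    and "P (x + 2 * pi * of_int m) = P x"
proof -
  define g where "g = (\<lambda>x. complex_of_real (heat_kernel t x) * cis (c * x))"
  have contg: "continuous_on S (\<lambda>x. g (f x))" if "continuous_on S f" for S and f :: "real \<Rightarrow> real"
    unfolding g_def by (intro continuous_intros that)
  have Pg: "P x = (\<Sum>\<^sub>\<infinity>n::int. g (x + 2 * pi * of_int n))" for x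
    by (simp add: P_def g_def)
  have ul: "uniform_limit {0..2*pi} (\<lambda>L x. \<Sum>n=-int L..int L. g (x + 2 * pi * of_int n)) P sequentially"
    unfolding Pg
  proof (rule uniform_limit_symmetric_sum)
    fix l :: int and y :: real assume "y \<in> {0..2*pi}"
    then show "norm (g (y + 2 * pi * of_int l)) \<le>
       exp ((pi\<^sup>2 / t) * (2 * pi / (2 * pi) + 1/2)\<^sup>2) / sqrt (4 * pi * t) * exp (- (pi\<^sup>2 / t)) ^ nat \<bar>l\<bar>"
      using heat_kernel_translate_le[OF t, of y "2 * pi" l] by (simp add: g_def norm_mult)
  qed (use t in auto)
  show contP: "continuous_on {0..2*pi} P"
    by (rule uniform_limit_theorem[OF _ ul]) (auto intro!: always_eventually continuous_intros contg)
  have "uniform_limit {0..2*pi} (\<lambda>L x. (\<Sum>n=-int L..int L. g (x + 2 * pi * of_int n)) * cis (of_int k * x))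
      (\<lambda>x. P x * cis (of_int k * x)) sequentially"
  proof (rule uniform_lim_mult[OF ul])
    show "bounded (P ` {0..2*pi})"
      using contP by (intro compact_imp_bounded compact_continuous_image) auto
    show "bounded ((\<lambda>x. cis (of_int k * x)) ` {0..2*pi})"
      by (intro boundedI[of _ 1]) auto
  qed (auto intro: uniform_limit_const)
  then obtain I J where IJ: "\<And>n. ((\<lambda>x. (\<Sum>l=-int n..int n. g (x + 2 * pi * of_int l)) * cis (of_int k * x)) has_integral I n) {0..2*pi}"
     "((\<lambda>x. P x * cis (of_int k * x)) has_integral J) {0..2*pi}" "I \<longlonglongrightarrow> J"
    by (rule uniform_limit_integral) (auto intro!: continuous_intros contg)
  define G where "G = (\<lambda>x. g x * cis (of_int k * x))"
  have contG: "continuous_on S G" for S unfolding G_def by (intro continuous_intros contg)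
  have Gint: "G integrable_on {u..v}" for u v by (intro integrable_continuous_real contG)
  have G_eq: "G = (\<lambda>x. of_real (heat_kernel t x) * cis ((of_int k + c) * x))"
    by (auto simp: G_def g_def fun_eq_iff cis_mult algebra_simps)
  have shift: "((\<lambda>x. g (x + 2 * pi * of_int l) * cis (of_int k * x)) has_integral
      integral {2 * pi * of_int l..2 * pi * of_int (l + 1)} G) {0..2*pi}" for l
  proof -
    have "cis (of_int k * (x + 2 * pi * of_int l)) = cis (of_int k * x)" for x
    proof -
      have "cis (of_int k * (2 * pi * of_int l)) = 1"
        using cis_multiple_2pi[of "of_int (k * l)"] by (simp add: algebra_simps)
      then show ?thesis by (simp add: distrib_left cis_mult[symmetric])
    qed
    then have eq: "(\<lambda>x. g (x + 2 * pi * of_int l) * cis (of_int k * x)) = (\<lambda>x. G (x + 2 * pi * of_int l))"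
      by (simp add: G_def)
    have "(G has_integral integral {2 * pi * of_int l..2 * pi * of_int (l + 1)} G) {0 + 2 * pi * of_int l..2 * pi + 2 * pi * of_int l}"
      using integrable_integral[OF Gint[of "2 * pi * of_int l" "2 * pi * of_int (l + 1)"]] by (simp add: algebra_simps)
    from this[folded has_integral_shift_Icc_real] show ?thesis
      unfolding eq by (simp add: o_def add.commute)
  qed
  have sumI: "(\<Sum>l=-int L..int L. integral {2 * pi * of_int l..2 * pi * of_int (l + 1)} G) =
      integral {2 * pi * of_int (- int L)..2 * pi * of_int (int L + 1)} G" for L
  proof (induction L)
    case 0
    then show ?case by simp
  next
    case (Suc L)
    have "{- int (Suc L)..int (Suc L)} = insert (- int (Suc L)) (insert (int (Suc L)) {- int L..int L})"
      by auto
    then have "(\<Sum>l=-int (Suc L)..int (Suc L). integral {2 * pi * of_int l..2 * pi * of_int (l + 1)} G) =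
       integral {2 * pi * of_int (- int (Suc L))..2 * pi * of_int (- int L)} G
       + integral {2 * pi * of_int (- int L)..2 * pi * of_int (int L + 1)} G
       + integral {2 * pi * of_int (int L + 1)..2 * pi * of_int (int (Suc L) + 1)} G"
      using Suc.IH by (simp add: add.commute add.left_commute)
    also have "integral {2 * pi * of_int (- int (Suc L))..2 * pi * of_int (- int L)} G
       + integral {2 * pi * of_int (- int L)..2 * pi * of_int (int L + 1)} G =
       integral {2 * pi * of_int (- int (Suc L))..2 * pi * of_int (int L + 1)} G"
      by (rule Henstock_Kurzweil_Integration.integral_combine[OF _ _ Gint]; intro mult_left_mono) auto
    also have "\<dots> + integral {2 * pi * of_int (int L + 1)..2 * pi * of_int (int (Suc L) + 1)} G =
       integral {2 * pi * of_int (- int (Suc L))..2 * pi * of_int (int (Suc L) + 1)} G"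
      by (rule Henstock_Kurzweil_Integration.integral_combine[OF _ _ Gint]; intro mult_left_mono) auto
    finally show ?case .
  qed
  have I: "I L = integral {2 * pi * of_int (- int L)..2 * pi * of_int (int L + 1)} G" for L
  proof -
    have "((\<lambda>x. \<Sum>l=-int L..int L. g (x + 2 * pi * of_int l) * cis (of_int k * x)) has_integral
      (\<Sum>l=-int L..int L. integral {2 * pi * of_int l..2 * pi * of_int (l + 1)} G)) {0..2*pi}"
      by (intro has_integral_sum shift) auto
    with IJ(1)[of L] show ?thesis
      unfolding sum_distrib_right sumI by (rule has_integral_unique)
  qed
  have Gl: "integrable lborel G" and GI: "(LINT x|lborel. G x) = of_real (exp (- t * (of_int k + c)\<^sup>2))"
    unfolding G_eq by (rule heat_kernel_Fourier[OF t])+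
  have "(\<lambda>L. LINT x|lborel. indicator {2 * pi * of_int (- int L)..2 * pi * of_int (int L + 1)} x *\<^sub>R G x) \<longlonglongrightarrow> (LINT x|lborel. G x)"
  proof (rule integral_dominated_convergence[where w="\<lambda>x. norm (G x)"])
    show "AE x in lborel. (\<lambda>L. indicator {2 * pi * of_int (- int L)..2 * pi * of_int (int L + 1)} x *\<^sub>R G x) \<longlonglongrightarrow> G x"
    proof (intro AE_I2 tendsto_eventually)
      fix x :: real
      obtain n where n: "\<bar>x\<bar> < real n" using reals_Archimedean2 by blast
      show "\<forall>\<^sub>F L in sequentially. indicator {2 * pi * of_int (- int L)..2 * pi * of_int (int L + 1)} x *\<^sub>R G x = G x"
      proof (rule eventually_sequentiallyI[of n])
        fix L assume "n \<le> L"
        have "real L \<le> 2 * pi * real L" using pi_gt3 mult_right_mono[of 1 "2 * pi" "real L"] by simp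
        then have *: "\<bar>x\<bar> \<le> 2 * pi * real L" using n \<open>n \<le> L\<close> by linarith
        then have "x \<le> 2 * pi * real L" by simp
        also have "\<dots> \<le> 2 * pi * (real L + 1)" by (intro mult_left_mono) auto
        finally have "x \<in> {2 * pi * of_int (- int L)..2 * pi * of_int (int L + 1)}" using * by auto
        then show "indicator {2 * pi * of_int (- int L)..2 * pi * of_int (int L + 1)} x *\<^sub>R G x = G x" by simp
      qed
    qed
  qed (use Gl in \<open>auto simp: indicator_def borel_measurable_integrable\<close>)
  moreover have "(LINT x|lborel. indicator {u..v} x *\<^sub>R G x) = integral {u..v} G" for u v :: real
    using set_borel_integral_eq_integral(2)[of "{u..v}" G] integrable_mult_indicator[OF _ Gl, of "{u..v}"]
    by (simp add: set_integrable_def set_lebesgue_integral_def)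
  ultimately have "I \<longlonglongrightarrow> (LINT x|lborel. G x)" by (simp only: I[symmetric])
  then have "J = (LINT x|lborel. G x)" using IJ(3) LIMSEQ_unique by blast
  then show "integral {0..2*pi} (\<lambda>x. P x * cis (of_int k * x)) = of_real (exp (- t * (of_int k + c)\<^sup>2))"
    using IJ(2)[THEN integral_unique] GI by simp
  have "P (x + 2 * pi * of_int m) = (\<Sum>\<^sub>\<infinity>n::int. g (x + 2 * pi * of_int (m + n)))"
    unfolding Pg by (simp add: algebra_simps)
  also have "\<dots> = P x"
    unfolding Pg
    by (rule infsum_reindex_bij_betw[of "\<lambda>n. m + n" UNIV UNIV "\<lambda>n. g (x + 2 * pi * of_int n)"])
      (rule bij_betw_byWitness[where f'="\<lambda>n. n - m"], auto)
  finally show "P (x + 2 * pi * of_int m) = P x" .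
qed

text \<open>On one period the two sides are continuous, take equal values at both ends and have the
  same Fourier coefficients; periodicity then extends the identity to all x.\<close>

theorem Poisson_summation_heat_kernel:
  fixes c :: real
  assumes t: "t > 0"
  shows "(\<Sum>\<^sub>\<infinity>l::int. of_real (exp (- t * (of_int l - c)\<^sup>2)) * cis (of_int l * x)) =
    of_real (2 * pi) * (\<Sum>\<^sub>\<infinity>n::int. of_real (heat_kernel t (x + 2 * pi * of_int n)) * cis (c * (x + 2 * pi * of_int n)))"
    (is "?T x = of_real (2 * pi) * ?P x")
proof -
  define T where "T = ?T" define P where "P = ?P"
  have T: "continuous_on UNIV T"
    "integral {0..2*pi} (\<lambda>x. T x * cis (of_int k * x)) = of_real (2 * pi * exp (- t * (of_int k + c)\<^sup>2))" for k
    unfolding T_def by (rule Poisson_left_Fourier[OF t])+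
  have P: "continuous_on {0..2*pi} P"
    "integral {0..2*pi} (\<lambda>x. P x * cis (of_int k * x)) = of_real (exp (- t * (of_int k + c)\<^sup>2))"
    "P (y + 2 * pi * of_int m) = P y" for k m y
    unfolding P_def by (rule Poisson_right_Fourier[OF t])+
  have Tper: "T (y + 2 * pi * of_int m) = T y" for y and m :: int
  proof -
    have "cis (of_int l * (y + 2 * pi * of_int m)) = cis (of_int l * y)" for l :: int
    proof -
      have "cis (of_int l * (2 * pi * of_int m)) = 1"
        using cis_multiple_2pi[of "of_int (l * m)"] by (simp add: algebra_simps)
      then show ?thesis by (simp add: distrib_left cis_mult[symmetric])
    qed
    then show ?thesis by (simp add: T_def)
  qed
  have base: "T y = of_real (2 * pi) * P y" if "y \<in> {0..2*pi}" for y
  proof -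
    define h where "h = (\<lambda>y. T y - of_real (2 * pi) * P y)"
    have cT: "continuous_on {0..2*pi} T" using T(1) continuous_on_subset by blast
    have "h y = 0"
    proof (rule Fourier_coefficients_zero_imp_zero[OF _ _ _ that])
      show "continuous_on {0..2*pi} h" unfolding h_def by (intro continuous_intros cT P(1))
      show "h 0 = h (2 * pi)" using Tper[of 0 1] P(3)[of 0 1] by (simp add: h_def)
      fix k :: int
      have "integral {0..2*pi} (\<lambda>x. h x * cis (of_int k * x)) =
         integral {0..2*pi} (\<lambda>x. T x * cis (of_int k * x) - of_real (2 * pi) * (P x * cis (of_int k * x)))"
        by (simp add: h_def algebra_simps)
      also have "\<dots> = integral {0..2*pi} (\<lambda>x. T x * cis (of_int k * x)) -
         integral {0..2*pi} (\<lambda>x. of_real (2 * pi) * (P x * cis (of_int k * x)))"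
        by (intro Henstock_Kurzweil_Integration.integral_diff integrable_continuous_real continuous_intros cT P(1))
      also have "\<dots> = 0" unfolding integral_mult_right T(2) P(2) by simp
      finally show "integral {0..2*pi} (\<lambda>x. h x * cis (of_int k * x)) = 0" .
    qed
    then show ?thesis by (simp add: h_def)
  qed
  define m where "m = - \<lfloor>x / (2 * pi)\<rfloor>"
  have "x + 2 * pi * of_int m \<in> {0..2*pi}"
  proof -
    have "of_int \<lfloor>x / (2 * pi)\<rfloor> \<le> x / (2 * pi)" "x / (2 * pi) \<le> of_int \<lfloor>x / (2 * pi)\<rfloor> + 1" by linarith+
    then show ?thesis
      using mult_left_mono[of "of_int \<lfloor>x / (2 * pi)\<rfloor>" "x / (2 * pi)" "2 * pi"]
        mult_left_mono[of "x / (2 * pi)" "of_int \<lfloor>x / (2 * pi)\<rfloor> + 1" "2 * pi"]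
      by (auto simp: m_def distrib_left)
  qed
  from base[OF this] show ?thesis unfolding Tper P(3) by (simp add: T_def P_def)
qed

section \<open>Almost everywhere convergence of heat means\<close>

lemma heat_kernel_tendsto_0:
  assumes "\<eta> \<noteq> 0"
  shows "((\<lambda>t. heat_kernel t \<eta>) \<longlongrightarrow> 0) (at_right 0)"
proof -
  have "\<eta>\<^sup>2 / 4 > 0" using assms by simp
  then have "((\<lambda>t. exp (- ((\<eta>\<^sup>2 / 4) / t)) / sqrt (4 * pi * t)) \<longlongrightarrow> 0) (at_right 0)"
    by real_asymp
  then show ?thesis
    by (rule Lim_transform_eventually)
      (auto simp: eventually_at_right_less heat_kernel_eq intro!: eventually_mono[OF eventually_at_right_less[of 0]])
qed

text \<open>The factor \<open>heat_kernel t r * (r / (2 * t))\<close> is minus the derivative of the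
  kernel in r. The integral is the weight of the layers of radius up to \<open>d\<close>, each
  multiplied by its radius; comparison with the variance 2 t over the whole line bounds it uniformly
  in t.\<close>

lemma heat_kernel_second_moment_le:
  assumes "t > 0"
  shows "(LINT r:{0..d}|lborel. heat_kernel t r * r * (r / (2 * t))) \<le> 1"
proof -
  have "has_bochner_integral lborel (\<lambda>x. normal_density 0 (sqrt (2 * t)) x * (x - 0) ^ (2 * 1))
      (fact (2 * 1) / ((2 / (sqrt (2 * t))\<^sup>2) ^ 1 * fact 1))"
    using assms by (intro normal_moment_even) simp
  then have *: "has_bochner_integral lborel (\<lambda>x. heat_kernel t x * x\<^sup>2) (2 * t)"
    using assms by (simp add: heat_kernel_def)
  have "has_bochner_integral lborel (\<lambda>x. heat_kernel t x * x\<^sup>2 / (2 * t)) (2 * t / (2 * t))"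
    by (rule has_bochner_integral_divide_zero[OF *])
  then have i: "integrable lborel (\<lambda>x. heat_kernel t x * x\<^sup>2 / (2 * t))" "(LINT x|lborel. heat_kernel t x * x\<^sup>2 / (2 * t)) = 1"
    using assms by (auto simp: has_bochner_integral_iff)
  have eq: "heat_kernel t r * r * (r / (2 * t)) = heat_kernel t r * r\<^sup>2 / (2 * t)" for r
    by (simp add: power2_eq_square)
  have "(LINT r:{0..d}|lborel. heat_kernel t r * r\<^sup>2 / (2 * t)) \<le> (LINT x|lborel. heat_kernel t x * x\<^sup>2 / (2 * t))"
    unfolding set_lebesgue_integral_def
    by (rule integral_mono[OF integrable_mult_indicator[OF _ i(1)] i(1)])
      (use assms in \<open>auto simp: indicator_def\<close>)
  then show ?thesis unfolding eq i(2) .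
qed

text \<open>The fundamental theorem of calculus between |x| and \<eta>. On [- \<eta>, \<eta>] the
  Gaussian is thereby a constant plus a superposition of indicator functions of symmetric
  intervals.\<close>

lemma heat_kernel_layer_cake:
  assumes t: "t > 0" and x: "\<bar>x\<bar> \<le> \<eta>"
  shows "heat_kernel t x = heat_kernel t \<eta> + (LINT r:{0..\<eta>}|lborel. (if \<bar>x\<bar> \<le> r then heat_kernel t r * (r / (2 * t)) else 0))"
proof -
  have d: "((\<lambda>r. - heat_kernel t r) has_vector_derivative heat_kernel t r * (r / (2 * t))) (at r within S)" for r S
    unfolding heat_kernel_eq[OF t] has_real_derivative_iff_has_vector_derivative[symmetric]
    using t by (auto intro!: derivative_eq_intros simp: field_simps)
  have HK: "((\<lambda>r. heat_kernel t r * (r / (2 * t))) has_integral (- heat_kernel t \<eta> - - heat_kernel t \<bar>x\<bar>)) {\<bar>x\<bar>..\<eta>}"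
    by (rule fundamental_theorem_of_calculus[OF x d])
  have "set_integrable lborel {\<bar>x\<bar>..\<eta>} (\<lambda>r. heat_kernel t r * (r / (2 * t)))"
    unfolding set_integrable_def by (rule borel_integrable_compact) (auto intro!: continuous_intros simp: t less_imp_neq[OF t, symmetric])
  from set_borel_integral_eq_integral(2)[OF this] integral_unique[OF HK]
  have "(LINT r:{\<bar>x\<bar>..\<eta>}|lborel. heat_kernel t r * (r / (2 * t))) = heat_kernel t \<bar>x\<bar> - heat_kernel t \<eta>"
    by linarith
  moreover have "(LINT r:{0..\<eta>}|lborel. (if \<bar>x\<bar> \<le> r then heat_kernel t r * (r / (2 * t)) else 0)) =
      (LINT r:{\<bar>x\<bar>..\<eta>}|lborel. heat_kernel t r * (r / (2 * t)))"
    unfolding set_lebesgue_integral_def by (intro Bochner_Integration.integral_cong) (auto simp: indicator_def)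
  moreover have "heat_kernel t \<bar>x\<bar> = heat_kernel t x" by (simp add: heat_kernel_eq[OF t])
  ultimately show ?thesis by simp
qed

text \<open>Fubini for the layer cake representation of the kernel; it replaces an integration by parts against
  the indefinite integral of \<open>q\<close>.\<close>
lemma heat_kernel_integral_by_layers:
  fixes q :: "real \<Rightarrow> complex"
  assumes t: "t > 0" and q: "integrable lborel q" and \<eta>: "\<eta> > 0"
  shows "(LINT y:{\<theta>-\<eta>..\<theta>+\<eta>}|lborel. of_real (heat_kernel t (y - \<theta>)) * q y) =
    of_real (heat_kernel t \<eta>) * (LINT y:{\<theta>-\<eta>..\<theta>+\<eta>}|lborel. q y) +
    (LINT r:{0..\<eta>}|lborel. of_real (heat_kernel t r * (r / (2 * t))) * (LINT y:{\<theta>-r..\<theta>+r}|lborel. q y))"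
    and "set_integrable lborel {0..\<eta>} (\<lambda>r. of_real (heat_kernel t r * (r / (2 * t))) * (LINT y:{\<theta>-r..\<theta>+r}|lborel. q y))"
proof -
  have [measurable]: "q \<in> borel_measurable borel" using q by auto
  define D where "D = (\<lambda>r. heat_kernel t r * (r / (2 * t)))"
  have [measurable]: "D \<in> borel_measurable borel" unfolding D_def by measurable
  have Dnn: "D r \<ge> 0" if "r \<ge> 0" for r using t that by (simp add: D_def)
  have Dint: "set_integrable lborel {0..\<eta>} D"
    unfolding D_def set_integrable_def by (rule borel_integrable_compact) (auto intro!: continuous_intros simp: t less_imp_neq[OF t, symmetric])
  define F where "F = (\<lambda>y r. (indicator {0..\<eta>} r * (if \<bar>y - \<theta>\<bar> \<le> r then D r else 0)) *\<^sub>R q y)"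
  have [measurable]: "case_prod F \<in> borel_measurable (lborel \<Otimes>\<^sub>M lborel)"
    unfolding F_def by measurable
  have bound: "integrable (lborel \<Otimes>\<^sub>M lborel) (\<lambda>(y, r). norm (q y) * (indicator {0..\<eta>} r * D r))"
  proof (rule lborel_pair.Fubini_integrable)
    show "(\<lambda>(y, r). norm (q y) * (indicator {0..\<eta>} r * D r)) \<in> borel_measurable (lborel \<Otimes>\<^sub>M lborel)"
      by measurable
    show "integrable lborel (\<lambda>y. LINT r|lborel. norm (case (y, r) of (y, r) \<Rightarrow> norm (q y) * (indicator {0..\<eta>} r * D r)))"
      using q by (simp add: abs_mult)
    show "AE y in lborel. integrable lborel (\<lambda>r. case (y, r) of (y, r) \<Rightarrow> norm (q y) * (indicator {0..\<eta>} r * D r))"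
      using Dint by (simp add: set_integrable_def)
  qed
  have Fint: "integrable (lborel \<Otimes>\<^sub>M lborel) (case_prod F)"
  proof (rule Bochner_Integration.integrable_bound[OF bound])
    have "norm (F y r) \<le> norm (q y) * (indicator {0..\<eta>} r * D r)" for y r
    proof -
      have "\<bar>indicator {0..\<eta>} r * (if \<bar>y - \<theta>\<bar> \<le> r then D r else 0)\<bar> \<le> indicator {0..\<eta>} r * D r"
        using Dnn[of r] by (cases "r \<in> {0..\<eta>}") auto
      from mult_left_mono[OF this norm_ge_zero[of "q y"]]
      show ?thesis by (simp add: F_def mult.commute)
    qed
    then have "norm (case p of (y, r) \<Rightarrow> F y r) \<le> norm (case p of (y, r) \<Rightarrow> norm (q y) * (indicator {0..\<eta>} r * D r))" for p
      unfolding split_beta using order_trans[OF _ abs_ge_self] unfolding real_norm_def by blast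
    then show "AE p in lborel \<Otimes>\<^sub>M lborel. norm (case p of (y, r) \<Rightarrow> F y r) \<le> norm (case p of (y, r) \<Rightarrow> norm (q y) * (indicator {0..\<eta>} r * D r))"
      by (intro AE_I2)
  qed measurable
  have inner: "(LINT r|lborel. F y r) = indicator {\<theta>-\<eta>..\<theta>+\<eta>} y *\<^sub>R (of_real (heat_kernel t (y - \<theta>) - heat_kernel t \<eta>) * q y)" for y
  proof (cases "\<bar>y - \<theta>\<bar> \<le> \<eta>")
    case True
    have "integrable lborel (\<lambda>r. indicator {0..\<eta>} r * (if \<bar>y - \<theta>\<bar> \<le> r then D r else 0))"
      by (rule Bochner_Integration.integrable_bound[OF Dint[unfolded set_integrable_def]])
        (auto simp: indicator_def)
    then have "(LINT r|lborel. F y r) = (LINT r:{0..\<eta>}|lborel. (if \<bar>y - \<theta>\<bar> \<le> r then D r else 0)) *\<^sub>R q y"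
      unfolding F_def set_lebesgue_integral_def by (subst integral_scaleR_left) auto
    also have "(LINT r:{0..\<eta>}|lborel. (if \<bar>y - \<theta>\<bar> \<le> r then D r else 0)) = heat_kernel t (y - \<theta>) - heat_kernel t \<eta>"
      using heat_kernel_layer_cake[OF t True] unfolding D_def by linarith
    finally show ?thesis using True by (auto simp: indicator_def abs_le_iff scaleR_conv_of_real)
  next
    case False
    then have "F y r = 0" for r by (auto simp: F_def indicator_def)
    then show ?thesis using False by (auto simp: indicator_def abs_le_iff)
  qed
  have outer: "(LINT y|lborel. F y r) = indicator {0..\<eta>} r *\<^sub>R (of_real (D r) * (LINT y:{\<theta>-r..\<theta>+r}|lborel. q y))" for r
  proof -
    have "(LINT y|lborel. F y r) = (LINT y|lborel. (indicator {0..\<eta>} r * D r) *\<^sub>R (indicator {\<theta>-r..\<theta>+r} y *\<^sub>R q y))"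
      by (intro Bochner_Integration.integral_cong refl) (auto simp: F_def indicator_def abs_le_iff)
    also have "\<dots> = (indicator {0..\<eta>} r * D r) *\<^sub>R (LINT y:{\<theta>-r..\<theta>+r}|lborel. q y)"
      unfolding set_lebesgue_integral_def by (rule integral_scaleR_right)
    finally show ?thesis by (simp add: scaleR_conv_of_real mult.assoc)
  qed
  have qh: "set_integrable lborel {\<theta>-\<eta>..\<theta>+\<eta>} (\<lambda>y. of_real (heat_kernel t (y - \<theta>)) * q y)"
    unfolding set_integrable_def
    by (rule Bochner_Integration.integrable_bound[of _ "\<lambda>y. heat_kernel t 0 *\<^sub>R q y"])
      (use q heat_kernel_antimono[OF t, of 0] in \<open>auto simp: indicator_def norm_mult intro!: mult_right_mono\<close>)
  have qs: "set_integrable lborel {\<theta>-\<eta>..\<theta>+\<eta>} (\<lambda>y. of_real (heat_kernel t \<eta>) * q y)"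
    using q unfolding set_integrable_def by (intro integrable_mult_indicator integrable_mult_right) auto
  have "(LINT y:{\<theta>-\<eta>..\<theta>+\<eta>}|lborel. of_real (heat_kernel t (y - \<theta>)) * q y) -
      (LINT y:{\<theta>-\<eta>..\<theta>+\<eta>}|lborel. of_real (heat_kernel t \<eta>) * q y) = (LINT y|lborel. LINT r|lborel. F y r)"
    unfolding inner set_integral_diff(2)[OF qh qs, symmetric]
    by (simp add: set_lebesgue_integral_def left_diff_distrib)
  also have "\<dots> = (LINT r|lborel. LINT y|lborel. F y r)"
    using lborel_pair.Fubini_integral[OF Fint] by simp
  also have "\<dots> = (LINT r:{0..\<eta>}|lborel. of_real (D r) * (LINT y:{\<theta>-r..\<theta>+r}|lborel. q y))"
    unfolding outer by (simp add: set_lebesgue_integral_def)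
  finally show "(LINT y:{\<theta>-\<eta>..\<theta>+\<eta>}|lborel. of_real (heat_kernel t (y - \<theta>)) * q y) =
    of_real (heat_kernel t \<eta>) * (LINT y:{\<theta>-\<eta>..\<theta>+\<eta>}|lborel. q y) +
    (LINT r:{0..\<eta>}|lborel. of_real (heat_kernel t r * (r / (2 * t))) * (LINT y:{\<theta>-r..\<theta>+r}|lborel. q y))"
    by (simp add: D_def diff_eq_eq add.commute)
  show "set_integrable lborel {0..\<eta>} (\<lambda>r. of_real (heat_kernel t r * (r / (2 * t))) * (LINT y:{\<theta>-r..\<theta>+r}|lborel. q y))"
    using lborel_pair.integrable_snd[OF Fint] unfolding outer set_integrable_def D_def .
qed

text \<open>Layers of radius at most \<delta> meet integrals of q bounded by (\<epsilon>/2) r, and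
  their total weight with the factor r is at most 1. The wider layers and the boundary term are
  bounded by the L1 norm of q times kernel values at the fixed points \<delta> and \<eta>, which
  vanish as t tends to 0.\<close>

lemma heat_kernel_concentration:
  fixes q :: "real \<Rightarrow> complex"
  assumes q: "integrable lborel q" and \<eta>: "\<eta> > 0"
    and small: "\<And>\<epsilon>. \<epsilon> > 0 \<Longrightarrow> \<exists>\<delta>>0. \<forall>r. 0 \<le> r \<longrightarrow> r < \<delta> \<longrightarrow> norm (LINT y:{\<theta>-r..\<theta>+r}|lborel. q y) \<le> \<epsilon> * r"
  shows "((\<lambda>t. LINT y:{\<theta>-\<eta>..\<theta>+\<eta>}|lborel. of_real (heat_kernel t (y - \<theta>)) * q y) \<longlongrightarrow> 0) (at_right 0)"
proof (rule tendstoI)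
  fix \<epsilon> :: real assume "\<epsilon> > 0"
  define A where "A = (\<lambda>r. LINT y:{\<theta>-r..\<theta>+r}|lborel. q y)"
  define C where "C = (LINT y|lborel. norm (q y))"
  have A: "norm (A r) \<le> C" for r
  proof -
    have "norm (A r) \<le> (LINT y|lborel. norm (indicator {\<theta>-r..\<theta>+r} y *\<^sub>R q y))"
      unfolding A_def set_lebesgue_integral_def by (rule integral_norm_bound)
    also have "\<dots> \<le> C"
      unfolding C_def using q
      by (intro integral_mono integrable_norm integrable_mult_indicator) (auto simp: indicator_def)
    finally show ?thesis .
  qed
  then have "C \<ge> 0" using norm_ge_zero order_trans by blast
  obtain \<delta>0 where \<delta>0: "\<delta>0 > 0" "\<And>r. 0 \<le> r \<Longrightarrow> r < \<delta>0 \<Longrightarrow> norm (A r) \<le> (\<epsilon>/2) * r"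
    using small[of "\<epsilon>/2"] \<open>\<epsilon> > 0\<close> by (auto simp: A_def)
  \<comment> \<open>Half of \<open>\<delta>0\<close> because smallness holds for r strictly below
    \<open>\<delta>0\<close>, while \<delta> itself is included here; \<delta> \<le> \<eta> keeps
    these radii among those of the layer representation.\<close>
  define \<delta> where "\<delta> = min (\<delta>0 / 2) \<eta>"
  have \<delta>: "\<delta> > 0" "\<delta> \<le> \<eta>" "\<And>r. 0 \<le> r \<Longrightarrow> r \<le> \<delta> \<Longrightarrow> norm (A r) \<le> (\<epsilon>/2) * r"
    using \<delta>0 \<eta> by (auto simp: \<delta>_def)
  have "((\<lambda>t. heat_kernel t \<eta> * C + C * heat_kernel t \<delta>) \<longlongrightarrow> 0) (at_right 0)"
    using \<delta>(1) \<eta> by (auto intro!: tendsto_eq_intros heat_kernel_tendsto_0)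
  then have "\<forall>\<^sub>F t in at_right 0. heat_kernel t \<eta> * C + C * heat_kernel t \<delta> < \<epsilon> / 2"
    using \<open>\<epsilon> > 0\<close> by (intro order_tendstoD(2)) auto
  moreover have "\<forall>\<^sub>F t :: real in at_right 0. t > 0" by (rule eventually_at_right_less)
  ultimately show "\<forall>\<^sub>F t in at_right 0. dist (LINT y:{\<theta>-\<eta>..\<theta>+\<eta>}|lborel. of_real (heat_kernel t (y - \<theta>)) * q y) 0 < \<epsilon>"
  proof eventually_elim
    case (elim t)
    define D where "D = (\<lambda>r. heat_kernel t r * (r / (2 * t)))"
    have Dnn: "D r \<ge> 0" if "r \<ge> 0" for r using elim(2) that by (simp add: D_def)
    have Dint: "set_integrable lborel {0..b} D" "set_integrable lborel {0..b} (\<lambda>r. D r * r)" for b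
      unfolding D_def set_integrable_def
      by (rule borel_integrable_compact; use elim(2) in \<open>auto intro!: continuous_intros\<close>)+
    have L: "(LINT y:{\<theta>-\<eta>..\<theta>+\<eta>}|lborel. of_real (heat_kernel t (y - \<theta>)) * q y) =
        of_real (heat_kernel t \<eta>) * A \<eta> + (LINT r:{0..\<eta>}|lborel. of_real (D r) * A r)"
      "set_integrable lborel {0..\<eta>} (\<lambda>r. of_real (D r) * A r)"
      unfolding A_def D_def by (rule heat_kernel_integral_by_layers[OF elim(2) q \<eta>])+
    \<comment> \<open>Integrable majorant: the bound for small radii on
      \<open>{0..\<delta>}\<close>, and the L1 bound \<open>C\<close> from \<delta> on.\<close>
    define W where "W = (\<lambda>r. (\<epsilon>/2) * (indicator {0..\<delta>} r * (D r * r)) + C * (indicator {0..\<eta>} r * (if \<delta> \<le> r then D r else 0)))"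
    have i1: "integrable lborel (\<lambda>r. indicator {0..\<delta>} r * (D r * r))" using Dint(2) by (simp add: set_integrable_def)
    have i2: "integrable lborel (\<lambda>r. indicator {0..\<eta>} r * (if \<delta> \<le> r then D r else 0))"
    proof (rule Bochner_Integration.integrable_bound[OF Dint(1)[of \<eta>, unfolded set_integrable_def]])
      show "(\<lambda>r. indicat_real {0..\<eta>} r * (if \<delta> \<le> r then D r else 0)) \<in> borel_measurable lborel"
        unfolding D_def by measurable
    qed (auto simp: indicator_def)
    have "norm (LINT r:{0..\<eta>}|lborel. of_real (D r) * A r) \<le> (LINT r|lborel. W r)"
      unfolding set_lebesgue_integral_def
    proof (rule Bochner_Integration.integral_norm_bound_integral)
      show "integrable lborel (\<lambda>r. indicat_real {0..\<eta>} r *\<^sub>R (complex_of_real (D r) * A r))"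
        using L(2) by (simp add: set_integrable_def)
      show "integrable lborel W" unfolding W_def using i1 i2 by auto
      fix r :: real
      show "norm (indicat_real {0..\<eta>} r *\<^sub>R (complex_of_real (D r) * A r)) \<le> W r"
      proof (cases "r \<in> {0..\<eta>}")
        case True
        then have "norm (indicat_real {0..\<eta>} r *\<^sub>R (complex_of_real (D r) * A r)) = D r * norm (A r)"
          using Dnn[of r] by (simp add: norm_mult)
        also have "\<dots> \<le> W r"
        proof (cases "r \<le> \<delta>")
          case True
          have "D r * norm (A r) \<le> D r * ((\<epsilon>/2) * r)"
            using \<open>r \<in> {0..\<eta>}\<close> True Dnn[of r] \<delta>(3)[of r] by (intro mult_left_mono) auto
          moreover have "0 \<le> C * (if \<delta> \<le> r then D r else 0)" using \<open>C \<ge> 0\<close> Dnn[of r] \<open>r \<in> {0..\<eta>}\<close> by auto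
          ultimately show ?thesis using True \<open>r \<in> {0..\<eta>}\<close> by (simp add: W_def algebra_simps)
        next
          case False
          have "D r * norm (A r) \<le> D r * C"
            using \<open>r \<in> {0..\<eta>}\<close> Dnn[of r] A[of r] by (intro mult_left_mono) auto
          then show ?thesis using False \<open>r \<in> {0..\<eta>}\<close> by (simp add: W_def mult.commute)
        qed
        finally show ?thesis .
      next
        case False
        then have "r \<notin> {0..\<delta>}" using \<delta>(2) by auto
        then show ?thesis using False by (simp add: W_def)
      qed
    qed
    also have "(LINT r|lborel. W r) = (\<epsilon>/2) * (LINT r|lborel. indicator {0..\<delta>} r * (D r * r)) +
        C * (LINT r|lborel. indicator {0..\<eta>} r * (if \<delta> \<le> r then D r else 0))"
      unfolding W_def using i1 i2 by simp
    also have "(LINT r|lborel. indicator {0..\<delta>} r * (D r * r)) \<le> 1"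
      using heat_kernel_second_moment_le[OF elim(2), of \<delta>] by (simp add: set_lebesgue_integral_def D_def mult_ac)
    also have "(LINT r|lborel. indicator {0..\<eta>} r * (if \<delta> \<le> r then D r else 0)) = heat_kernel t \<delta> - heat_kernel t \<eta>"
      using heat_kernel_layer_cake[OF elim(2), of \<delta> \<eta>] \<delta>(1,2)
      unfolding set_lebesgue_integral_def D_def by simp
    finally have 1: "norm (LINT r:{0..\<eta>}|lborel. of_real (D r) * A r) \<le> \<epsilon>/2 + C * (heat_kernel t \<delta> - heat_kernel t \<eta>)"
      using \<open>\<epsilon> > 0\<close> by simp
    have "norm (of_real (heat_kernel t \<eta>) * A \<eta>) \<le> heat_kernel t \<eta> * C"
      using A[of \<eta>] by (simp add: norm_mult mult_left_mono)
    then have "norm (of_real (heat_kernel t \<eta>) * A \<eta> + (LINT r:{0..\<eta>}|lborel. of_real (D r) * A r))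
        \<le> heat_kernel t \<eta> * C + (\<epsilon>/2 + C * (heat_kernel t \<delta> - heat_kernel t \<eta>))"
      using 1 by (rule norm_triangle_mono)
    also have "\<dots> \<le> \<epsilon>/2 + (heat_kernel t \<eta> * C + C * heat_kernel t \<delta>)"
      using \<open>C \<ge> 0\<close> by (simp add: algebra_simps)
    also have "\<dots> < \<epsilon>" using elim(1) by linarith
    finally show ?case using L(1) by simp
  qed
qed

section \<open>Regulated Fourier series as convolutions\<close>

text \<open>The exponent has the sign of the one in \<open>spherical\<close>, so a function is
  recovered with the opposite sign, by \<open>cis (- of_int l * \<theta>)\<close>.\<close>

definition Fourier_coeff :: "(real \<Rightarrow> complex) \<Rightarrow> int \<Rightarrow> complex" where
  "Fourier_coeff f l = (LINT y:{0..2*pi}|lborel. cis (of_int l * y) * f y) / of_real (2 * pi)"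

lemma set_integrable_bounded_mult:
  fixes f u :: "real \<Rightarrow> complex"
  assumes f: "set_integrable lborel S f" and S: "S \<in> sets borel" and u: "u \<in> borel_measurable borel"
    and B: "\<And>y. y \<in> S \<Longrightarrow> norm (u y) \<le> B"
  shows "set_integrable lborel S (\<lambda>y. u y * f y)"
proof -
  have "integrable lborel (\<lambda>y. u y * (indicator S y *\<^sub>R f y))"
  proof (rule Bochner_Integration.integrable_bound[of _ "\<lambda>y. B *\<^sub>R (indicator S y *\<^sub>R f y)"])
    show "(\<lambda>y. u y * (indicator S y *\<^sub>R f y)) \<in> borel_measurable lborel"
      using f u unfolding set_integrable_def by (intro borel_measurable_times) auto
    show "AE y in lborel. norm (u y * (indicator S y *\<^sub>R f y)) \<le> norm (B *\<^sub>R (indicator S y *\<^sub>R f y))"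
    proof (rule AE_I2)
      fix y
      show "norm (u y * (indicator S y *\<^sub>R f y)) \<le> norm (B *\<^sub>R (indicator S y *\<^sub>R f y))"
        using mult_right_mono[OF order_trans[OF B abs_ge_self], of y "norm (f y)"]
        by (cases "y \<in> S") (simp_all add: norm_mult)
    qed
  qed (use f in \<open>auto simp: set_integrable_def simp del: scaleR_scaleR\<close>)
  moreover have "u y * (indicator S y *\<^sub>R f y) = indicator S y *\<^sub>R (u y * f y)" for y by simp
  ultimately show ?thesis unfolding set_integrable_def by simp
qed

lemma cis_measurable [measurable]: "(\<lambda>y. cis (u * (y + v))) \<in> borel_measurable borel" "(\<lambda>y. cis (u * y)) \<in> borel_measurable borel"
    "(\<lambda>y. cis (u * (y - v))) \<in> borel_measurable borel"
  by (intro borel_measurable_continuous_onI continuous_intros)+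

lemma Fourier_coeff_bounded:
  assumes f: "set_integrable lborel {0..2*pi} f"
  shows "norm (Fourier_coeff f l) \<le> (LINT y:{0..2*pi}|lborel. norm (f y)) / (2 * pi)"
proof -
  have "norm (LINT y:{0..2*pi}|lborel. cis (of_int l * y) * f y) \<le> (LINT y:{0..2*pi}|lborel. norm (cis (of_int l * y) * f y))"
    by (rule set_integral_norm_bound[OF set_integrable_bounded_mult[OF f, of _ 1]]) auto
  then show ?thesis by (simp add: Fourier_coeff_def norm_mult norm_divide divide_right_mono)
qed

text \<open>The damping of the heat semigroup, centred at the frequency c instead of 0.\<close>

definition heat_mean :: "real \<Rightarrow> real \<Rightarrow> (real \<Rightarrow> complex) \<Rightarrow> real \<Rightarrow> complex" where
  "heat_mean c t f \<theta> = (\<Sum>\<^sub>\<infinity>l::int. of_real (exp (- t * (of_int l - c)\<^sup>2)) * (Fourier_coeff f l * cis (- of_int l * \<theta>)))"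

lemma heat_mean_bound:
  assumes f: "set_integrable lborel {0..2*pi} f" and t: "t > 0"
  obtains K where "\<And>l \<theta>. norm (of_real (exp (- t * (of_int l - c)\<^sup>2)) * (Fourier_coeff f l * cis (- of_int l * \<theta>)))
      \<le> K * exp (- t) ^ nat \<bar>l\<bar>"
proof
  define C where "C = (LINT y:{0..2*pi}|lborel. norm (f y)) / (2 * pi)"
  have C: "norm (Fourier_coeff f l) \<le> C" for l
    unfolding C_def by (rule Fourier_coeff_bounded[OF f])
  fix l :: int and \<theta>
  have "exp (- t * (of_int l - c)\<^sup>2) * norm (Fourier_coeff f l) \<le> (exp (t * (\<bar>c\<bar> + 1/2)\<^sup>2) * exp (- t) ^ nat \<bar>l\<bar>) * C"
    by (rule mult_mono[OF exp_square_le_geometric[OF order_refl t] C]) auto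
  then show "norm (of_real (exp (- t * (of_int l - c)\<^sup>2)) * (Fourier_coeff f l * cis (- of_int l * \<theta>)))
      \<le> (exp (t * (\<bar>c\<bar> + 1/2)\<^sup>2) * C) * exp (- t) ^ nat \<bar>l\<bar>"
    by (simp add: norm_mult mult_ac)
qed

lemma heat_mean_summable:
  assumes f: "set_integrable lborel {0..2*pi} f" and t: "t > 0"
  shows "(\<lambda>l::int. of_real (exp (- t * (of_int l - c)\<^sup>2)) * (Fourier_coeff f l * cis (- of_int l * \<theta>))) summable_on UNIV"
proof -
  obtain K where K: "\<And>l \<theta>. norm (of_real (exp (- t * (of_int l - c)\<^sup>2)) * (Fourier_coeff f l * cis (- of_int l * \<theta>)))
      \<le> K * exp (- t) ^ nat \<bar>l\<bar>"
    using heat_mean_bound[OF f t] by blast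
  have "(\<lambda>l. K * exp (- t) ^ nat \<bar>l\<bar>) summable_on (UNIV :: int set)"
    using t by (intro summable_on_int_geometric) auto
  then show ?thesis
    by (rule abs_summable_summable[OF Infinite_Sum.abs_summable_on_comparison_test'] ) (use K in auto)
qed

text \<open>The partial sums of the damped exponentials are bounded uniformly, so dominated
  convergence exchanges series and integral for merely integrable f; Poisson summation then rewrites
  the kernel. The 2 pi of that formula cancels the one in \<open>Fourier_coeff\<close>.\<close>

lemma heat_mean_eq_integral:
  fixes c :: real
  assumes f: "set_integrable lborel {0..2*pi} f" and t: "t > 0"
  defines "P \<equiv> \<lambda>x. \<Sum>\<^sub>\<infinity>n::int. of_real (heat_kernel t (x + 2 * pi * of_int n)) * cis (c * (x + 2 * pi * of_int n))"
  shows "heat_mean c t f \<theta> = (LINT y:{0..2*pi}|lborel. P (y - \<theta>) * f y)"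
    and "set_integrable lborel {0..2*pi} (\<lambda>y. P (y - \<theta>) * f y)"
proof -
  define b where "b = (\<lambda>l::int. complex_of_real (exp (- t * (of_int l - c)\<^sup>2)))"
  define T where "T = (\<lambda>x. \<Sum>\<^sub>\<infinity>l::int. b l * cis (of_int l * x))"
  define TL where "TL = (\<lambda>L::nat. \<lambda>x. \<Sum>l=-int L..int L. b l * cis (of_int l * x))"
  define K where "K = exp (t * (\<bar>c\<bar> + 1/2)\<^sup>2)"
  define B where "B = (\<Sum>\<^sub>\<infinity>l::int. K * exp (- t) ^ nat \<bar>l\<bar>)"
  have TP: "T x = of_real (2 * pi) * P x" for x
    unfolding T_def P_def b_def by (rule Poisson_summation_heat_kernel[OF t])
  have contT: "continuous_on UNIV T"
    unfolding T_def b_def by (rule Poisson_left_Fourier[OF t])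
  have [measurable]: "T \<in> borel_measurable borel" by (rule borel_measurable_continuous_onI[OF contT])
  have [measurable]: "TL L \<in> borel_measurable borel" for L
    unfolding TL_def by (intro borel_measurable_continuous_onI continuous_intros)
  have bK: "norm (b l * cis (of_int l * x)) \<le> K * exp (- t) ^ nat \<bar>l\<bar>" for l x
    using exp_square_le_geometric[of c "\<bar>c\<bar>" t l] t by (simp add: b_def K_def norm_mult)
  have lim: "(\<lambda>L. TL L x) \<longlonglongrightarrow> T x" for x
    using tendsto_uniform_limitI[OF uniform_limit_symmetric_sum[of UNIV "\<lambda>l x. b l * cis (of_int l * x)" K "exp (- t)"], of x] bK t
    by (simp add: TL_def T_def)
  have TLB: "norm (TL L x) \<le> B" for L x
  proof -
    have "norm (TL L x) \<le> (\<Sum>l=-int L..int L. K * exp (- t) ^ nat \<bar>l\<bar>)"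
      unfolding TL_def by (rule sum_norm_le) (use bK in auto)
    also have "\<dots> \<le> B"
      unfolding B_def using t
      by (intro finite_sum_le_infsum summable_on_int_geometric) (auto simp: K_def)
    finally show ?thesis .
  qed
  have TB: "norm (T x) \<le> B" for x
    by (rule LIMSEQ_le_const2[OF tendsto_norm[OF lim]]) (use TLB in auto)
  have fi: "integrable lborel (\<lambda>y. indicator {0..2*pi} y *\<^sub>R f y)" using f by (simp add: set_integrable_def)
  have "(\<lambda>L. LINT y:{0..2*pi}|lborel. TL L (y - \<theta>) * f y) \<longlonglongrightarrow> (LINT y:{0..2*pi}|lborel. T (y - \<theta>) * f y)"
    unfolding set_lebesgue_integral_def
  proof (rule integral_dominated_convergence[where w="\<lambda>y. norm (B *\<^sub>R (indicator {0..2*pi} y *\<^sub>R f y))"])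
    show "(\<lambda>y. indicat_real {0..2 * pi} y *\<^sub>R (T (y - \<theta>) * f y)) \<in> borel_measurable lborel"
      using set_integrable_bounded_mult[where u="\<lambda>y. T (y - \<theta>)", OF f _ _ TB] by (auto simp: set_integrable_def)
    show "(\<lambda>y. indicat_real {0..2 * pi} y *\<^sub>R (TL L (y - \<theta>) * f y)) \<in> borel_measurable lborel" for L
      using set_integrable_bounded_mult[where u="\<lambda>y. TL L (y - \<theta>)", OF f _ _ TLB] by (auto simp: set_integrable_def)
    show "AE y in lborel. (\<lambda>L. indicat_real {0..2 * pi} y *\<^sub>R (TL L (y - \<theta>) * f y)) \<longlonglongrightarrow> indicat_real {0..2 * pi} y *\<^sub>R (T (y - \<theta>) * f y)"
      by (intro AE_I2 tendsto_intros lim)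
    show "AE y in lborel. norm (indicat_real {0..2 * pi} y *\<^sub>R (TL L (y - \<theta>) * f y)) \<le> norm (B *\<^sub>R (indicator {0..2*pi} y *\<^sub>R f y))" for L
    proof (rule AE_I2)
      fix y
      show "norm (indicat_real {0..2 * pi} y *\<^sub>R (TL L (y - \<theta>) * f y)) \<le> norm (B *\<^sub>R (indicator {0..2*pi} y *\<^sub>R f y))"
        using mult_right_mono[OF order_trans[OF TLB[of L "y - \<theta>"] abs_ge_self], of "norm (f y)"]
        by (cases "y \<in> {0..2*pi}") (simp_all add: norm_mult)
    qed
    show "integrable lborel (\<lambda>y. norm (B *\<^sub>R (indicator {0..2*pi} y *\<^sub>R f y)))"
      by (intro integrable_norm integrable_scaleR_right fi)
  qed
  moreover have "(LINT y:{0..2*pi}|lborel. TL L (y - \<theta>) * f y) =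
      of_real (2 * pi) * (\<Sum>l=-int L..int L. b l * (Fourier_coeff f l * cis (- of_int l * \<theta>)))" for L
  proof -
    have i: "set_integrable lborel {0..2*pi} (\<lambda>y. b l * cis (- of_int l * \<theta>) * (cis (of_int l * y) * f y))" for l
      by (intro set_integrable_mult_right set_integrable_bounded_mult[OF f, of _ 1]) auto
    have "(LINT y:{0..2*pi}|lborel. TL L (y - \<theta>) * f y) =
       (LINT y:{0..2*pi}|lborel. \<Sum>l=-int L..int L. b l * cis (- of_int l * \<theta>) * (cis (of_int l * y) * f y))"
    proof (intro arg_cong[of _ _ "set_lebesgue_integral lborel {0..2*pi}"] ext)
      fix y
      have "cis (of_int l * (y - \<theta>)) = cis (- of_int l * \<theta>) * cis (of_int l * y)" for l
        by (simp add: cis_mult algebra_simps)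
      then show "TL L (y - \<theta>) * f y = (\<Sum>l=-int L..int L. b l * cis (- of_int l * \<theta>) * (cis (of_int l * y) * f y))"
        unfolding TL_def sum_distrib_right by (simp only: mult.assoc)
    qed
    also have "\<dots> = (\<Sum>l=-int L..int L. LINT y:{0..2*pi}|lborel. b l * cis (- of_int l * \<theta>) * (cis (of_int l * y) * f y))"
      using i unfolding set_lebesgue_integral_def set_integrable_def scaleR_sum_right
      by (intro Bochner_Integration.integral_sum)
    also have "\<dots> = (\<Sum>l=-int L..int L. of_real (2 * pi) * (b l * (Fourier_coeff f l * cis (- of_int l * \<theta>))))"
      by (intro sum.cong refl) (simp add: Fourier_coeff_def)
    finally show ?thesis by (simp add: sum_distrib_left)
  qed
  ultimately have 1: "(\<lambda>L. of_real (2 * pi) * (\<Sum>l=-int L..int L. b l * (Fourier_coeff f l * cis (- of_int l * \<theta>)))) \<longlonglongrightarrow>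
      (LINT y:{0..2*pi}|lborel. T (y - \<theta>) * f y)" by simp
  obtain K' where K': "\<And>l \<theta>. norm (b l * (Fourier_coeff f l * cis (- of_int l * \<theta>))) \<le> K' * exp (- t) ^ nat \<bar>l\<bar>"
    unfolding b_def using heat_mean_bound[OF f t] by blast
  have "(\<lambda>L. \<Sum>l=-int L..int L. b l * (Fourier_coeff f l * cis (- of_int l * \<theta>))) \<longlonglongrightarrow> heat_mean c t f \<theta>"
    using tendsto_uniform_limitI[OF uniform_limit_symmetric_sum[of UNIV "\<lambda>l \<theta>. b l * (Fourier_coeff f l * cis (- of_int l * \<theta>))" K' "exp (- t)"], of \<theta>] K' t
    by (simp add: heat_mean_def b_def)
  from tendsto_mult[OF tendsto_const this, of "of_real (2 * pi)"] 1
  have "of_real (2 * pi) * heat_mean c t f \<theta> = (LINT y:{0..2*pi}|lborel. T (y - \<theta>) * f y)"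
    by (rule LIMSEQ_unique)
  then show "heat_mean c t f \<theta> = (LINT y:{0..2*pi}|lborel. P (y - \<theta>) * f y)"
    unfolding TP mult.assoc by simp
  have "set_integrable lborel {0..2*pi} (\<lambda>y. T (y - \<theta>) * f y)"
    by (rule set_integrable_bounded_mult[OF f _ _ TB]) auto
  then show "set_integrable lborel {0..2*pi} (\<lambda>y. P (y - \<theta>) * f y)"
    unfolding TP mult.assoc by simp
qed

section \<open>Pointwise limits of heat means\<close>

text \<open>\<eta> is at most the distance of \<theta> from either end of the period, so the
  translates with n \<noteq> 0 stay at distance \<eta> |n| from 0. With exp (- \<eta>^2 / (4 t))
  \<le> 1/2 and n^2 \<ge> |n| they are dominated by a geometric series times the value of the kernel
  at \<eta>.\<close>

lemma heat_kernel_periodization_remainder: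
  fixes x \<eta> :: real
  assumes t: "t > 0" and \<eta>: "\<eta> > 0" and \<theta>: "\<eta> \<le> \<theta>" "\<eta> \<le> 2 * pi - \<theta>" and x: "- \<theta> \<le> x" "x \<le> 2 * pi - \<theta>"
    and q: "exp (- (\<eta>\<^sup>2 / (4 * t))) \<le> 1 / 2"
  shows "norm ((\<Sum>\<^sub>\<infinity>n::int. of_real (heat_kernel t (x + 2 * pi * of_int n)) * cis (c * (x + 2 * pi * of_int n)))
     - of_real (heat_kernel t x) * cis (c * x)) \<le> heat_kernel t \<eta> * (\<Sum>\<^sub>\<infinity>n::int. 2 * (1/2) ^ nat \<bar>n\<bar>)"
proof -
  define g where "g = (\<lambda>n::int. complex_of_real (heat_kernel t (x + 2 * pi * of_int n)) * cis (c * (x + 2 * pi * of_int n)))"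
  have far: "\<eta> * of_int \<bar>n\<bar> \<le> \<bar>x + 2 * pi * of_int n\<bar>" if "n \<noteq> 0" for n :: int
  proof (cases "n > 0")
    case True
    have "\<eta> \<le> 2 * pi" using \<theta> \<eta> by linarith
    then have "\<eta> * of_int (n - 1) \<le> 2 * pi * of_int (n - 1)" using True by (intro mult_right_mono) auto
    then show ?thesis using True x \<theta> by (simp add: algebra_simps)
  next
    case False
    have "\<eta> \<le> 2 * pi" using \<theta> \<eta> by linarith
    then have "\<eta> * of_int (- n - 1) \<le> 2 * pi * of_int (- n - 1)" using False that by (intro mult_right_mono) auto
    then show ?thesis using False that x \<theta> by (simp add: algebra_simps)
  qed
  have bound: "norm (g n) \<le> heat_kernel t \<eta> * (2 * (1/2) ^ nat \<bar>n\<bar>)" if "n \<noteq> 0" for n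
  proof -
    have "norm (g n) \<le> heat_kernel t (\<eta> * of_int \<bar>n\<bar>)"
      using heat_kernel_antimono[OF t, of "\<eta> * of_int \<bar>n\<bar>"] far[OF that] \<eta> by (simp add: g_def norm_mult abs_mult)
    also have "\<dots> \<le> exp (- (\<eta>\<^sup>2 / (4 * t))) ^ nat \<bar>n\<bar> / sqrt (4 * pi * t)"
    proof -
      define m where "m = nat \<bar>n\<bar>"
      have "real m \<le> (real m)\<^sup>2" by (cases m) (auto simp: power2_eq_square)
      then have "\<eta>\<^sup>2 / (4 * t) * real m \<le> \<eta>\<^sup>2 / (4 * t) * (real m)\<^sup>2"
        using t by (intro mult_left_mono) auto
      moreover have "of_int \<bar>n\<bar> = real m" by (simp add: m_def)
      ultimately show ?thesis
        using t unfolding m_def[symmetric] exp_of_nat_mult[symmetric]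
        by (simp add: heat_kernel_eq power_mult_distrib divide_right_mono mult.commute)
    qed
    also have "\<dots> = heat_kernel t \<eta> * exp (- (\<eta>\<^sup>2 / (4 * t))) ^ (nat \<bar>n\<bar> - 1)"
      using that t by (simp add: heat_kernel_eq power_eq_if[of _ "nat \<bar>n\<bar>"])
    also have "\<dots> \<le> heat_kernel t \<eta> * (1/2) ^ (nat \<bar>n\<bar> - 1)"
      using q by (intro mult_left_mono power_mono) auto
    also have "(1/2 :: real) ^ (nat \<bar>n\<bar> - 1) = 2 * (1/2) ^ nat \<bar>n\<bar>"
      using that by (simp add: power_eq_if[of _ "nat \<bar>n\<bar>"])
    finally show ?thesis .
  qed
  have sumU: "(\<lambda>n::int. heat_kernel t \<eta> * (2 * (1/2) ^ nat \<bar>n\<bar>)) summable_on UNIV"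
    using summable_on_int_geometric[of "1/2" "heat_kernel t \<eta> * 2"] by (simp add: mult.assoc)
  then have sum0: "(\<lambda>n::int. heat_kernel t \<eta> * (2 * (1/2) ^ nat \<bar>n\<bar>)) summable_on (- {0})"
    by (rule summable_on_subset_banach) auto
  have abs: "(\<lambda>n. norm (g n)) summable_on (- {0})"
    by (rule Infinite_Sum.abs_summable_on_comparison_test'[OF sum0]) (use bound in auto)
  have "(\<Sum>\<^sub>\<infinity>n. g n) = g 0 + (\<Sum>\<^sub>\<infinity>n\<in>- {0}. g n)"
    using infsum_Un_disjoint[of g "{0}" "- {0}"] abs_summable_summable[OF abs] by simp
  then have "(\<Sum>\<^sub>\<infinity>n. g n) - g 0 = (\<Sum>\<^sub>\<infinity>n\<in>- {0}. g n)" by simp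
  moreover have "norm (\<Sum>\<^sub>\<infinity>n\<in>- {0}. g n) \<le> (\<Sum>\<^sub>\<infinity>n\<in>- {0}. norm (g n))"
    by (rule norm_infsum_bound[OF abs])
  moreover have "(\<Sum>\<^sub>\<infinity>n\<in>- {0}. norm (g n)) \<le> (\<Sum>\<^sub>\<infinity>n\<in>- {0}. heat_kernel t \<eta> * (2 * (1/2) ^ nat \<bar>n\<bar>))"
    by (rule infsum_mono[OF abs sum0]) (use bound in auto)
  moreover have "(\<Sum>\<^sub>\<infinity>n\<in>- {0::int}. heat_kernel t \<eta> * (2 * (1/2) ^ nat \<bar>n\<bar>)) \<le> (\<Sum>\<^sub>\<infinity>n. heat_kernel t \<eta> * (2 * (1/2) ^ nat \<bar>n\<bar>))"
    by (rule infsum_mono_neutral[OF sum0 sumU]) auto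
  moreover have "(\<Sum>\<^sub>\<infinity>n::int. heat_kernel t \<eta> * (2 * (1/2) ^ nat \<bar>n\<bar>)) = heat_kernel t \<eta> * (\<Sum>\<^sub>\<infinity>n::int. 2 * (1/2) ^ nat \<bar>n\<bar>)"
    by (rule infsum_cmult_right')
  ultimately show ?thesis by (simp add: g_def)
qed

text \<open>Three contributions: the translates with n \<noteq> 0 and the part of the period outside
  the window of radius \<eta>, both of the order of \<open>heat_kernel t \<eta>\<close>, and the
  window itself, where concentration applies to a function \<open>q\<close> that has absorbed the
  oscillating factor.\<close>

lemma heat_mean_tendsto_0:
  assumes f: "set_integrable lborel {0..2*pi} f" and \<theta>: "\<theta> \<in> {0<..<2*pi}"
    and small: "\<And>\<epsilon>. \<epsilon> > 0 \<Longrightarrow> \<exists>\<delta>>0. \<forall>r. 0 \<le> r \<longrightarrow> r < \<delta> \<longrightarrow>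
      norm (LINT y:{\<theta>-r..\<theta>+r}|lborel. cis (c * (y - \<theta>)) * (indicator {0..2*pi} y *\<^sub>R f y)) \<le> \<epsilon> * r"
  shows "((\<lambda>t. heat_mean c t f \<theta>) \<longlongrightarrow> 0) (at_right 0)"
proof -
  \<comment> \<open>The largest radius for which the window around \<theta> stays within the
    period.\<close>
  define \<eta> where "\<eta> = min \<theta> (2 * pi - \<theta>)"
  have \<eta>: "\<eta> > 0" "\<eta> \<le> \<theta>" "\<eta> \<le> 2 * pi - \<theta>" using \<theta> by (auto simp: \<eta>_def)
  define C where "C = (\<Sum>\<^sub>\<infinity>n::int. 2 * (1/2 :: real) ^ nat \<bar>n\<bar>)"
  define I where "I = (LINT y:{0..2*pi}|lborel. norm (f y))"
  define q where "q = (\<lambda>y. cis (c * (y - \<theta>)) * (indicator {0..2*pi} y *\<^sub>R f y))"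
  have q_eq: "q y = indicator {0..2*pi} y *\<^sub>R (cis (c * (y - \<theta>)) * f y)" for y by (simp add: q_def)
  have qi: "integrable lborel q"
    using set_integrable_bounded_mult[OF f, of "\<lambda>y. cis (c * (y - \<theta>))" 1] unfolding q_eq[abs_def] set_integrable_def by simp
  have fn: "set_integrable lborel {0..2*pi} (\<lambda>y. norm (f y))" using f by (rule set_integrable_norm)
  have "\<forall>\<^sub>F t in at_right 0. heat_kernel t \<eta> < 1 \<and> exp (- (\<eta>\<^sup>2 / (4 * t))) \<le> 1 / 2 \<and> t > 0"
  proof (intro eventually_conj)
    show "\<forall>\<^sub>F t in at_right 0. heat_kernel t \<eta> < 1"
      using \<eta>(1) by (intro order_tendstoD(2)[OF heat_kernel_tendsto_0]) auto
    have "\<eta>\<^sup>2 / 4 > 0" using \<eta>(1) by simp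
    then have "((\<lambda>t. exp (- ((\<eta>\<^sup>2 / 4) / t))) \<longlongrightarrow> 0) (at_right 0)" by real_asymp
    then have "\<forall>\<^sub>F t in at_right 0. exp (- ((\<eta>\<^sup>2 / 4) / t)) < 1/2" by (rule order_tendstoD) simp
    then show "\<forall>\<^sub>F t in at_right 0. exp (- (\<eta>\<^sup>2 / (4 * t))) \<le> 1 / 2" by eventually_elim simp
    show "\<forall>\<^sub>F t :: real in at_right 0. t > 0" by (rule eventually_at_right_less)
  qed
  then have bound: "\<forall>\<^sub>F t in at_right 0. norm (heat_mean c t f \<theta> - (LINT y:{\<theta>-\<eta>..\<theta>+\<eta>}|lborel. of_real (heat_kernel t (y - \<theta>)) * q y))
      \<le> heat_kernel t \<eta> * ((C + 1) * I)"
  proof eventually_elim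
    case (elim t)
    then have t: "t > 0" by simp
    define P where "P = (\<lambda>x. \<Sum>\<^sub>\<infinity>n::int. of_real (heat_kernel t (x + 2 * pi * of_int n)) * cis (c * (x + 2 * pi * of_int n)))"
    define g where "g = (\<lambda>x. complex_of_real (heat_kernel t x) * cis (c * x))"
    have PI: "heat_mean c t f \<theta> = (LINT y:{0..2*pi}|lborel. P (y - \<theta>) * f y)"
      "set_integrable lborel {0..2*pi} (\<lambda>y. P (y - \<theta>) * f y)"
      unfolding P_def by (rule heat_mean_eq_integral[OF f t])+
    have gi: "set_integrable lborel {0..2*pi} (\<lambda>y. g (y - \<theta>) * f y)"
      by (rule set_integrable_bounded_mult[OF f, of _ "heat_kernel t 0"])
        (use heat_kernel_antimono[OF t, of 0] in \<open>auto simp: g_def norm_mult\<close>)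
    have "norm (heat_mean c t f \<theta> - (LINT y:{0..2*pi}|lborel. g (y - \<theta>) * f y)) =
        norm (LINT y:{0..2*pi}|lborel. P (y - \<theta>) * f y - g (y - \<theta>) * f y)"
      unfolding PI(1) by (subst set_integral_diff(2)[OF PI(2) gi]) simp
    also have "\<dots> \<le> (LINT y:{0..2*pi}|lborel. norm (P (y - \<theta>) * f y - g (y - \<theta>) * f y))"
      by (rule set_integral_norm_bound[OF set_integral_diff(1)[OF PI(2) gi]])
    also have "\<dots> \<le> (LINT y:{0..2*pi}|lborel. (heat_kernel t \<eta> * C) * norm (f y))"
    proof (rule set_integral_mono)
      show "set_integrable lborel {0..2*pi} (\<lambda>y. norm (P (y - \<theta>) * f y - g (y - \<theta>) * f y))"
        by (rule set_integrable_norm[OF set_integral_diff(1)[OF PI(2) gi]])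
      show "set_integrable lborel {0..2*pi} (\<lambda>y. (heat_kernel t \<eta> * C) * norm (f y))"
        using fn by (rule set_integrable_mult_right)
      fix y assume "y \<in> {0..2*pi}"
      then have "norm (P (y - \<theta>) - g (y - \<theta>)) \<le> heat_kernel t \<eta> * C"
        unfolding P_def g_def C_def using elim \<eta>
        by (intro heat_kernel_periodization_remainder[where \<theta>=\<theta>]) auto
      then have "norm (P (y - \<theta>) - g (y - \<theta>)) * norm (f y) \<le> (heat_kernel t \<eta> * C) * norm (f y)"
        by (rule mult_right_mono) simp
      then show "norm (P (y - \<theta>) * f y - g (y - \<theta>) * f y) \<le> (heat_kernel t \<eta> * C) * norm (f y)"
        by (simp add: norm_mult[symmetric] left_diff_distrib)
    qed
    also have "\<dots> = heat_kernel t \<eta> * C * I" by (simp add: I_def)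
    finally have 1: "norm (heat_mean c t f \<theta> - (LINT y:{0..2*pi}|lborel. g (y - \<theta>) * f y)) \<le> heat_kernel t \<eta> * C * I" .
    have hq: "set_integrable lborel S (\<lambda>y. of_real (heat_kernel t (y - \<theta>)) * q y)" if "S \<in> sets borel" for S
    proof (rule set_integrable_bounded_mult[of S q _ "heat_kernel t 0"])
      show "set_integrable lborel S q" using qi that by (auto simp: set_integrable_def intro: integrable_mult_indicator)
    qed (use that heat_kernel_antimono[OF t, of 0] in auto)
    have "(LINT y:{0..2*pi}|lborel. g (y - \<theta>) * f y) = (LINT y:{0..2*pi}|lborel. of_real (heat_kernel t (y - \<theta>)) * q y)"
      by (intro set_lebesgue_integral_cong) (auto simp: g_def q_def)
    also have "\<dots> = (LINT y:{\<theta>-\<eta>..\<theta>+\<eta>} \<union> ({0..2*pi} - {\<theta>-\<eta>..\<theta>+\<eta>})|lborel. of_real (heat_kernel t (y - \<theta>)) * q y)"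
      by (rule arg_cong[of _ _ "\<lambda>S. LINT y:S|lborel. of_real (heat_kernel t (y - \<theta>)) * q y"]) (use \<eta> in auto)
    also have "\<dots> =
       (LINT y:{\<theta>-\<eta>..\<theta>+\<eta>}|lborel. of_real (heat_kernel t (y - \<theta>)) * q y) +
       (LINT y:{0..2*pi} - {\<theta>-\<eta>..\<theta>+\<eta>}|lborel. of_real (heat_kernel t (y - \<theta>)) * q y)"
      by (rule set_integral_Un) (auto intro: hq)
    finally have 2: "(LINT y:{0..2*pi}|lborel. g (y - \<theta>) * f y) - (LINT y:{\<theta>-\<eta>..\<theta>+\<eta>}|lborel. of_real (heat_kernel t (y - \<theta>)) * q y) =
       (LINT y:{0..2*pi} - {\<theta>-\<eta>..\<theta>+\<eta>}|lborel. of_real (heat_kernel t (y - \<theta>)) * q y)" by simp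
    have "norm (LINT y:{0..2*pi} - {\<theta>-\<eta>..\<theta>+\<eta>}|lborel. of_real (heat_kernel t (y - \<theta>)) * q y) \<le>
       (LINT y|lborel. heat_kernel t \<eta> * (indicator {0..2*pi} y *\<^sub>R norm (f y)))"
      unfolding set_lebesgue_integral_def
    proof (rule Bochner_Integration.integral_norm_bound_integral)
      show "integrable lborel (\<lambda>y. indicat_real ({0..2 * pi} - {\<theta> - \<eta>..\<theta> + \<eta>}) y *\<^sub>R (complex_of_real (heat_kernel t (y - \<theta>)) * q y))"
        using hq[of "{0..2 * pi} - {\<theta> - \<eta>..\<theta> + \<eta>}"] by (simp add: set_integrable_def)
      show "integrable lborel (\<lambda>y. heat_kernel t \<eta> * (indicat_real {0..2 * pi} y *\<^sub>R norm (f y)))"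
        using fn unfolding set_integrable_def by (rule integrable_mult_right)
      fix y
      show "norm (indicat_real ({0..2 * pi} - {\<theta> - \<eta>..\<theta> + \<eta>}) y *\<^sub>R (complex_of_real (heat_kernel t (y - \<theta>)) * q y))
          \<le> heat_kernel t \<eta> * (indicat_real {0..2 * pi} y *\<^sub>R norm (f y))"
      proof (cases "y \<in> {0..2 * pi} - {\<theta> - \<eta>..\<theta> + \<eta>}")
        case True
        then have "heat_kernel t (y - \<theta>) \<le> heat_kernel t \<eta>" using \<eta> by (intro heat_kernel_antimono t) auto
        then show ?thesis using True by (auto simp: q_def norm_mult intro: mult_right_mono)
      qed auto
    qed
    also have "\<dots> = heat_kernel t \<eta> * I" by (simp add: I_def set_lebesgue_integral_def)
    finally have "norm ((LINT y:{0..2*pi}|lborel. g (y - \<theta>) * f y) - (LINT y:{\<theta>-\<eta>..\<theta>+\<eta>}|lborel. of_real (heat_kernel t (y - \<theta>)) * q y)) \<le> heat_kernel t \<eta> * I"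
      unfolding 2 .
    with 1 show ?case
      by (rule norm_diff_triangle_le[THEN order_trans]) (simp add: algebra_simps)
  qed
  have "((\<lambda>t. heat_mean c t f \<theta> - (LINT y:{\<theta>-\<eta>..\<theta>+\<eta>}|lborel. of_real (heat_kernel t (y - \<theta>)) * q y)) \<longlongrightarrow> 0) (at_right 0)"
  proof (rule Lim_null_comparison[OF bound])
    show "((\<lambda>t. heat_kernel t \<eta> * ((C + 1) * I)) \<longlongrightarrow> 0) (at_right 0)"
      using \<eta>(1) by (auto intro!: tendsto_eq_intros heat_kernel_tendsto_0)
  qed
  moreover have "((\<lambda>t. LINT y:{\<theta>-\<eta>..\<theta>+\<eta>}|lborel. of_real (heat_kernel t (y - \<theta>)) * q y) \<longlongrightarrow> 0) (at_right 0)"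
    using small unfolding q_def[symmetric] by (rule heat_kernel_concentration[OF qi \<eta>(1)])
  ultimately have "((\<lambda>t. (heat_mean c t f \<theta> - (LINT y:{\<theta>-\<eta>..\<theta>+\<eta>}|lborel. of_real (heat_kernel t (y - \<theta>)) * q y)) +
      (LINT y:{\<theta>-\<eta>..\<theta>+\<eta>}|lborel. of_real (heat_kernel t (y - \<theta>)) * q y)) \<longlongrightarrow> 0 + 0) (at_right 0)"
    by (rule tendsto_add)
  then show ?thesis by (simp only: diff_add_cancel add_0)
qed

lemma Fourier_coeff_const: "Fourier_coeff (\<lambda>_. a) l = (if l = 0 then a else 0)"
proof -
  have "set_integrable lborel {0..2*pi} (\<lambda>y. cis (of_int l * y))"
    unfolding set_integrable_def by (intro borel_integrable_compact continuous_intros) auto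
  then have "(LINT y:{0..2*pi}|lborel. cis (of_int l * y)) = (if l = 0 then of_real (2 * pi) else 0)"
    using integral_cis[of l] by (simp add: set_borel_integral_eq_integral)
  then show ?thesis by (simp add: Fourier_coeff_def)
qed

text \<open>At almost every \<theta> the averages of two modulated functions converge, that of f and
  that of the constant 1. Subtracting the constant \<open>f \<theta>\<close> leaves a function whose
  modulated averages at \<theta> are small, and the heat mean of a constant has only the frequency
  0.\<close>

theorem heat_mean_tendsto_AE:
  assumes f: "set_integrable lborel {0..2*pi} f"
  shows "AE \<theta> in lborel. \<theta> \<in> {0<..<2*pi} \<longrightarrow> ((\<lambda>t. heat_mean c t f \<theta>) \<longlongrightarrow> f \<theta>) (at_right 0)"
proof -
  define h1 where "h1 = (\<lambda>y. indicator {0..2*pi} y *\<^sub>R (cis (c * y) * f y))"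
  define h2 where "h2 = (\<lambda>y. indicator {0..2*pi} y *\<^sub>R cis (c * y))"
  have h1: "integrable lborel h1"
    using set_integrable_bounded_mult[OF f, of "\<lambda>y. cis (c * y)" 1] unfolding h1_def set_integrable_def by simp
  have h2: "integrable lborel h2"
    unfolding h2_def by (intro borel_integrable_compact continuous_intros) auto
  show ?thesis
    using AE_integral_average[OF h1] AE_integral_average[OF h2]
  proof eventually_elim
    case (elim \<theta>)
    show ?case
    proof
      assume \<theta>: "\<theta> \<in> {0<..<2*pi}"
      define k where "k = (\<lambda>y. f y - f \<theta>)"
      have ci: "set_integrable lborel {0..2*pi} (\<lambda>y. a)" for a :: complex
        unfolding set_integrable_def by (intro borel_integrable_compact continuous_intros) auto
      have ki: "set_integrable lborel {0..2*pi} k" unfolding k_def by (rule set_integral_diff(1)[OF f ci])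
      have hs: "set_integrable lborel S h1" "set_integrable lborel S h2" if "S \<in> sets borel" for S
        using h1 h2 that by (auto simp: set_integrable_def intro!: integrable_mult_indicator)
      have A: "(LINT y:S|lborel. cis (c * (y - \<theta>)) * (indicator {0..2*pi} y *\<^sub>R k y)) =
          cis (- c * \<theta>) * ((LINT y:S|lborel. h1 y) - f \<theta> * (LINT y:S|lborel. h2 y))" if "S \<in> sets borel" for S
      proof -
        have "cis (c * (y - \<theta>)) * (indicator {0..2*pi} y *\<^sub>R k y) = cis (- c * \<theta>) * (h1 y - f \<theta> * h2 y)" for y
        proof -
          have "cis (c * (y - \<theta>)) = cis (- c * \<theta>) * cis (c * y)" by (simp add: cis_mult algebra_simps)
          then show ?thesis by (cases "y \<in> {0..2*pi}") (simp_all add: h1_def h2_def k_def algebra_simps)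
        qed
        then show ?thesis
          using hs[OF that] by (simp add: set_integral_diff(2))
      qed
      have "((\<lambda>t. heat_mean c t k \<theta>) \<longlongrightarrow> 0) (at_right 0)"
      proof (rule heat_mean_tendsto_0[OF ki \<theta>])
        fix \<epsilon> :: real assume "\<epsilon> > 0"
        \<comment> \<open>The two averaging errors enter with the weights 1 and |f \<theta>|; with
          \<open>e\<close> equal to \<epsilon> / (2 D) they add up to at most \<epsilon> r on an
          interval of length 2 r.\<close>
        define D where "D = 1 + norm (f \<theta>)"
        have den: "D > 0" using norm_ge_zero[of "f \<theta>"] unfolding D_def by linarith
        define e where "e = (\<epsilon> / 2) / D"
        have "e > 0" using \<open>\<epsilon> > 0\<close> den by (simp add: e_def)
        obtain d1 where d1: "d1 > 0" "\<And>u v. u \<le> \<theta> \<Longrightarrow> \<theta> \<le> v \<Longrightarrow> \<theta> - d1 < u \<Longrightarrow> v < \<theta> + d1 \<Longrightarrow>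
            norm ((LINT y:{u..v}|lborel. h1 y) - of_real (v - u) * h1 \<theta>) \<le> e * (v - u)"
          using elim(1) \<open>e > 0\<close> by blast
        obtain d2 where d2: "d2 > 0" "\<And>u v. u \<le> \<theta> \<Longrightarrow> \<theta> \<le> v \<Longrightarrow> \<theta> - d2 < u \<Longrightarrow> v < \<theta> + d2 \<Longrightarrow>
            norm ((LINT y:{u..v}|lborel. h2 y) - of_real (v - u) * h2 \<theta>) \<le> e * (v - u)"
          using elim(2) \<open>e > 0\<close> by blast
        show "\<exists>\<delta>>0. \<forall>r. 0 \<le> r \<longrightarrow> r < \<delta> \<longrightarrow>
          norm (LINT y:{\<theta>-r..\<theta>+r}|lborel. cis (c * (y - \<theta>)) * (indicator {0..2*pi} y *\<^sub>R k y)) \<le> \<epsilon> * r"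
        proof (intro exI[of _ "min d1 d2"] conjI allI impI)
          fix r assume r: "0 \<le> r" "r < min d1 d2"
          define I1 where "I1 = (LINT y:{\<theta>-r..\<theta>+r}|lborel. h1 y)"
          define I2 where "I2 = (LINT y:{\<theta>-r..\<theta>+r}|lborel. h2 y)"
          have b1: "norm (I1 - of_real (2 * r) * h1 \<theta>) \<le> e * (2 * r)"
            using d1(2)[of "\<theta> - r" "\<theta> + r"] r by (simp add: I1_def)
          have b2: "norm (I2 - of_real (2 * r) * h2 \<theta>) \<le> e * (2 * r)"
            using d2(2)[of "\<theta> - r" "\<theta> + r"] r by (simp add: I2_def)
          have "h1 \<theta> = f \<theta> * h2 \<theta>" using \<theta> by (simp add: h1_def h2_def)
          then have eq: "I1 - f \<theta> * I2 = (I1 - of_real (2 * r) * h1 \<theta>) - f \<theta> * (I2 - of_real (2 * r) * h2 \<theta>)"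
            by (simp add: algebra_simps)
          have "norm (I1 - f \<theta> * I2) \<le> norm (I1 - of_real (2 * r) * h1 \<theta>) + norm (f \<theta>) * norm (I2 - of_real (2 * r) * h2 \<theta>)"
            unfolding eq norm_mult[symmetric] by (rule norm_triangle_ineq4)
          also have "\<dots> \<le> e * (2 * r) + norm (f \<theta>) * (e * (2 * r))"
            using b1 b2 by (intro add_mono mult_left_mono) auto
          also have "\<dots> = (e * D) * (2 * r)"
            by (simp add: D_def algebra_simps)
          also have "e * D = \<epsilon> / 2"
            using den unfolding e_def by simp
          also have "\<epsilon> / 2 * (2 * r) = \<epsilon> * r" by simp
          finally show "norm (LINT y:{\<theta>-r..\<theta>+r}|lborel. cis (c * (y - \<theta>)) * (indicator {0..2*pi} y *\<^sub>R k y)) \<le> \<epsilon> * r"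
            by (subst A) (simp_all add: norm_mult I1_def I2_def)
        qed (use d1(1) d2(1) in auto)
      qed
      moreover have "((\<lambda>t. of_real (exp (- t * c\<^sup>2)) * f \<theta>) \<longlongrightarrow> of_real (exp (- 0 * c\<^sup>2)) * f \<theta>) (at_right 0)"
        by (intro tendsto_intros)
      ultimately have "((\<lambda>t. heat_mean c t k \<theta> + of_real (exp (- t * c\<^sup>2)) * f \<theta>) \<longlongrightarrow> 0 + of_real (exp (- 0 * c\<^sup>2)) * f \<theta>) (at_right 0)"
        by (rule tendsto_add)
      moreover have "\<forall>\<^sub>F t in at_right 0. heat_mean c t k \<theta> + of_real (exp (- t * c\<^sup>2)) * f \<theta> = heat_mean c t f \<theta>"
        using eventually_at_right_less[of "0::real"]
      proof eventually_elim
        case (elim t)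
        have co: "Fourier_coeff f l = Fourier_coeff k l + Fourier_coeff (\<lambda>_. f \<theta>) l" for l
        proof -
          have i: "set_integrable lborel {0..2*pi} (\<lambda>y. cis (of_int l * y) * k y)"
            "set_integrable lborel {0..2*pi} (\<lambda>y. cis (of_int l * y) * f \<theta>)"
            by (rule set_integrable_bounded_mult[OF ki, of _ 1] set_integrable_bounded_mult[OF ci, of _ 1]; simp)+
          have "(LINT y:{0..2*pi}|lborel. cis (of_int l * y) * f y) = (LINT y:{0..2*pi}|lborel. cis (of_int l * y) * k y + cis (of_int l * y) * f \<theta>)"
            by (simp add: k_def algebra_simps)
          also have "\<dots> = (LINT y:{0..2*pi}|lborel. cis (of_int l * y) * k y) + (LINT y:{0..2*pi}|lborel. cis (of_int l * y) * f \<theta>)"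
            by (rule set_integral_add(2)[OF i])
          finally show ?thesis by (simp add: Fourier_coeff_def add_divide_distrib)
        qed
        have "heat_mean c t f \<theta> = heat_mean c t k \<theta> + heat_mean c t (\<lambda>_. f \<theta>) \<theta>"
          unfolding heat_mean_def co distrib_left distrib_right
          by (rule infsum_add[OF heat_mean_summable[OF ki elim] heat_mean_summable[OF ci elim]])
        also have "heat_mean c t (\<lambda>_. f \<theta>) \<theta> = (\<Sum>\<^sub>\<infinity>l\<in>{0::int}. of_real (exp (- t * (of_int l - c)\<^sup>2)) * (Fourier_coeff (\<lambda>_. f \<theta>) l * cis (- of_int l * \<theta>)))"
          unfolding heat_mean_def by (rule infsum_cong_neutral) (auto simp: Fourier_coeff_const)
        also have "\<dots> = of_real (exp (- t * c\<^sup>2)) * f \<theta>" by (simp add: Fourier_coeff_const)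
        finally show ?case by simp
      qed
      ultimately show "((\<lambda>t. heat_mean c t f \<theta>) \<longlongrightarrow> f \<theta>) (at_right 0)"
        using Lim_transform_eventually by fastforce
    qed
  qed
qed

section \<open>The circle\<close>

lemma space_circle_haar [simp]: "space circle_haar = sphere 0 1"
  by (simp add: circle_haar_def space_restrict_space)

lemma sets_circle_haar: "sets circle_haar = sets (restrict_space borel (sphere 0 1))"
  by (simp add: circle_haar_def)

lemma measurable_circle_haar: "borel_measurable circle_haar = borel_measurable (restrict_space borel (sphere (0::complex) 1))"
  by (rule measurable_cong_sets[OF sets_circle_haar refl])

lemma continuous_on_measurable_circle:
  "continuous_on (sphere 0 1) (f :: complex \<Rightarrow> complex) \<Longrightarrow> f \<in> borel_measurable circle_haar"
  unfolding measurable_circle_haar by (rule borel_measurable_continuous_on_restrict)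

lemma cis_measurable_circle: "cis \<in> measurable borel (restrict_space borel (sphere 0 1))"
  by (intro measurable_restrict_space2 borel_measurable_continuous_onI continuous_intros) auto

lemma uniform_measure_angle:
  "uniform_measure lborel {0..2*pi} = density lborel (\<lambda>x. ennreal (indicator {0..2*pi} x / (2 * pi)))"
  unfolding uniform_measure_def
  by (rule arg_cong[of _ _ "density lborel"]) (auto simp: fun_eq_iff indicator_def divide_ennreal ennreal_1[symmetric] simp del: ennreal_1)

lemma circle_integral:
  fixes f :: "complex \<Rightarrow> complex"
  assumes f: "f \<in> borel_measurable circle_haar"
  shows "integrable circle_haar f \<longleftrightarrow> set_integrable lborel {0..2*pi} (\<lambda>\<theta>. f (cis \<theta>))"
    and "(LINT z|circle_haar. f z) = (LINT \<theta>:{0..2*pi}|lborel. f (cis \<theta>)) / of_real (2 * pi)"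
proof -
  have m: "f \<in> borel_measurable (restrict_space borel (sphere 0 1))" using f by (simp add: measurable_circle_haar)
  have c: "cis \<in> measurable (uniform_measure lborel {0..2*pi}) (restrict_space borel (sphere 0 1))"
    using cis_measurable_circle by (simp add: measurable_cong_sets[OF sets_uniform_measure refl])
  have fc: "(\<lambda>\<theta>. f (cis \<theta>)) \<in> borel_measurable lborel"
    using measurable_compose[OF cis_measurable_circle m] by simp
  have eq: "(indicat_real {0..2 * pi} x / (2 * pi)) *\<^sub>R f (cis x) = (indicat_real {0..2 * pi} x *\<^sub>R f (cis x)) / of_real (2 * pi)" for x
    by (simp add: scaleR_conv_of_real)
  show "integrable circle_haar f \<longleftrightarrow> set_integrable lborel {0..2*pi} (\<lambda>\<theta>. f (cis \<theta>))"
  proof -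
    have "integrable circle_haar f \<longleftrightarrow> integrable (uniform_measure lborel {0..2*pi}) (\<lambda>\<theta>. f (cis \<theta>))"
      unfolding circle_haar_def by (rule integrable_distr_eq[OF c m])
    also have "\<dots> \<longleftrightarrow> integrable lborel (\<lambda>\<theta>. (indicat_real {0..2 * pi} \<theta> / (2 * pi)) *\<^sub>R f (cis \<theta>))"
      unfolding uniform_measure_angle by (rule integrable_density[OF fc]) auto
    also have "\<dots> \<longleftrightarrow> set_integrable lborel {0..2*pi} (\<lambda>\<theta>. f (cis \<theta>))"
    proof
      assume "integrable lborel (\<lambda>\<theta>. (indicat_real {0..2 * pi} \<theta> / (2 * pi)) *\<^sub>R f (cis \<theta>))"
      from integrable_scaleR_right[where c="2 * pi", OF this]
      show "set_integrable lborel {0..2*pi} (\<lambda>\<theta>. f (cis \<theta>))" by (simp add: set_integrable_def)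
    next
      assume "set_integrable lborel {0..2*pi} (\<lambda>\<theta>. f (cis \<theta>))"
      then show "integrable lborel (\<lambda>\<theta>. (indicat_real {0..2 * pi} \<theta> / (2 * pi)) *\<^sub>R f (cis \<theta>))"
        unfolding eq set_integrable_def by (rule integrable_divide_zero)
    qed
    finally show ?thesis .
  qed
  have "(LINT z|circle_haar. f z) = (LINT \<theta>|lborel. (indicat_real {0..2 * pi} \<theta> / (2 * pi)) *\<^sub>R f (cis \<theta>))"
    unfolding circle_haar_def integral_distr[OF c m]
    unfolding uniform_measure_angle by (rule integral_density[OF fc]) auto
  then show "(LINT z|circle_haar. f z) = (LINT \<theta>:{0..2*pi}|lborel. f (cis \<theta>)) / of_real (2 * pi)"
    unfolding eq set_lebesgue_integral_def by simp
qed

text \<open>The property \<open>P\<close> may be non-measurable, so what is transported to the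
  circle is a null set of angles that covers the exceptions. The angle is a Borel function of the
  point once 1 is set aside, the common image of both ends of the period.\<close>

lemma AE_circleI:
  assumes "AE \<theta> in lborel. \<theta> \<in> {0<..<2*pi} \<longrightarrow> P (cis \<theta>)"
  shows "AE z in circle_haar. P z"
proof -
  obtain N where N: "N \<in> null_sets lborel" "{\<theta> \<in> space lborel. \<not> (\<theta> \<in> {0<..<2*pi} \<longrightarrow> P (cis \<theta>))} \<subseteq> N"
    using assms unfolding eventually_ae_filter by blast
  define A where "A = sphere 0 1 - {1::complex}"
  \<comment> \<open>\<open>Arg2pi\<close> is continuous off the nonnegative reals; on the circle
    this costs the point 1, where \<open>F\<close> is set to 0.\<close>
  define F where "F = (\<lambda>z. indicator A z *\<^sub>R Arg2pi z)"
  have "A \<in> sets borel" unfolding A_def by simp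
  have "continuous_on A Arg2pi"
  proof (rule continuous_at_imp_continuous_on, rule ballI, rule continuous_at_Arg2pi)
    fix z assume "z \<in> A"
    then show "z \<notin> \<real>\<^sub>\<ge>\<^sub>0"
      by (auto simp: A_def nonneg_Reals_def)
  qed
  then have [measurable]: "F \<in> borel_measurable borel"
    unfolding F_def using \<open>A \<in> sets borel\<close> by (intro borel_measurable_continuous_on_indicator)
  have [measurable]: "N \<in> sets borel" using N(1) by auto
  have F: "F (cis \<theta>) = \<theta>" "cis \<theta> \<noteq> 1" if "\<theta> \<in> {0<..<2*pi}" for \<theta>
  proof -
    have a: "Arg2pi (cis \<theta>) = \<theta>"
      using that by (intro Arg2pi_unique[of 1]) (auto simp: cis_conv_exp)
    have "Arg2pi 1 = 0" by (rule Arg2pi_unique[of 1]) auto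
    then show "cis \<theta> \<noteq> 1" using a that by auto
    then show "F (cis \<theta>) = \<theta>" using a by (simp add: F_def A_def)
  qed
  define B where "B = {z \<in> sphere 0 1. z = 1 \<or> F z \<in> N}"
  have "B = sphere 0 1 \<inter> ({1} \<union> F -` N)" by (auto simp: B_def)
  moreover have "F -` N \<in> sets borel" using measurable_sets[of F borel borel N] by simp
  then have "{1} \<union> F -` N \<in> sets borel" by auto
  ultimately have B: "B \<in> sets circle_haar"
    unfolding sets_circle_haar sets_restrict_space by (metis image_eqI)
  have "AE z in circle_haar. z \<notin> B"
    unfolding circle_haar_def
  proof (subst AE_distr_iff)
    show "cis \<in> measurable (uniform_measure lborel {0..2*pi}) (restrict_space borel (sphere 0 1))"
      using cis_measurable_circle by (simp add: measurable_cong_sets[OF sets_uniform_measure refl])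
    have "{z \<in> space (restrict_space borel (sphere 0 1)). z \<notin> B} = space circle_haar - B"
      by (auto simp: space_restrict_space)
    then show "{z \<in> space (restrict_space borel (sphere 0 1)). z \<notin> B} \<in> sets (restrict_space borel (sphere 0 1))"
      using B sets.compl_sets[OF B] by (simp add: sets_circle_haar)
    show "AE \<theta> in uniform_measure lborel {0..2 * pi}. cis \<theta> \<notin> B"
    proof (rule AE_uniform_measureI)
      show "AE \<theta> in lborel. \<theta> \<in> {0..2*pi} \<longrightarrow> cis \<theta> \<notin> B"
        using AE_not_in[OF N(1)] AE_lborel_singleton[of 0] AE_lborel_singleton[of "2*pi"]
      proof eventually_elim
        case (elim \<theta>)
        then show ?case using F[of \<theta>] by (auto simp: B_def)
      qed
    qed simp
  qed
  moreover have "AE z in circle_haar. z \<in> space circle_haar" by (rule AE_space)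
  ultimately show ?thesis
  proof eventually_elim
    case (elim z)
    have z: "z = cis (Arg2pi z)" using Arg2pi_eq[of z] elim(2) by (simp add: cis_conv_exp)
    have "z \<noteq> 1" "F z \<notin> N" using elim by (auto simp: B_def)
    have "Arg2pi z \<noteq> 0" using z \<open>z \<noteq> 1\<close> by auto
    then have "Arg2pi z \<in> {0<..<2*pi}" using Arg2pi[of z] by (auto simp: less_le)
    moreover have "F z = Arg2pi z" using \<open>z \<noteq> 1\<close> elim by (simp add: F_def A_def)
    ultimately have "P (cis (Arg2pi z))" using N(2) \<open>F z \<notin> N\<close> by auto
    then show "P z" using z by simp
  qed
qed

lemma spherical_eq_Fourier_coeff:
  assumes "w \<in> borel_measurable circle_haar"
  shows "spherical w l = Fourier_coeff (\<lambda>\<theta>. w (cis \<theta>)) l"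
proof -
  have "(\<lambda>z. z powi l * w z) \<in> borel_measurable circle_haar"
    by (rule borel_measurable_times[OF continuous_on_measurable_circle assms]) (auto intro!: continuous_intros)
  from circle_integral(2)[OF this] show ?thesis
    by (simp add: spherical_def Fourier_coeff_def cis_power_int)
qed

section \<open>The regulator of the theorem\<close>

text \<open>Completing the square gives (l + 1 - N) l = (l - c)^2 - c^2; the resulting factor exp (t
  c^2) is independent of l and tends to 1.\<close>

lemma regulated_term_eq:
  assumes "N \<ge> 1"
  defines "c \<equiv> (real N - 1) / 2"
  shows "a * cis \<theta> powi (- l) * regulator N t l =
    of_real (exp (t * c\<^sup>2)) * (of_real (exp (- t * (of_int l - c)\<^sup>2)) * (a * cis (- of_int l * \<theta>)))"
proof -
  have "(of_int l - c)\<^sup>2 - c\<^sup>2 = of_int ((l + 1 - int N) * l)"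
    by (simp add: c_def power2_eq_square field_simps)
  from arg_cong[OF this, of "\<lambda>x. - t * x"]
  have e: "- t * of_int ((l + 1 - int N) * l) = t * c\<^sup>2 + (- t * (of_int l - c)\<^sup>2)"
    unfolding right_diff_distrib by simp
  have "regulator N t l = exp (of_real (- t * of_int ((l + 1 - int N) * l)))"
    by (simp add: regulator_def)
  also have "\<dots> = of_real (exp (t * c\<^sup>2 + (- t * (of_int l - c)\<^sup>2)))"
    unfolding e by (rule exp_of_real)
  also have "\<dots> = of_real (exp (t * c\<^sup>2)) * of_real (exp (- t * (of_int l - c)\<^sup>2))"
    by (simp only: exp_add of_real_mult)
  finally show ?thesis by (simp add: cis_power_int mult_ac)
qed

lemma regulated_series_summable:
  assumes "N \<ge> 1" and f: "integrable circle_haar f" and "t > 0" "z \<in> sphere 0 1"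
  shows "(\<lambda>l. spherical f l * z powi (- l) * regulator N t l) summable_on UNIV"
proof -
  have z: "z = cis (Arg2pi z)" using Arg2pi_eq[of z] assms(4) by (simp add: cis_conv_exp)
  have m: "f \<in> borel_measurable circle_haar" using f by auto
  have i: "set_integrable lborel {0..2*pi} (\<lambda>\<theta>. f (cis \<theta>))" using circle_integral(1)[OF m] f by simp
  show ?thesis
    unfolding spherical_eq_Fourier_coeff[OF m]
    by (subst z, subst regulated_term_eq[OF assms(1)])
      (intro summable_on_cmult_right heat_mean_summable i assms(3))
qed

theorem regulated_series_tendsto_AE:
  assumes N: "N \<ge> 1" and f: "integrable circle_haar f"
  shows "AE z in circle_haar. ((\<lambda>t. \<Sum>\<^sub>\<infinity>l. spherical f l * z powi (- l) * regulator N t l) \<longlongrightarrow> f z) (at_right 0)"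
proof (rule AE_circleI)
  have m: "f \<in> borel_measurable circle_haar" using f by auto
  have i: "set_integrable lborel {0..2*pi} (\<lambda>\<theta>. f (cis \<theta>))" using circle_integral(1)[OF m] f by simp
  define c where "c = (real N - 1) / 2"
  have eq: "(\<Sum>\<^sub>\<infinity>l. spherical f l * cis \<theta> powi (- l) * regulator N t l) = of_real (exp (t * c\<^sup>2)) * heat_mean c t (\<lambda>\<theta>. f (cis \<theta>)) \<theta>" for \<theta> t
    unfolding spherical_eq_Fourier_coeff[OF m] heat_mean_def regulated_term_eq[OF N] c_def
    by (rule infsum_cmult_right')
  show "AE \<theta> in lborel. \<theta> \<in> {0<..<2*pi} \<longrightarrow> ((\<lambda>t. \<Sum>\<^sub>\<infinity>l. spherical f l * cis \<theta> powi (- l) * regulator N t l) \<longlongrightarrow> f (cis \<theta>)) (at_right 0)"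
    unfolding eq
    using heat_mean_tendsto_AE[OF i, of c]
  proof eventually_elim
    case (elim \<theta>)
    show ?case
    proof
      assume "\<theta> \<in> {0<..<2*pi}"
      then have "((\<lambda>t. of_real (exp (t * c\<^sup>2)) * heat_mean c t (\<lambda>\<theta>. f (cis \<theta>)) \<theta>) \<longlongrightarrow> of_real (exp (0 * c\<^sup>2)) * f (cis \<theta>)) (at_right 0)"
        using elim by (intro tendsto_intros) auto
      then show "((\<lambda>t. of_real (exp (t * c\<^sup>2)) * heat_mean c t (\<lambda>\<theta>. f (cis \<theta>)) \<theta>) \<longlongrightarrow> f (cis \<theta>)) (at_right 0)" by simp
    qed
  qed
qed

section \<open>Measurability of the derivative along the circle\<close>

text \<open>Quotients in terms of the increment, so that the addition formula of \<open>cis\<close>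
  alone moves the base point between the angle 0 and any other angle.\<close>

lemma has_vector_derivative_at_iff_tendsto:
  fixes f :: "real \<Rightarrow> 'a::real_normed_vector"
  shows "(f has_vector_derivative D) (at x) \<longleftrightarrow> ((\<lambda>h. (f (x + h) - f x) /\<^sub>R h) \<longlongrightarrow> D) (at 0)"
proof -
  have "(f has_vector_derivative D) (at x) \<longleftrightarrow> (\<lambda>h. norm (f (x + h) - f x - h *\<^sub>R D) / norm h) \<midarrow>0\<rightarrow> 0"
    unfolding has_vector_derivative_def has_derivative_at by (simp add: bounded_linear_scaleR_left)
  also have "\<dots> \<longleftrightarrow> (\<lambda>h. norm ((f (x + h) - f x) /\<^sub>R h - D)) \<midarrow>0\<rightarrow> 0"
  proof (rule Lim_cong_within)
    fix h :: real assume "h \<noteq> 0"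
    then have "(f (x + h) - f x) /\<^sub>R h - D = (f (x + h) - f x - h *\<^sub>R D) /\<^sub>R h"
      by (simp add: scaleR_diff_right)
    then show "norm (f (x + h) - f x - h *\<^sub>R D) / norm h = norm ((f (x + h) - f x) /\<^sub>R h - D)"
      by (simp add: divide_inverse_commute)
  qed auto
  also have "\<dots> \<longleftrightarrow> ((\<lambda>h. (f (x + h) - f x) /\<^sub>R h) \<longlongrightarrow> D) (at 0)"
    by (simp add: tendsto_norm_zero_iff LIM_zero_iff)
  finally show ?thesis .
qed

text \<open>\<open>circle_deriv\<close> is total, so measurability includes the points without a
  derivative. The points of differentiability form a Borel set by the Cauchy criterion for
  difference quotients, and on it the derivative is a limit along a single sequence of
  increments.\<close>

lemma circle_deriv_measurable:
  assumes f: "continuous_on (sphere 0 1) f"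
  shows "circle_deriv f \<in> borel_measurable circle_haar"
proof -
  define S where "S = sphere (0::complex) 1"
  define q where "q = (\<lambda>s z. (f (z * cis s) - f z) /\<^sub>R s)"
  define Df where "Df = (\<lambda>z. \<exists>L. ((\<lambda>s. q s z) \<longlongrightarrow> L) (at 0))"
  have contq: "continuous_on S (q s)" for s
    unfolding q_def S_def
    by (intro continuous_intros continuous_on_compose2[OF f] f) (auto simp: norm_mult)
  have vd: "((\<lambda>\<theta>. f (z * cis \<theta>)) has_vector_derivative L) (at 0) \<longleftrightarrow> ((\<lambda>s. q s z) \<longlongrightarrow> L) (at 0)" for z L
    unfolding has_vector_derivative_at_iff_tendsto q_def by simp
  \<comment> \<open>The Cauchy criterion at accuracy 1 / (n + 1) for increments below 1 / (m + 1).
    Quantifying over uncountably many increments is harmless, since each pair gives a closed set and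
    arbitrary intersections of closed sets are closed.\<close>
  define C where "C = (\<lambda>n m :: nat. {z \<in> S. \<forall>s s'. s \<noteq> 0 \<and> s' \<noteq> 0 \<and> \<bar>s\<bar> < 1 / Suc m \<and> \<bar>s'\<bar> < 1 / Suc m \<longrightarrow> norm (q s z - q s' z) \<le> 1 / Suc n})"
  have "closed (C n m)" for n m
  proof -
    have "C n m = S \<inter> (\<Inter>(s, s')\<in>{(s, s'). s \<noteq> 0 \<and> s' \<noteq> 0 \<and> \<bar>s\<bar> < 1 / Suc m \<and> \<bar>s'\<bar> < 1 / Suc m}. {z \<in> S. norm (q s z - q s' z) \<le> 1 / Suc n})"
      by (auto simp: C_def)
    moreover have "closed {z \<in> S. norm (q s z - q s' z) \<le> 1 / Suc n}" for s s'
    proof -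
      have "closed (S \<inter> (\<lambda>z. norm (q s z - q s' z)) -` {..1 / Suc n})"
        by (intro continuous_closed_preimage continuous_intros contq) (auto simp: S_def)
      moreover have "S \<inter> (\<lambda>z. norm (q s z - q s' z)) -` {..1 / Suc n} = {z \<in> S. norm (q s z - q s' z) \<le> 1 / Suc n}"
        by auto
      ultimately show ?thesis by simp
    qed
    ultimately show ?thesis by (auto simp: S_def intro!: closed_Int closed_INT)
  qed
  have lim_seq: "((\<lambda>k. q (1 / Suc k) z) \<longlonglongrightarrow> L)" if "((\<lambda>s. q s z) \<longlongrightarrow> L) (at 0)" for z L
  proof -
    have "(\<lambda>k. 1 / real (Suc k)) \<longlonglongrightarrow> 0" by (rule LIMSEQ_Suc[OF lim_1_over_n])
    then have "filterlim (\<lambda>k. 1 / real (Suc k)) (at 0) sequentially"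
      by (simp add: filterlim_at)
    from filterlim_compose[OF that this] show ?thesis .
  qed
  have Df_eq: "{z \<in> S. Df z} = (\<Inter>n. \<Union>m. C n m)"
  proof (intro equalityI subsetI)
    fix z assume z: "z \<in> {z \<in> S. Df z}"
    then obtain L where L: "((\<lambda>s. q s z) \<longlongrightarrow> L) (at 0)" by (auto simp: Df_def)
    have "\<exists>m. z \<in> C n m" for n
    proof -
      have "1 / real (Suc n) / 2 > 0" by simp
      from L[unfolded LIM_eq, rule_format, OF this]
      obtain d where d: "d > 0" "\<And>s. s \<noteq> 0 \<Longrightarrow> \<bar>s\<bar> < d \<Longrightarrow> norm (q s z - L) < 1 / real (Suc n) / 2"
        unfolding diff_0_right real_norm_def by blast
      obtain m where m: "1 / real (Suc m) < d" using d(1) nat_approx_posE by blast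
      have "norm (q s z - q s' z) \<le> 1 / Suc n" if "s \<noteq> 0" "s' \<noteq> 0" "\<bar>s\<bar> < 1 / Suc m" "\<bar>s'\<bar> < 1 / Suc m" for s s'
      proof -
        have "norm (q s z - q s' z) \<le> norm (q s z - L) + norm (q s' z - L)"
          using norm_triangle_ineq4[of "q s z - L" "q s' z - L"] by simp
        moreover have "norm (q s z - L) < 1 / real (Suc n) / 2" "norm (q s' z - L) < 1 / real (Suc n) / 2"
          using d(2) that m by auto
        ultimately show ?thesis by linarith
      qed
      then show ?thesis using z by (auto simp: C_def)
    qed
    then show "z \<in> (\<Inter>n. \<Union>m. C n m)" by auto
  next
    fix z assume z: "z \<in> (\<Inter>n. \<Union>m. C n m)"
    then have "\<forall>n. \<exists>m. z \<in> C n m" by blast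
    then obtain m where m: "\<And>n. z \<in> C n (m n)" unfolding choice_iff by blast
    have near: "norm (q s z - q s' z) \<le> 1 / Suc n" if "s \<noteq> 0" "s' \<noteq> 0" "\<bar>s\<bar> < 1 / Suc (m n)" "\<bar>s'\<bar> < 1 / Suc (m n)" for n s s'
      using m[of n] that by (auto simp: C_def)
    have "Cauchy (\<lambda>k. q (1 / Suc k) z)"
    proof (rule metric_CauchyI)
      fix e :: real assume "e > 0"
      then obtain n where n: "1 / real (Suc n) < e" using nat_approx_posE by blast
      have "dist (q (1 / Suc j) z) (q (1 / Suc k) z) < e" if "j \<ge> Suc (m n)" "k \<ge> Suc (m n)" for j k
      proof -
        have "norm (q (1 / Suc j) z - q (1 / Suc k) z) \<le> 1 / Suc n"
          using that by (intro near) (auto simp: field_simps)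
        then show ?thesis using n by (simp add: dist_norm)
      qed
      then show "\<exists>M. \<forall>j\<ge>M. \<forall>k\<ge>M. dist (q (1 / Suc j) z) (q (1 / Suc k) z) < e" by blast
    qed
    then obtain L where L: "(\<lambda>k. q (1 / Suc k) z) \<longlonglongrightarrow> L" using Cauchy_convergent convergent_def by blast
    have "((\<lambda>s. q s z) \<longlongrightarrow> L) (at 0)"
      unfolding LIM_eq
    proof (intro allI impI)
      fix e :: real assume "e > 0"
      then obtain n where n: "1 / real (Suc n) < e" using nat_approx_posE by blast
      show "\<exists>d>0. \<forall>s. s \<noteq> 0 \<and> norm (s - 0) < d \<longrightarrow> norm (q s z - L) < e"
      proof (intro exI[of _ "1 / Suc (m n)"] conjI allI impI)
        fix s :: real assume s: "s \<noteq> 0 \<and> norm (s - 0) < 1 / Suc (m n)"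
        have "norm (q s z - L) \<le> 1 / Suc n"
        proof (rule LIMSEQ_le_const2[OF tendsto_norm[OF tendsto_diff[OF tendsto_const L]]])
          show "\<exists>N. \<forall>k\<ge>N. norm (q s z - q (1 / Suc k) z) \<le> 1 / Suc n"
            using s by (intro exI[of _ "Suc (m n)"] allI impI near) (auto simp: field_simps)
        qed
        then show "norm (q s z - L) < e" using n by simp
      qed simp
    qed
    then show "z \<in> {z \<in> S. Df z}" using m[of 0] by (auto simp: Df_def C_def)
  qed
  have Dfm: "{z \<in> space circle_haar. Df z} \<in> sets circle_haar"
  proof -
    have "{z \<in> S. Df z} \<in> sets borel"
      unfolding Df_eq using \<open>\<And>n m. closed (C n m)\<close> by (intro sets.countable_INT sets.countable_UN) auto
    moreover have "{z \<in> S. Df z} \<subseteq> S" by auto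
    ultimately show ?thesis
      unfolding sets_circle_haar sets_restrict_space space_circle_haar S_def[symmetric] by auto
  qed
  \<comment> \<open>the junk value of \<open>vector_derivative\<close> at the points where \<open>f\<close> is not differentiable\<close>
  define u where "u = (SOME L :: complex. False)"
  have "circle_deriv f z = (if Df z then lim (\<lambda>k. q (1 / Suc k) z) else u) / (\<i> * z)" for z
  proof (cases "Df z")
    case True
    then obtain L where L: "((\<lambda>s. q s z) \<longlongrightarrow> L) (at 0)" by (auto simp: Df_def)
    then have "vector_derivative (\<lambda>\<theta>. f (z * cis \<theta>)) (at 0) = L" using vd vector_derivative_at by blast
    then show ?thesis using True limI[OF lim_seq[OF L]] by (simp add: circle_deriv_def)
  next
    case False
    then have "((\<lambda>\<theta>. f (z * cis \<theta>)) has_vector_derivative L) (at 0) \<longleftrightarrow> False" for L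
      unfolding vd Df_def by blast
    then show ?thesis using False by (simp add: circle_deriv_def vector_derivative_def u_def)
  qed
  then have "circle_deriv f = (\<lambda>z. (if Df z then lim (\<lambda>k. q (1 / Suc k) z) else u) / (\<i> * z))" by auto
  moreover have "(\<lambda>z. (if Df z then lim (\<lambda>k. q (1 / Suc k) z) else u) / (\<i> * z)) \<in> borel_measurable circle_haar"
  proof (intro borel_measurable_divide measurable_If borel_measurable_lim_metric Dfm)
    show "q (1 / Suc k) \<in> borel_measurable circle_haar" for k
      using contq by (intro continuous_on_measurable_circle) (simp add: S_def)
    show "(\<lambda>z. \<i> * z) \<in> borel_measurable circle_haar"
      by (intro continuous_on_measurable_circle continuous_intros)
  qed auto
  ultimately show ?thesis by simp
qed

section \<open>Calculus of derivatives along the circle\<close>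

text \<open>Relational form, which asserts existence together with the value; an equation for
  \<open>circle_deriv\<close> alone would not. The factor i z is the velocity of the path
  \<open>z * cis \<theta>\<close> at \<theta> = 0.\<close>

definition has_circle_deriv :: "(complex \<Rightarrow> complex) \<Rightarrow> complex \<Rightarrow> complex \<Rightarrow> bool" where
  "has_circle_deriv f D z \<longleftrightarrow> ((\<lambda>\<theta>. f (z * cis \<theta>)) has_vector_derivative (\<i> * z * D)) (at 0)"

lemma has_circle_deriv_imp: "has_circle_deriv f D z \<Longrightarrow> z \<in> sphere 0 1 \<Longrightarrow> circle_deriv f z = D"
  unfolding has_circle_deriv_def circle_deriv_def by (auto dest!: vector_derivative_at)

lemma differentiable_iff_has_circle_deriv:
  assumes "z \<in> sphere 0 1"
  shows "(\<lambda>\<theta>. f (z * cis \<theta>)) differentiable (at 0) \<longleftrightarrow> has_circle_deriv f (circle_deriv f z) z"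
proof -
  have "\<i> * z * circle_deriv f z = vector_derivative (\<lambda>\<theta>. f (z * cis \<theta>)) (at 0)"
    using assms by (auto simp: circle_deriv_def)
  then show ?thesis
    unfolding has_circle_deriv_def by (simp add: vector_derivative_works)
qed

lemma circle_cong_path: "z \<in> sphere 0 1 \<Longrightarrow> (\<And>u. u \<in> sphere 0 1 \<Longrightarrow> f u = g u) \<Longrightarrow> (\<lambda>\<theta>. f (z * cis \<theta>)) = (\<lambda>\<theta>. g (z * cis \<theta>))"
  by (simp add: norm_mult)

lemma circle_deriv_cong:
  assumes "z \<in> sphere 0 1" "\<And>u. u \<in> sphere 0 1 \<Longrightarrow> f u = g u"
  shows "circle_deriv f z = circle_deriv g z" "has_circle_deriv f D z = has_circle_deriv g D z"
  using circle_cong_path[of z f g, OF assms] by (simp_all add: circle_deriv_def has_circle_deriv_def)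

lemma circle_derivs_cong:
  assumes "\<And>u. u \<in> sphere 0 1 \<Longrightarrow> f u = g u" "z \<in> sphere 0 1"
  shows "(circle_deriv ^^ j) f z = (circle_deriv ^^ j) g z"
  using assms(2)
proof (induction j arbitrary: z)
  case (Suc j)
  then show ?case by (auto intro!: circle_deriv_cong)
qed (use assms(1) in auto)

lemma has_circle_deriv_add:
  "has_circle_deriv f D z \<Longrightarrow> has_circle_deriv g E z \<Longrightarrow> has_circle_deriv (\<lambda>u. f u + g u) (D + E) z"
  unfolding has_circle_deriv_def distrib_left by (rule has_vector_derivative_add)

text \<open>One product rule for all purposes: p = 0 gives constant multiples, p = 1 the outer
  factor z, and p = l the integration by parts.\<close>

lemma has_circle_deriv_monom_mult:
  assumes "has_circle_deriv f D z" "z \<in> sphere 0 1"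
  shows "has_circle_deriv (\<lambda>u. c * u powi p * f u) (c * of_int p * z powi (p - 1) * f z + c * z powi p * D) z"
proof -
  have z: "z \<noteq> 0" using assms(2) by auto
  have "((\<lambda>\<theta>. cis (of_int p * \<theta>)) has_vector_derivative \<i> * of_int p) (at 0)"
  proof -
    have "((\<lambda>z. exp (\<i> * of_int p * z)) has_field_derivative \<i> * of_int p) (at (of_real 0))"
      by (auto intro!: derivative_eq_intros)
    from has_vector_derivative_real_field[OF this]
    show ?thesis by (simp add: cis_conv_exp mult.assoc)
  qed
  then have "((\<lambda>\<theta>. (c * z powi p) * cis (of_int p * \<theta>)) has_vector_derivative (c * z powi p) * (\<i> * of_int p)) (at 0)"
    by (rule has_vector_derivative_mult_right)
  from has_vector_derivative_mult[OF this assms(1)[unfolded has_circle_deriv_def]]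
  have "((\<lambda>\<theta>. (c * z powi p) * cis (of_int p * \<theta>) * f (z * cis \<theta>)) has_vector_derivative
     c * z powi p * (\<i> * z * D) + (c * z powi p) * (\<i> * of_int p) * f z) (at 0)"
    by simp
  moreover have "(c * z powi p) * cis (of_int p * \<theta>) * f (z * cis \<theta>) = c * (z * cis \<theta>) powi p * f (z * cis \<theta>)" for \<theta>
    by (simp add: power_int_mult_distrib cis_power_int)
  moreover have "c * z powi p * (\<i> * z * D) + (c * z powi p) * (\<i> * of_int p) * f z =
     \<i> * z * (c * of_int p * z powi (p - 1) * f z + c * z powi p * D)"
    using z by (simp add: power_int_diff field_simps)
  ultimately show ?thesis unfolding has_circle_deriv_def by simp
qed

section \<open>Regularity of functions on the circle\<close>

lemma abs_cont_const: "abs_cont a b (\<lambda>_. k)"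
  unfolding abs_cont_def jump_sum_def by (auto intro: exI[of _ 1])

lemma abs_cont_mult_Lipschitz:
  fixes f k :: "real \<Rightarrow> complex"
  assumes ac: "abs_cont a b f" and L: "\<And>x y. x \<in> {a..b} \<Longrightarrow> y \<in> {a..b} \<Longrightarrow> norm (k x - k y) \<le> L * \<bar>x - y\<bar>"
    and B: "\<And>x. x \<in> {a..b} \<Longrightarrow> norm (k x) \<le> B"
  shows "abs_cont a b (\<lambda>x. k x * f x)"
proof -
  obtain F where F: "F > 0" "\<And>x. x \<in> {a..b} \<Longrightarrow> norm (f x) \<le> F"
    using compact_imp_bounded[OF compact_continuous_image[OF abs_cont_imp_continuous_on[OF ac]]]
    by (auto simp: bounded_pos)
  \<comment> \<open>The bounds are raised to at least 1, so that \<epsilon> can be divided by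
    them.\<close>
  define B' where "B' = max B 1"
  define L' where "L' = max L 1"
  have pos: "B' > 0" "L' > 0" by (auto simp: B'_def L'_def)
  have js: "jump_sum (\<lambda>x. k x * f x) S \<le> B' * jump_sum f S + (L' * F) * total_length S"
    if S: "S \<in> interval_families a b" for S
  proof -
    have "jump_sum (\<lambda>x. k x * f x) S \<le> (\<Sum>p\<in>S. B' * norm (f (snd p) - f (fst p)) + (L' * F) * (snd p - fst p))"
      unfolding jump_sum_def
    proof (rule sum_mono)
      fix p assume "p \<in> S"
      then have p: "fst p \<in> {a..b}" "snd p \<in> {a..b}" "fst p < snd p" using S by (auto simp: interval_families_def)
      have "k (snd p) * f (snd p) - k (fst p) * f (fst p) =
        k (snd p) * (f (snd p) - f (fst p)) + (k (snd p) - k (fst p)) * f (fst p)" by (simp add: algebra_simps)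
      also have "norm \<dots> \<le> norm (k (snd p)) * norm (f (snd p) - f (fst p)) + norm (k (snd p) - k (fst p)) * norm (f (fst p))"
        unfolding norm_mult[symmetric] by (rule norm_triangle_ineq)
      also have "\<dots> \<le> B' * norm (f (snd p) - f (fst p)) + (L' * (snd p - fst p)) * F"
      proof (intro add_mono mult_mono)
        show "norm (k (snd p)) \<le> B'" using B[OF p(2)] by (simp add: B'_def)
        have "norm (k (snd p) - k (fst p)) \<le> L * \<bar>snd p - fst p\<bar>" by (rule L[OF p(2,1)])
        also have "\<dots> \<le> L' * \<bar>snd p - fst p\<bar>" by (intro mult_right_mono) (auto simp: L'_def)
        finally show "norm (k (snd p) - k (fst p)) \<le> L' * (snd p - fst p)" using p(3) by simp
        show "norm (f (fst p)) \<le> F" using F(2)[OF p(1)] .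
      qed (use pos p(3) in auto)
      finally show "norm (k (snd p) * f (snd p) - k (fst p) * f (fst p)) \<le>
        B' * norm (f (snd p) - f (fst p)) + (L' * F) * (snd p - fst p)" by (simp add: mult_ac)
    qed
    also have "\<dots> = B' * jump_sum f S + (L' * F) * total_length S"
      by (simp add: jump_sum_def sum.distrib sum_distrib_left)
    finally show ?thesis .
  qed
  show ?thesis
    unfolding abs_cont_def
  proof (intro allI impI)
    fix \<epsilon> :: real assume "\<epsilon> > 0"
    then have "\<epsilon> / 2 / B' > 0" using pos by simp
    from ac[unfolded abs_cont_def, rule_format, OF this]
    obtain \<delta> where d: "\<delta> > 0" "\<And>S. S \<in> interval_families a b \<Longrightarrow> total_length S < \<delta> \<Longrightarrow> jump_sum f S < \<epsilon> / 2 / B'"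
      by blast
    show "\<exists>\<delta>>0. \<forall>S\<in>interval_families a b. total_length S < \<delta> \<longrightarrow> jump_sum (\<lambda>x. k x * f x) S < \<epsilon>"
    proof (intro exI[of _ "min \<delta> (\<epsilon> / 2 / (L' * F))"] conjI ballI impI)
      fix S assume S: "S \<in> interval_families a b" "total_length S < min \<delta> (\<epsilon> / 2 / (L' * F))"
      have "B' * jump_sum f S < B' * (\<epsilon> / 2 / B')" using d(2)[of S] S pos by (intro mult_strict_left_mono) auto
      moreover have "(L' * F) * total_length S < (L' * F) * (\<epsilon> / 2 / (L' * F))"
        using S pos F(1) by (intro mult_strict_left_mono) auto
      moreover have "B' * (\<epsilon> / 2 / B') = \<epsilon> / 2" "(L' * F) * (\<epsilon> / 2 / (L' * F)) = \<epsilon> / 2" using pos F(1) by auto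
      ultimately show "jump_sum (\<lambda>x. k x * f x) S < \<epsilon>" using js[OF S(1)] by linarith
    qed (use d(1) \<open>\<epsilon> > 0\<close> pos F(1) in auto)
  qed
qed

lemma abs_cont_add:
  fixes f g :: "real \<Rightarrow> complex"
  assumes "abs_cont a b f" "abs_cont a b g"
  shows "abs_cont a b (\<lambda>x. f x + g x)"
proof -
  have "abs_cont a b (\<lambda>x. (-1) * g x)"
    by (rule abs_cont_mult_Lipschitz[OF assms(2), of _ 0 1]) auto
  from abs_cont_diff[OF assms(1) this] show ?thesis by simp
qed

text \<open>The derivative is bounded on the compact interval, so f is bounded and Lipschitz; the
  product lemma with the constant function 1 then yields absolute continuity.\<close>

lemma abs_cont_C1:
  fixes f :: "real \<Rightarrow> complex"
  assumes d: "\<And>x. x \<in> {a..b} \<Longrightarrow> (f has_vector_derivative f' x) (at x within {a..b})"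
    and c: "continuous_on {a..b} f'"
  shows "abs_cont a b f"
proof -
  obtain L where L: "\<And>x. x \<in> {a..b} \<Longrightarrow> norm (f' x) \<le> L"
    using compact_imp_bounded[OF compact_continuous_image[OF c compact_Icc]] unfolding bounded_iff by blast
  have cf: "continuous_on {a..b} f"
    unfolding continuous_on_eq_continuous_within using has_vector_derivative_continuous[OF d] by blast
  obtain B where B: "\<And>x. x \<in> {a..b} \<Longrightarrow> norm (f x) \<le> B"
    using compact_imp_bounded[OF compact_continuous_image[OF cf compact_Icc]] unfolding bounded_iff by blast
  have "norm (f x - f y) \<le> L * \<bar>x - y\<bar>" if "x \<in> {a..b}" "y \<in> {a..b}" for x y
  proof -
    have "norm (f x - f y) \<le> L * norm (x - y)"
    proof (rule differentiable_bound[where S="{a..b}" and f'="\<lambda>x h. h *\<^sub>R f' x"])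
      fix x assume x: "x \<in> {a..b}"
      show "(f has_derivative (\<lambda>h. h *\<^sub>R f' x)) (at x within {a..b})"
        using d[OF x] by (simp add: has_vector_derivative_def)
      show "onorm (\<lambda>h. h *\<^sub>R f' x) \<le> L"
      proof (rule onorm_le)
        show "norm (h *\<^sub>R f' x) \<le> L * norm h" for h
          using mult_right_mono[OF L[OF x], of "norm h"] by (simp add: mult.commute)
      qed
    qed (use that in auto)
    then show ?thesis by simp
  qed
  from abs_cont_mult_Lipschitz[OF abs_cont_const[of a b 1] this B] show ?thesis by simp
qed

lemma cis_monomial_abs_cont: "abs_cont 0 (2 * pi) (\<lambda>\<theta>. f (cis \<theta>)) \<Longrightarrow> abs_cont 0 (2 * pi) (\<lambda>\<theta>. c * cis \<theta> powi p * f (cis \<theta>))"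
proof (rule abs_cont_mult_Lipschitz[where L="norm c * \<bar>of_int p\<bar>" and B="norm c"])
  fix x y :: real
  have d: "((\<lambda>\<theta>. c * cis (of_int p * \<theta>)) has_vector_derivative c * (\<i> * of_int p * cis (of_int p * \<theta>))) (at \<theta> within UNIV)" for \<theta>
  proof -
    have "((\<lambda>z. c * exp (\<i> * of_int p * z)) has_field_derivative c * (\<i> * of_int p * exp (\<i> * of_int p * of_real \<theta>))) (at (of_real \<theta>))"
      by (auto intro!: derivative_eq_intros)
    from has_vector_derivative_real_field[OF this]
    show ?thesis by (simp add: cis_conv_exp mult.assoc)
  qed
  have "norm (c * cis (of_int p * x) - c * cis (of_int p * y)) \<le> (norm c * \<bar>of_int p\<bar>) * norm (x - y)"
  proof (rule differentiable_bound[where S=UNIV and f'="\<lambda>\<theta> h. h *\<^sub>R (c * (\<i> * of_int p * cis (of_int p * \<theta>)))"])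
    fix \<theta>
    show "((\<lambda>\<theta>. c * cis (of_int p * \<theta>)) has_derivative (\<lambda>h. h *\<^sub>R (c * (\<i> * of_int p * cis (of_int p * \<theta>))))) (at \<theta> within UNIV)"
      using d[of \<theta>] by (simp add: has_vector_derivative_def)
    show "onorm (\<lambda>h. h *\<^sub>R (c * (\<i> * of_int p * cis (of_int p * \<theta>)))) \<le> norm c * \<bar>of_int p\<bar>"
      by (rule onorm_le) (simp add: norm_mult)
  qed auto
  then show "norm (c * cis x powi p - c * cis y powi p) \<le> (norm c * \<bar>of_int p\<bar>) * \<bar>x - y\<bar>"
    by (simp add: cis_power_int)
qed (auto simp: norm_mult norm_power_int)

text \<open>For m = N - 2 this is the regularity of the weight: m derivatives at every point, the
  last one absolutely continuous in the angle. The recursion on m suits inductions over sums and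
  products, in which the functions vary.\<close>

primrec circle_regular :: "nat \<Rightarrow> (complex \<Rightarrow> complex) \<Rightarrow> bool" where
  "circle_regular 0 f \<longleftrightarrow> abs_cont 0 (2 * pi) (\<lambda>\<theta>. f (cis \<theta>))"
| "circle_regular (Suc m) f \<longleftrightarrow> circle_differentiable f \<and> circle_regular m (circle_deriv f)"

lemma circle_regularI:
  assumes "\<And>j. j < m \<Longrightarrow> circle_differentiable ((circle_deriv ^^ j) f)"
    and "abs_cont 0 (2 * pi) (\<lambda>\<theta>. (circle_deriv ^^ m) f (cis \<theta>))"
  shows "circle_regular m f"
  using assms
proof (induction m arbitrary: f)
  case (Suc m)
  have "circle_regular m (circle_deriv f)"
  proof (rule Suc.IH)
    show "circle_differentiable ((circle_deriv ^^ j) (circle_deriv f))" if "j < m" for j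
      using Suc.prems(1)[of "Suc j"] that by (simp add: funpow_swap1)
    show "abs_cont 0 (2 * pi) (\<lambda>\<theta>. (circle_deriv ^^ m) (circle_deriv f) (cis \<theta>))"
      using Suc.prems(2) by (simp add: funpow_swap1)
  qed
  then show ?case using Suc.prems(1)[of 0] by simp
qed simp

lemma circle_regular_cong:
  "(\<And>u. u \<in> sphere 0 1 \<Longrightarrow> f u = g u) \<Longrightarrow> circle_regular m f = circle_regular m g"
proof (induction m arbitrary: f g)
  case 0
  then show ?case by simp
next
  case (Suc m)
  have "circle_differentiable f = circle_differentiable g"
    unfolding circle_differentiable_def using circle_cong_path[of _ f g] Suc.prems by simp
  moreover have "circle_regular m (circle_deriv f) = circle_regular m (circle_deriv g)"
    using circle_deriv_cong(1)[of _ f g] Suc.prems by (intro Suc.IH) auto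
  ultimately show ?case by simp
qed

lemma has_circle_deriv_path:
  assumes "has_circle_deriv f D (cis \<theta>)"
  shows "((\<lambda>\<theta>. f (cis \<theta>)) has_vector_derivative (\<i> * cis \<theta> * D)) (at \<theta>)"
  using assms unfolding has_circle_deriv_def has_vector_derivative_at_iff_tendsto
  by (simp add: cis_mult)

lemma path_has_circle_deriv:
  assumes "((\<lambda>\<theta>. f (cis \<theta>)) has_vector_derivative L) (at \<theta>)"
  shows "has_circle_deriv f (L / (\<i> * cis \<theta>)) (cis \<theta>)"
  using assms unfolding has_circle_deriv_def has_vector_derivative_at_iff_tendsto
  by (simp add: cis_mult)

lemma continuous_on_circle_if_path:
  fixes f :: "complex \<Rightarrow> complex"
  assumes "continuous_on {0..2*pi} (\<lambda>\<theta>. f (cis \<theta>))"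
  shows "continuous_on (sphere 0 1) f"
proof -
  obtain H where H: "continuous_on (sphere 0 1) H" "\<forall>x\<in>{0..2*pi}. H (cis x) = f (cis x)"
    using continuous_on_circle_lift[of "\<lambda>\<theta>. f (cis \<theta>)"] assms by auto
  have "H z = f z" if "z \<in> sphere 0 1" for z
  proof -
    have "z = cis (Arg2pi z)" using Arg2pi_eq[of z] that by (simp add: cis_conv_exp)
    moreover have "Arg2pi z \<in> {0..2*pi}" using Arg2pi[of z] by auto
    ultimately show ?thesis using H(2) by metis
  qed
  then show ?thesis using H(1) continuous_on_cong[of "sphere 0 1" "sphere 0 1" H f] by auto
qed

text \<open>For m > 0 differentiability at every angle gives continuity along the path. Continuity
  of the path descends to the circle because both ends of [0, 2 pi] are the same point.\<close>

lemma circle_regular_continuous: "circle_regular m f \<Longrightarrow> continuous_on (sphere 0 1) f"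
proof (cases m)
  case 0
  assume "circle_regular m f"
  then show ?thesis using 0 by (auto intro: continuous_on_circle_if_path abs_cont_imp_continuous_on)
next
  case (Suc k)
  assume "circle_regular m f"
  then have "has_circle_deriv f (circle_deriv f (cis \<theta>)) (cis \<theta>)" for \<theta>
    using Suc differentiable_iff_has_circle_deriv[of "cis \<theta>" f] by (auto simp: circle_differentiable_def)
  then have "isCont (\<lambda>\<theta>. f (cis \<theta>)) \<theta>" for \<theta>
    using has_circle_deriv_path has_vector_derivative_continuous by blast
  then show ?thesis
    by (intro continuous_on_circle_if_path continuous_at_imp_continuous_on) auto
qed

text \<open>At the bottom level an absolutely continuous derivative is continuous, so f is
  continuously differentiable in the angle and \<open>abs_cont_C1\<close> applies.\<close>

lemma circle_regular_Suc_imp: "circle_regular (Suc m) f \<Longrightarrow> circle_regular m f"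
proof (induction m arbitrary: f)
  case 0
  then have d: "has_circle_deriv f (circle_deriv f (cis \<theta>)) (cis \<theta>)" for \<theta>
    using differentiable_iff_has_circle_deriv[of "cis \<theta>" f] by (auto simp: circle_differentiable_def)
  have c: "continuous_on (sphere 0 1) (circle_deriv f)"
    using 0 by (intro circle_regular_continuous[of 0]) simp
  have "abs_cont 0 (2*pi) (\<lambda>\<theta>. f (cis \<theta>))"
  proof (rule abs_cont_C1)
    show "((\<lambda>\<theta>. f (cis \<theta>)) has_vector_derivative (\<i> * cis \<theta> * circle_deriv f (cis \<theta>))) (at \<theta> within {0..2*pi})" for \<theta>
      by (rule has_vector_derivative_at_within[OF has_circle_deriv_path[OF d]])
    show "continuous_on {0..2*pi} (\<lambda>\<theta>. \<i> * cis \<theta> * circle_deriv f (cis \<theta>))"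
      by (intro continuous_intros continuous_on_compose2[OF c]) auto
  qed
  then show ?case by simp
next
  case (Suc m)
  then show ?case by simp
qed

lemma circle_regular_mono: "circle_regular m f \<Longrightarrow> k \<le> m \<Longrightarrow> circle_regular k f"
proof (induction m)
  case (Suc m)
  then show ?case using circle_regular_Suc_imp[OF Suc.prems(1)] by (cases "k = Suc m") auto
qed simp

lemma circle_regular_derivs: "circle_regular m f \<Longrightarrow> j \<le> m \<Longrightarrow> circle_regular (m - j) ((circle_deriv ^^ j) f)"
proof (induction j)
  case (Suc j)
  then have "circle_regular (Suc (m - Suc j)) ((circle_deriv ^^ j) f)" by (simp add: Suc_diff_Suc)
  then show ?case by simp
qed simp

lemma circle_regular_has_deriv:
  "circle_regular (Suc m) f \<Longrightarrow> z \<in> sphere 0 1 \<Longrightarrow> has_circle_deriv f (circle_deriv f z) z"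
  using differentiable_iff_has_circle_deriv[of z f] by (auto simp: circle_differentiable_def)

lemma circle_regular_add:
  "circle_regular m f \<Longrightarrow> circle_regular m g \<Longrightarrow> circle_regular m (\<lambda>u. f u + g u)"
proof (induction m arbitrary: f g)
  case 0
  then show ?case by (simp add: abs_cont_add)
next
  case (Suc m)
  have d: "has_circle_deriv (\<lambda>u. f u + g u) (circle_deriv f z + circle_deriv g z) z" if "z \<in> sphere 0 1" for z
    using Suc.prems that by (intro has_circle_deriv_add circle_regular_has_deriv)
  then have "circle_regular m (circle_deriv (\<lambda>u. f u + g u)) = circle_regular m (\<lambda>z. circle_deriv f z + circle_deriv g z)"
    by (intro circle_regular_cong has_circle_deriv_imp)
  moreover have "circle_differentiable (\<lambda>u. f u + g u)"
    unfolding circle_differentiable_def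
    using differentiableI_vector[OF d[unfolded has_circle_deriv_def]] by blast
  ultimately show ?case using Suc by simp
qed

text \<open>In the induction step f reappears next to its derivative, so its regularity is lowered
  by one; general c and p absorb the coefficients of the product rule.\<close>

lemma circle_regular_monom_mult:
  "circle_regular m f \<Longrightarrow> circle_regular m (\<lambda>u. c * u powi p * f u)"
proof (induction m arbitrary: f c p)
  case 0
  then show ?case using cis_monomial_abs_cont[of f c p] by simp
next
  case (Suc m)
  have d: "has_circle_deriv (\<lambda>u. c * u powi p * f u) (c * of_int p * z powi (p - 1) * f z + c * z powi p * circle_deriv f z) z" if "z \<in> sphere 0 1" for z
    using Suc.prems that by (intro has_circle_deriv_monom_mult circle_regular_has_deriv)
  then have "circle_regular m (circle_deriv (\<lambda>u. c * u powi p * f u)) =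
      circle_regular m (\<lambda>z. (c * of_int p) * z powi (p - 1) * f z + c * z powi p * circle_deriv f z)"
    by (intro circle_regular_cong has_circle_deriv_imp)
  moreover have "circle_regular m (\<lambda>z. (c * of_int p) * z powi (p - 1) * f z + c * z powi p * circle_deriv f z)"
    using Suc.prems circle_regular_Suc_imp[OF Suc.prems] by (intro circle_regular_add Suc.IH) simp_all
  moreover have "circle_differentiable (\<lambda>u. c * u powi p * f u)"
    unfolding circle_differentiable_def
    using differentiableI_vector[OF d[unfolded has_circle_deriv_def]] by blast
  ultimately show ?case by simp
qed

lemma circle_regular_mult: "circle_regular m f \<Longrightarrow> circle_regular m (\<lambda>u. u * f u)"
  using circle_regular_monom_mult[of m f 1 1] by simp

section \<open>Integration by parts on the circle\<close>

text \<open>With \<open>h\<close> the derivative in the angle, \<open>z * circle_deriv f z\<close>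
  is \<open>- \<i> * h\<close> almost everywhere. Its integral over a full turn is, up to a factor,
  the increment of f, which vanishes because 0 and 2 pi are the same point of the circle.\<close>

theorem circle_regular_derivative:
  assumes f: "circle_regular 0 f"
  shows "AE z in circle_haar. has_circle_deriv f (circle_deriv f z) z"
    and "integrable circle_haar (\<lambda>z. z * circle_deriv f z)"
    and "(LINT z|circle_haar. z * circle_deriv f z) = 0"
proof -
  have ac: "abs_cont 0 (2*pi) (\<lambda>\<theta>. f (cis \<theta>))" using f by simp
  obtain h where h: "integrable lborel h" "f (cis (2*pi)) - f (cis 0) = (LINT x:{0<..2*pi}|lborel. h x)"
    "AE x in lborel. x \<in> {0<..<2*pi} \<longrightarrow> ((\<lambda>\<theta>. f (cis \<theta>)) has_vector_derivative h x) (at x)"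
    by (rule abs_cont_derivative[OF ac]) auto
  have ae: "AE \<theta> in lborel. \<theta> \<in> {0<..<2*pi} \<longrightarrow> has_circle_deriv f (circle_deriv f (cis \<theta>)) (cis \<theta>) \<and>
       cis \<theta> * circle_deriv f (cis \<theta>) = - \<i> * h \<theta>"
    using h(3)
  proof eventually_elim
    case (elim \<theta>)
    show ?case
    proof
      assume "\<theta> \<in> {0<..<2*pi}"
      then have *: "has_circle_deriv f (h \<theta> / (\<i> * cis \<theta>)) (cis \<theta>)" using elim by (intro path_has_circle_deriv) auto
      then have "circle_deriv f (cis \<theta>) = h \<theta> / (\<i> * cis \<theta>)" by (rule has_circle_deriv_imp) simp
      then show "has_circle_deriv f (circle_deriv f (cis \<theta>)) (cis \<theta>) \<and> cis \<theta> * circle_deriv f (cis \<theta>) = - \<i> * h \<theta>"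
        using * by (simp add: divide_inverse cis_mult)
    qed
  qed
  show "AE z in circle_haar. has_circle_deriv f (circle_deriv f z) z"
    by (rule AE_circleI, use ae in eventually_elim) auto
  have m: "(\<lambda>z. z * circle_deriv f z) \<in> borel_measurable circle_haar"
    by (intro borel_measurable_times circle_deriv_measurable circle_regular_continuous[OF f] continuous_on_measurable_circle) auto
  have mc: "(\<lambda>\<theta>. cis \<theta> * circle_deriv f (cis \<theta>)) \<in> borel_measurable lborel"
    using measurable_compose[OF cis_measurable_circle m[unfolded measurable_circle_haar]] by simp
  have hi: "integrable lborel (\<lambda>\<theta>. indicator {0<..2*pi} \<theta> *\<^sub>R (- \<i> * h \<theta>))"
    using h(1) by (intro integrable_mult_indicator) auto
  have eq: "AE \<theta> in lborel. indicator {0<..2*pi} \<theta> *\<^sub>R (- \<i> * h \<theta>) = indicator {0..2*pi} \<theta> *\<^sub>R (cis \<theta> * circle_deriv f (cis \<theta>))"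
    using ae AE_lborel_singleton[of 0] AE_lborel_singleton[of "2*pi"]
    by eventually_elim (auto simp: indicator_def less_le)
  have ms: "(\<lambda>\<theta>. indicat_real {0..2 * pi} \<theta> *\<^sub>R (cis \<theta> * circle_deriv f (cis \<theta>))) \<in> borel_measurable lborel"
    using mc by (intro borel_measurable_scaleR borel_measurable_indicator) auto
  have "integrable lborel (\<lambda>\<theta>. indicator {0..2*pi} \<theta> *\<^sub>R (cis \<theta> * circle_deriv f (cis \<theta>)))"
    using integrable_cong_AE[OF borel_measurable_integrable[OF hi] ms eq] hi by simp
  then show "integrable circle_haar (\<lambda>z. z * circle_deriv f z)"
    unfolding circle_integral(1)[OF m] set_integrable_def .
  have "(LINT z|circle_haar. z * circle_deriv f z) = (LINT \<theta>|lborel. indicator {0<..2*pi} \<theta> *\<^sub>R (- \<i> * h \<theta>)) / of_real (2 * pi)"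
    unfolding circle_integral(2)[OF m] set_lebesgue_integral_def
    using integral_cong_AE[OF borel_measurable_integrable[OF hi] ms eq] by simp
  also have "(LINT \<theta>|lborel. indicator {0<..2*pi} \<theta> *\<^sub>R (- \<i> * h \<theta>)) = - \<i> * (LINT x:{0<..2*pi}|lborel. h x)"
    unfolding set_lebesgue_integral_def by (subst integral_mult_right_zero[symmetric]) (simp add: mult.commute)
  also have "\<dots> = 0" using h(2) by simp
  finally show "(LINT z|circle_haar. z * circle_deriv f z) = 0" by simp
qed

lemma circle_integrable_monom_mult:
  assumes "integrable circle_haar f"
  shows "integrable circle_haar (\<lambda>z. z powi l * f z)"
proof (rule Bochner_Integration.integrable_bound[OF assms])
  show "(\<lambda>z. z powi l * f z) \<in> borel_measurable circle_haar"
    using assms by (intro borel_measurable_times[OF continuous_on_measurable_circle]) (auto intro!: continuous_intros)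
  show "AE z in circle_haar. norm (z powi l * f z) \<le> norm (f z)"
    by (rule AE_I2) (simp add: norm_mult norm_power_int)
qed

lemma prob_space_circle_haar: "prob_space circle_haar"
  unfolding circle_haar_def
proof (rule prob_space.prob_space_distr)
  show "prob_space (uniform_measure lborel {0..2 * pi})"
    by (rule prob_space_uniform_measure) auto
  show "cis \<in> measurable (uniform_measure lborel {0..2*pi}) (restrict_space borel (sphere 0 1))"
    using cis_measurable_circle by (simp add: measurable_cong_sets[OF sets_uniform_measure refl])
qed

lemma circle_regular_integrable:
  assumes "circle_regular m f"
  shows "integrable circle_haar f"
proof -
  interpret prob_space circle_haar by (rule prob_space_circle_haar)
  have c: "continuous_on (sphere 0 1) f" by (rule circle_regular_continuous[OF assms])
  obtain B where "\<And>z. z \<in> sphere 0 1 \<Longrightarrow> norm (f z) \<le> B"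
    using compact_imp_bounded[OF compact_continuous_image[OF c compact_sphere]] unfolding bounded_iff by blast
  then show ?thesis
    by (intro integrable_const_bound[of _ B] AE_I2 continuous_on_measurable_circle c) auto
qed

text \<open>z \<partial> applied to z^l f has mean zero, and the product rule splits it into l z^l f
  and z^l (z \<partial> f).\<close>

lemma spherical_circle_deriv:
  assumes f: "circle_regular 0 f"
  shows "spherical (\<lambda>z. z * circle_deriv f z) l = - of_int l * spherical f l"
proof -
  define g where "g = (\<lambda>u. 1 * u powi l * f u)"
  have g: "circle_regular 0 g" unfolding g_def by (rule circle_regular_monom_mult[OF f])
  note ig = circle_integrable_monom_mult[OF circle_regular_integrable[OF f]]
  note ie = circle_integrable_monom_mult[OF circle_regular_derivative(2)[OF f]]
  have sum: "integrable circle_haar (\<lambda>z. of_int l * (z powi l * f z) + z powi l * (z * circle_deriv f z))"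
    using ig ie by auto
  have ae: "AE z in circle_haar. z * circle_deriv g z = of_int l * (z powi l * f z) + z powi l * (z * circle_deriv f z)"
    using circle_regular_derivative(1)[OF f] AE_space[of circle_haar]
  proof eventually_elim
    case (elim z)
    then have z: "z \<in> sphere 0 1" "z \<noteq> 0" by auto
    from has_circle_deriv_monom_mult[OF elim(1) z(1), of 1 l]
    have "circle_deriv g z = of_int l * z powi (l - 1) * f z + z powi l * circle_deriv f z"
      unfolding g_def using has_circle_deriv_imp[OF _ z(1)] by simp
    then show ?case using z(2) by (simp add: power_int_diff field_simps)
  qed
  have "0 = (LINT z|circle_haar. of_int l * (z powi l * f z) + z powi l * (z * circle_deriv f z))"
    using circle_regular_derivative(3)[OF g]
      integral_cong_AE[OF borel_measurable_integrable[OF circle_regular_derivative(2)[OF g]] borel_measurable_integrable[OF sum] ae]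
    by simp
  also have "\<dots> = of_int l * spherical f l + spherical (\<lambda>z. z * circle_deriv f z) l"
    unfolding spherical_def using ig ie by simp
  finally show ?thesis by (simp add: eq_neg_iff_add_eq_0 add.commute)
qed

section \<open>The functions of the biorthonormal pair\<close>

text \<open>The induction step of the Leibniz rule for u f, with \<open>F\<close> and
  \<open>G\<close> in the roles of its derivatives of order j and j - 1. For j = 0 the truncated j -
  1 names no lower derivative, but the coefficient is then 0, so \<open>G\<close> is constrained
  only for j \<noteq> 0.\<close>

lemma has_circle_deriv_step:
  assumes F: "has_circle_deriv F D z" and G: "j \<noteq> 0 \<Longrightarrow> has_circle_deriv G (F z) z" and z: "z \<in> sphere 0 1"
  shows "has_circle_deriv (\<lambda>u. u * F u + of_nat j * G u) (z * D + of_nat (Suc j) * F z) z"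
proof -
  have 1: "has_circle_deriv (\<lambda>u. u * F u) (F z + z * D) z"
    using has_circle_deriv_monom_mult[OF F z, of 1 1] by simp
  show ?thesis
  proof (cases "j = 0")
    case True
    then show ?thesis using 1 by (simp add: add.commute)
  next
    case False
    have "has_circle_deriv (\<lambda>u. of_nat j * G u) (of_nat j * F z) z"
      using has_circle_deriv_monom_mult[OF G[OF False] z, of "of_nat j" 0] by simp
    from has_circle_deriv_add[OF 1 this] show ?thesis by (simp add: algebra_simps)
  qed
qed

lemma circle_regular_derivs_has_deriv:
  assumes "circle_regular m f" "j < m" "z \<in> sphere 0 1"
  shows "has_circle_deriv ((circle_deriv ^^ j) f) ((circle_deriv ^^ Suc j) f z) z"
proof -
  have "circle_regular (Suc (m - Suc j)) ((circle_deriv ^^ j) f)"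
    using circle_regular_derivs[OF assms(1), of j] assms(2) by (simp add: Suc_diff_Suc)
  from circle_regular_has_deriv[OF this assms(3)] show ?thesis by simp
qed

lemma circle_derivs_mult_id:
  assumes "circle_regular m f" "j \<le> m" "z \<in> sphere 0 1"
  shows "(circle_deriv ^^ j) (\<lambda>u. u * f u) z = z * (circle_deriv ^^ j) f z + of_nat j * (circle_deriv ^^ (j - 1)) f z"
  using assms(2,3)
proof (induction j arbitrary: z)
  case (Suc j)
  have "(circle_deriv ^^ Suc j) (\<lambda>u. u * f u) z =
      circle_deriv (\<lambda>z. z * (circle_deriv ^^ j) f z + of_nat j * (circle_deriv ^^ (j - 1)) f z) z"
    using Suc.IH Suc.prems by (auto intro!: circle_deriv_cong)
  also have "\<dots> = z * (circle_deriv ^^ Suc j) f z + of_nat (Suc j) * (circle_deriv ^^ j) f z"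
    using Suc.prems circle_regular_derivs_has_deriv[OF assms(1), of j z] circle_regular_derivs_has_deriv[OF assms(1), of "j - 1" z]
    by (intro has_circle_deriv_imp has_circle_deriv_step) auto
  finally show ?case by simp
qed simp

text \<open>This reaches the top order: for j = m regularity gives the next derivative only almost
  everywhere, so differentiability at z is a hypothesis.\<close>

lemma circle_derivs_mult_id_Suc:
  assumes f: "circle_regular m f" "j \<le> m" and z: "z \<in> sphere 0 1"
    and d: "has_circle_deriv ((circle_deriv ^^ j) f) ((circle_deriv ^^ Suc j) f z) z"
  shows "(circle_deriv ^^ Suc j) (\<lambda>u. u * f u) z = z * (circle_deriv ^^ Suc j) f z + of_nat (Suc j) * (circle_deriv ^^ j) f z"
proof -
  have "(circle_deriv ^^ Suc j) (\<lambda>u. u * f u) z =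
      circle_deriv (\<lambda>z. z * (circle_deriv ^^ j) f z + of_nat j * (circle_deriv ^^ (j - 1)) f z) z"
    using circle_derivs_mult_id[OF f] z by (auto intro!: circle_deriv_cong)
  also have "\<dots> = z * (circle_deriv ^^ Suc j) f z + of_nat (Suc j) * (circle_deriv ^^ j) f z"
    using f(2) circle_regular_derivs_has_deriv[OF f(1), of "j - 1" z] z d
    by (intro has_circle_deriv_imp has_circle_deriv_step) auto
  finally show ?thesis .
qed

definition shifted_weight :: "(complex \<Rightarrow> complex) \<Rightarrow> nat \<Rightarrow> complex \<Rightarrow> complex" where
  "shifted_weight w j = (\<lambda>u. u powi (int j - 1) * w u)"

lemma polya_Q_eq: "polya_Q w j = (\<lambda>z. z * (circle_deriv ^^ j) (shifted_weight w j) z)"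
  by (simp add: polya_Q_def shifted_weight_def fun_eq_iff)

lemma shifted_weight_regular: "circle_regular m w \<Longrightarrow> circle_regular m (shifted_weight w j)"
  unfolding shifted_weight_def using circle_regular_monom_mult[of m w 1 "int j - 1"] by simp

lemma polya_Q_regular: "circle_regular m w \<Longrightarrow> j \<le> m \<Longrightarrow> circle_regular (m - j) (polya_Q w j)"
  unfolding polya_Q_eq by (intro circle_regular_mult circle_regular_derivs shifted_weight_regular)

lemma polya_Q_0: "z \<in> sphere 0 1 \<Longrightarrow> polya_Q w 0 z = w z"
  by (cases "z = 0") (auto simp: polya_Q_def power_int_minus)

text \<open>The recursion expresses the operator identity
  \<open>z \<partial>\<^sup>j\<^sup>+\<^sup>1 z\<^sup>j = (z \<partial> + j) z \<partial>\<^sup>j z\<^sup>j\<^sup>-\<^sup>1\<close>.\<close>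
lemma polya_Q_Suc:
  assumes w: "circle_regular m w" "j \<le> m" and z: "z \<in> sphere 0 1"
    and d: "has_circle_deriv ((circle_deriv ^^ j) (shifted_weight w j)) ((circle_deriv ^^ Suc j) (shifted_weight w j) z) z"
  shows "polya_Q w (Suc j) z = z * circle_deriv (polya_Q w j) z + of_nat j * polya_Q w j z"
    and "has_circle_deriv (polya_Q w j) (circle_deriv (polya_Q w j) z) z"
proof -
  let ?g = "shifted_weight w j"
  have "shifted_weight w (Suc j) u = u * ?g u" if "u \<in> sphere 0 1" for u
  proof -
    have "u \<noteq> 0" using that by auto
    then have "u powi (int (Suc j) - 1) = u * u powi (int j - 1)"
      using power_int_add[of u 1 "int j - 1"] by simp
    then show ?thesis by (simp add: shifted_weight_def)
  qed
  then have "(circle_deriv ^^ Suc j) (shifted_weight w (Suc j)) z = (circle_deriv ^^ Suc j) (\<lambda>u. u * ?g u) z"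
    using z by (intro circle_derivs_cong)
  also have "\<dots> = z * (circle_deriv ^^ Suc j) ?g z + of_nat (Suc j) * (circle_deriv ^^ j) ?g z"
    by (rule circle_derivs_mult_id_Suc[OF shifted_weight_regular[OF w(1)] w(2) z d])
  finally have 1: "polya_Q w (Suc j) z = z * (z * (circle_deriv ^^ Suc j) ?g z + of_nat (Suc j) * (circle_deriv ^^ j) ?g z)"
    unfolding polya_Q_eq by simp
  have 2: "has_circle_deriv (polya_Q w j) ((circle_deriv ^^ j) ?g z + z * (circle_deriv ^^ Suc j) ?g z) z"
    unfolding polya_Q_eq using has_circle_deriv_monom_mult[OF d z, of 1 1] by simp
  then have 3: "circle_deriv (polya_Q w j) z = (circle_deriv ^^ j) ?g z + z * (circle_deriv ^^ Suc j) ?g z"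
    using z by (rule has_circle_deriv_imp)
  show "has_circle_deriv (polya_Q w j) (circle_deriv (polya_Q w j) z) z" using 2 3 by simp
  show "polya_Q w (Suc j) z = z * circle_deriv (polya_Q w j) z + of_nat j * polya_Q w j z"
  proof -
    have "polya_Q w j z = z * (circle_deriv ^^ j) ?g z" by (simp add: polya_Q_eq)
    then show ?thesis unfolding 1 3 by (simp add: algebra_simps)
  qed
qed

section \<open>Fourier coefficients of Q_j\<close>

lemma AE_shifted_weight_deriv:
  assumes "circle_regular m w" "j \<le> m"
  shows "AE z in circle_haar. has_circle_deriv ((circle_deriv ^^ j) (shifted_weight w j)) ((circle_deriv ^^ Suc j) (shifted_weight w j) z) z"
  using circle_regular_derivative(1)[OF circle_regular_mono[OF circle_regular_derivs[OF shifted_weight_regular[OF assms(1)] assms(2)], of 0]]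
  by simp

lemma spherical_cong_AE:
  assumes "f \<in> borel_measurable circle_haar" "g \<in> borel_measurable circle_haar" "AE z in circle_haar. f z = g z"
  shows "spherical f l = spherical g l"
proof -
  have c: "(\<lambda>z::complex. z powi l) \<in> borel_measurable circle_haar"
    by (intro continuous_on_measurable_circle continuous_intros) auto
  show ?thesis unfolding spherical_def
  proof (rule integral_cong_AE)
    show "AE z in circle_haar. z powi l * f z = z powi l * g z" using assms(3) by eventually_elim simp
  qed (intro borel_measurable_times c assms)+
qed

text \<open>On Fourier coefficients z \<partial> acts as multiplication by - l, so each step of the
  recursion contributes a factor j - l, and these factors build up the Pochhammer symbol. The last
  index m + 1 is within reach because integrals see only almost every point.\<close>

lemma polya_Q_spherical_regular:
  assumes w: "circle_regular m w"
  shows "j \<le> Suc m \<Longrightarrow> integrable circle_haar (polya_Q w j) \<and> (\<forall>l. spherical (polya_Q w j) l = Gamma_ratio j l * spherical w l)"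
proof (induction j)
  case 0
  have wi: "integrable circle_haar w" by (rule circle_regular_integrable[OF w])
  have "integrable circle_haar (polya_Q w 0) = integrable circle_haar w"
    by (rule Bochner_Integration.integrable_cong) (auto simp: polya_Q_0)
  moreover have "spherical (polya_Q w 0) l = spherical w l" for l
    unfolding spherical_def by (rule Bochner_Integration.integral_cong) (auto simp: polya_Q_0)
  ultimately show ?case using wi by (simp add: Gamma_ratio_def)
next
  case (Suc j)
  then have j: "j \<le> m" by simp
  let ?Q = "polya_Q w j"
  have r: "circle_regular 0 ?Q" by (rule circle_regular_mono[OF polya_Q_regular[OF w j]]) simp
  have IH: "integrable circle_haar ?Q" "\<And>l. spherical ?Q l = Gamma_ratio j l * spherical w l" using Suc by auto
  have i1: "integrable circle_haar (\<lambda>z. z * circle_deriv ?Q z)" by (rule circle_regular_derivative(2)[OF r])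
  have i2: "integrable circle_haar (\<lambda>z. z * circle_deriv ?Q z + of_nat j * ?Q z)" using i1 IH(1) by auto
  have ae: "AE z in circle_haar. polya_Q w (Suc j) z = z * circle_deriv ?Q z + of_nat j * ?Q z"
    using AE_shifted_weight_deriv[OF w j] AE_space[of circle_haar]
    by eventually_elim (rule polya_Q_Suc[OF w j], auto)
  \<comment> \<open>The function of index j + 1 contains a derivative that may fail to exist on a
    null set; its measurability comes from continuity of the derivative one order lower.\<close>
  have c: "continuous_on (sphere 0 1) ((circle_deriv ^^ j) (shifted_weight w (Suc j)))"
    by (rule circle_regular_continuous[OF circle_regular_derivs[OF shifted_weight_regular[OF w] j]])
  have m: "polya_Q w (Suc j) \<in> borel_measurable circle_haar"
    unfolding polya_Q_eq using circle_deriv_measurable[OF c] continuous_on_measurable_circle[OF continuous_on_id]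
    by (simp add: borel_measurable_times)
  have "integrable circle_haar (polya_Q w (Suc j))"
    using integrable_cong_AE[OF m borel_measurable_integrable[OF i2] ae] i2 by simp
  moreover have "spherical (polya_Q w (Suc j)) l = Gamma_ratio (Suc j) l * spherical w l" for l
  proof -
    have "spherical (polya_Q w (Suc j)) l = spherical (\<lambda>z. z * circle_deriv ?Q z + of_nat j * ?Q z) l"
      by (rule spherical_cong_AE[OF m borel_measurable_integrable[OF i2] ae])
    also have "\<dots> = (LINT z|circle_haar. z powi l * (z * circle_deriv ?Q z) + of_nat j * (z powi l * ?Q z))"
      unfolding spherical_def by (simp add: algebra_simps)
    also have "\<dots> = spherical (\<lambda>z. z * circle_deriv ?Q z) l + of_nat j * spherical ?Q l"
      unfolding spherical_def
      using circle_integrable_monom_mult[OF i1, of l] circle_integrable_monom_mult[OF IH(1), of l] by simp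
    also have "\<dots> = (of_nat j - of_int l) * spherical ?Q l"
      unfolding spherical_circle_deriv[OF r] by (simp add: algebra_simps)
    also have "\<dots> = Gamma_ratio (Suc j) l * spherical w l"
      unfolding IH(2) Gamma_ratio_def pochhammer_Suc by (simp add: algebra_simps)
    finally show ?thesis .
  qed
  ultimately show ?case by simp
qed

section \<open>Q_j as combinations of the w_i\<close>

lemma polya_w_Suc: "polya_w w (Suc j) = (\<lambda>z. - (z * circle_deriv (polya_w w j) z))"
  by (simp add: polya_w_def)

lemma polya_w_regular: "circle_regular m w \<Longrightarrow> j \<le> m \<Longrightarrow> circle_regular (m - j) (polya_w w j)"
proof (induction j)
  case 0
  then show ?case by (simp add: polya_w_def)
next
  case (Suc j)
  then have "circle_regular (Suc (m - Suc j)) (polya_w w j)" by (simp add: Suc_diff_Suc)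
  then have "circle_regular (m - Suc j) (circle_deriv (polya_w w j))" by simp
  from circle_regular_monom_mult[OF this, of "-1" 1] show ?case by (simp add: polya_w_Suc)
qed

lemma has_circle_deriv_sum:
  fixes j :: nat
  assumes "\<And>i. i \<le> j \<Longrightarrow> has_circle_deriv (F i) (D i) z" and z: "z \<in> sphere 0 1"
  shows "has_circle_deriv (\<lambda>u. \<Sum>i\<le>j. c i * F i u) (\<Sum>i\<le>j. c i * D i) z"
proof -
  have 1: "has_circle_deriv (\<lambda>u. c i * F i u) (c i * D i) z" if "i \<le> j" for i
    using has_circle_deriv_monom_mult[OF assms(1)[OF that] z, of "c i" 0] by simp
  have "has_circle_deriv (\<lambda>u. \<Sum>i\<le>k. c i * F i u) (\<Sum>i\<le>k. c i * D i) z" if "k \<le> j" for k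
    using that by (induction k) (auto intro: 1 has_circle_deriv_add)
  then show ?thesis by simp
qed

text \<open>Differentiability is a premise at the point z, inside the quantifiers, so that the
  coefficients \<open>d\<close> do not depend on z and one lemma serves every point for j < m and
  almost every point for j = m.\<close>

lemma polya_Q_triangular_step:
  assumes w: "circle_regular m w" "j \<le> m"
    and c: "c j \<noteq> 0" "\<And>z. z \<in> sphere 0 1 \<Longrightarrow> polya_Q w j z = (\<Sum>i\<le>j. c i * polya_w w i z)"
  shows "\<exists>d. d (Suc j) \<noteq> 0 \<and> (\<forall>z\<in>sphere 0 1.
     has_circle_deriv ((circle_deriv ^^ j) (shifted_weight w j)) ((circle_deriv ^^ Suc j) (shifted_weight w j) z) z \<longrightarrow>
     (\<forall>i\<le>j. has_circle_deriv (polya_w w i) (circle_deriv (polya_w w i) z) z) \<longrightarrow>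
     polya_Q w (Suc j) z = (\<Sum>i\<le>Suc j. d i * polya_w w i z))"
proof -
  \<comment> \<open>As z \<partial> w_i = - w_(i+1), the first summand shifts the coefficients and
    changes their sign; the second comes from the term j Q_j of the recursion. The new leading
    coefficient is \<open>- c j\<close>.\<close>
  define d where "d = (\<lambda>i. (case i of 0 \<Rightarrow> 0 | Suc i' \<Rightarrow> - c i') + (if i \<le> j then of_nat j * c i else 0))"
  have "polya_Q w (Suc j) z = (\<Sum>i\<le>Suc j. d i * polya_w w i z)"
    if z: "z \<in> sphere 0 1" and g: "has_circle_deriv ((circle_deriv ^^ j) (shifted_weight w j)) ((circle_deriv ^^ Suc j) (shifted_weight w j) z) z"
      and W: "\<And>i. i \<le> j \<Longrightarrow> has_circle_deriv (polya_w w i) (circle_deriv (polya_w w i) z) z" for z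
  proof -
    have "circle_deriv (polya_Q w j) z = circle_deriv (\<lambda>u. \<Sum>i\<le>j. c i * polya_w w i u) z"
      by (rule circle_deriv_cong(1)[OF z c(2)])
    also have "\<dots> = (\<Sum>i\<le>j. c i * circle_deriv (polya_w w i) z)"
      by (rule has_circle_deriv_imp[OF has_circle_deriv_sum[OF W z] z])
    finally have "z * circle_deriv (polya_Q w j) z = (\<Sum>i\<le>j. - c i * polya_w w (Suc i) z)"
      by (simp add: polya_w_Suc sum_distrib_left mult_ac)
    then have "polya_Q w (Suc j) z = (\<Sum>i\<le>j. - c i * polya_w w (Suc i) z) + of_nat j * (\<Sum>i\<le>j. c i * polya_w w i z)"
      unfolding polya_Q_Suc(1)[OF w z g] c(2)[OF z] by simp
    also have "(\<Sum>i\<le>j. - c i * polya_w w (Suc i) z) = (\<Sum>i\<le>Suc j. (case i of 0 \<Rightarrow> 0 | Suc i' \<Rightarrow> - c i') * polya_w w i z)"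
      by (subst sum.atMost_Suc_shift) simp
    also have "of_nat j * (\<Sum>i\<le>j. c i * polya_w w i z) = (\<Sum>i\<le>Suc j. (if i \<le> j then of_nat j * c i else 0) * polya_w w i z)"
      by (simp add: sum_distrib_left mult.assoc)
    finally show ?thesis unfolding d_def by (simp only: distrib_right sum.distrib)
  qed
  moreover have "d (Suc j) \<noteq> 0" using c(1) by (simp add: d_def)
  ultimately show ?thesis by blast
qed

lemma polya_Q_triangular_sphere:
  assumes w: "circle_regular m w"
  shows "j \<le> m \<Longrightarrow> \<exists>c. c j \<noteq> 0 \<and> (\<forall>z\<in>sphere 0 1. polya_Q w j z = (\<Sum>i\<le>j. c i * polya_w w i z))"
proof (induction j)
  case 0
  show ?case by (rule exI[of _ "\<lambda>_. 1"]) (simp add: polya_Q_0 polya_w_def)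
next
  case (Suc j)
  then obtain c where c: "c j \<noteq> 0" "\<And>z. z \<in> sphere 0 1 \<Longrightarrow> polya_Q w j z = (\<Sum>i\<le>j. c i * polya_w w i z)" by auto
  have jm: "j \<le> m" using Suc.prems by simp
  have "has_circle_deriv (polya_w w i) (circle_deriv (polya_w w i) z) z" if "z \<in> sphere 0 1" "i \<le> j" for z i
  proof -
    have "circle_regular (Suc (m - Suc i)) (polya_w w i)"
      using polya_w_regular[OF w, of i] Suc.prems that(2) by (simp add: Suc_diff_Suc)
    then show ?thesis by (rule circle_regular_has_deriv[OF _ that(1)])
  qed
  moreover have "has_circle_deriv ((circle_deriv ^^ j) (shifted_weight w j)) ((circle_deriv ^^ Suc j) (shifted_weight w j) z) z" if "z \<in> sphere 0 1" for z
    using Suc.prems that by (intro circle_regular_derivs_has_deriv[OF shifted_weight_regular[OF w]]) auto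
  ultimately show ?case using polya_Q_triangular_step[where c=c, OF w jm c] by blast
qed

text \<open>Up to index m the expansion holds at every point of the circle; only the step from m to
  m + 1 passes to almost every point.\<close>

lemma polya_Q_triangular_AE:
  assumes w: "circle_regular m w" and j: "j \<le> Suc m"
  shows "\<exists>c. c j \<noteq> 0 \<and> (AE z in circle_haar. polya_Q w j z = (\<Sum>i\<le>j. c i * polya_w w i z))"
proof (cases j)
  case 0
  show ?thesis unfolding 0
    by (intro exI[of _ "\<lambda>_. 1"] conjI AE_I2) (auto simp: polya_Q_0 polya_w_def)
next
  case (Suc k)
  have k: "k \<le> m" using Suc j by simp
  then obtain c where c: "c k \<noteq> 0" "\<And>z. z \<in> sphere 0 1 \<Longrightarrow> polya_Q w k z = (\<Sum>i\<le>k. c i * polya_w w i z)"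
    using polya_Q_triangular_sphere[OF w] by blast
  obtain d where d: "d (Suc k) \<noteq> 0" "\<And>z. z \<in> sphere 0 1 \<Longrightarrow>
     has_circle_deriv ((circle_deriv ^^ k) (shifted_weight w k)) ((circle_deriv ^^ Suc k) (shifted_weight w k) z) z \<Longrightarrow>
     (\<forall>i\<le>k. has_circle_deriv (polya_w w i) (circle_deriv (polya_w w i) z) z) \<Longrightarrow>
     polya_Q w (Suc k) z = (\<Sum>i\<le>Suc k. d i * polya_w w i z)"
    using polya_Q_triangular_step[where c=c, OF w k c] by blast
  have "AE z in circle_haar. \<forall>i\<in>{..k}. has_circle_deriv (polya_w w i) (circle_deriv (polya_w w i) z) z"
  proof (rule AE_finite_allI)
    fix i assume "i \<in> {..k}"
    then show "AE z in circle_haar. has_circle_deriv (polya_w w i) (circle_deriv (polya_w w i) z) z"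
      using k by (intro circle_regular_derivative(1) circle_regular_mono[OF polya_w_regular[OF w, of i]]) auto
  qed simp
  then have "AE z in circle_haar. polya_Q w (Suc k) z = (\<Sum>i\<le>Suc k. d i * polya_w w i z)"
    using AE_shifted_weight_deriv[OF w k] AE_space[of circle_haar]
    by eventually_elim (rule d(2), auto)
  then show ?thesis using d(1) Suc by blast
qed

lemma L1_circle_smooth_regular:
  assumes "w \<in> L1_circle_smooth N" "2 \<le> N"
  shows "circle_regular (N - 2) w"
  using assms by (intro circle_regularI absolutely_continuous_fun_imp_abs_cont) (auto simp: L1_circle_smooth_def)

lemma L1_circle_smooth_integrable: "w \<in> L1_circle_smooth N \<Longrightarrow> integrable circle_haar w"
  by (simp add: L1_circle_smooth_def L1_circle_def)

text \<open>For N \<ge> 2 the weight is regular of order N - 2, which reaches all j \<le> N - 1. For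
  N = 1 the weight is only integrable, but then j = 0, and Q_0 coincides with the weight on the
  circle.\<close>

lemma polya_Q_spherical:
  assumes w: "w \<in> L1_circle_smooth N" and j: "j < N"
  shows "integrable circle_haar (polya_Q w j)" "spherical (polya_Q w j) l = Gamma_ratio j l * spherical w l"
proof -
  have "integrable circle_haar (polya_Q w j) \<and> (\<forall>l. spherical (polya_Q w j) l = Gamma_ratio j l * spherical w l)"
  proof (cases "2 \<le> N")
    case True
    then show ?thesis using polya_Q_spherical_regular[OF L1_circle_smooth_regular[OF w True], of j] j by simp
  next
    case False
    then have "j = 0" using j by simp
    have "integrable circle_haar (polya_Q w 0) = integrable circle_haar w"
      by (rule Bochner_Integration.integrable_cong) (auto simp: polya_Q_0)
    moreover have "spherical (polya_Q w 0) l = spherical w l" for l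
      unfolding spherical_def by (rule Bochner_Integration.integral_cong) (auto simp: polya_Q_0)
    ultimately show ?thesis using L1_circle_smooth_integrable[OF w] \<open>j = 0\<close> by (simp add: Gamma_ratio_def)
  qed
  then show "integrable circle_haar (polya_Q w j)" "spherical (polya_Q w j) l = Gamma_ratio j l * spherical w l" by auto
qed

lemma polya_Q_triangular:
  assumes w: "w \<in> L1_circle_smooth N" and j: "j < N"
  shows "\<exists>c. c j \<noteq> 0 \<and> (AE z in circle_haar. polya_Q w j z = (\<Sum>i\<le>j. c i * polya_w w i z))"
proof (cases "2 \<le> N")
  case True
  then show ?thesis using polya_Q_triangular_AE[OF L1_circle_smooth_regular[OF w True], of j] j by simp
next
  case False
  then have "j = 0" using j by simp
  show ?thesis unfolding \<open>j = 0\<close>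
    by (intro exI[of _ "\<lambda>_. 1"] conjI AE_I2) (auto simp: polya_Q_0 polya_w_def)
qed

section \<open>Spans modulo null sets\<close>

lemma circle_span_self: "j < N \<Longrightarrow> F j \<in> circle_span N F"
  unfolding circle_span_def
  by (intro CollectI exI[of _ "\<lambda>i. if i = j then 1 else 0"] AE_I2) (simp add: if_distrib[of "\<lambda>x. x * _"] cong: if_cong)

lemma circle_span_cong_AE:
  "f \<in> circle_span N F \<Longrightarrow> AE z in circle_haar. g z = f z \<Longrightarrow> g \<in> circle_span N F"
proof -
  assume "f \<in> circle_span N F" and ae: "AE z in circle_haar. g z = f z"
  then obtain c where "AE z in circle_haar. f z = (\<Sum>j<N. c j * F j z)" by (auto simp: circle_span_def)
  with ae have "AE z in circle_haar. g z = (\<Sum>j<N. c j * F j z)" by eventually_elim simp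
  then show ?thesis by (auto simp: circle_span_def)
qed

lemma circle_span_sum:
  assumes "finite A" "\<And>i. i \<in> A \<Longrightarrow> f i \<in> circle_span N F"
  shows "(\<lambda>z. \<Sum>i\<in>A. a i * f i z) \<in> circle_span N F"
proof -
  have "\<forall>i\<in>A. \<exists>c. AE z in circle_haar. f i z = (\<Sum>j<N. c j * F j z)"
    using assms(2) by (auto simp: circle_span_def)
  from bchoice[OF this]
  obtain c where c: "\<And>i. i \<in> A \<Longrightarrow> AE z in circle_haar. f i z = (\<Sum>j<N. c i j * F j z)" by blast
  have "AE z in circle_haar. \<forall>i\<in>A. f i z = (\<Sum>j<N. c i j * F j z)"
    by (rule AE_finite_allI[OF assms(1) c])
  then have "AE z in circle_haar. (\<Sum>i\<in>A. a i * f i z) = (\<Sum>j<N. (\<Sum>i\<in>A. a i * c i j) * F j z)"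
  proof eventually_elim
    case (elim z)
    have "(\<Sum>i\<in>A. a i * f i z) = (\<Sum>i\<in>A. \<Sum>j<N. a i * c i j * F j z)"
      using elim by (simp add: sum_distrib_left mult.assoc)
    also have "\<dots> = (\<Sum>j<N. \<Sum>i\<in>A. a i * c i j * F j z)" by (rule sum.swap)
    finally show ?case by (simp add: sum_distrib_right)
  qed
  then show ?thesis by (auto simp: circle_span_def)
qed

lemma circle_span_mono:
  assumes "\<And>j. j < N \<Longrightarrow> F j \<in> circle_span N G"
  shows "circle_span N F \<subseteq> circle_span N G"
proof
  fix f assume "f \<in> circle_span N F"
  then obtain c where c: "AE z in circle_haar. f z = (\<Sum>j<N. c j * F j z)" by (auto simp: circle_span_def)
  have "(\<lambda>z. \<Sum>j<N. c j * F j z) \<in> circle_span N G" by (rule circle_span_sum) (use assms in auto)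
  then show "f \<in> circle_span N G" by (rule circle_span_cong_AE[OF _ c])
qed

text \<open>A triangular system with nonzero diagonal can be solved for \<open>G j\<close> in terms
  of \<open>F j\<close> and the earlier \<open>G i\<close>, which lie in the span by strong
  induction.\<close>

lemma circle_span_triangular:
  assumes tri: "\<And>j. j < N \<Longrightarrow> \<exists>c. c j \<noteq> 0 \<and> (AE z in circle_haar. F j z = (\<Sum>i\<le>j. c i * G i z))"
  shows "circle_span N F = circle_span N G"
proof (intro equalityI circle_span_mono)
  fix j assume j: "j < N"
  obtain c where "AE z in circle_haar. F j z = (\<Sum>i\<le>j. c i * G i z)" using tri[OF j] by blast
  moreover have "(\<lambda>z. \<Sum>i\<le>j. c i * G i z) \<in> circle_span N G"
    by (rule circle_span_sum) (use j in \<open>auto intro: circle_span_self\<close>)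
  ultimately show "F j \<in> circle_span N G" using circle_span_cong_AE by blast
next
  fix j assume "j < N"
  then show "G j \<in> circle_span N F"
  proof (induction j rule: less_induct)
    case (less j)
    obtain c where c: "c j \<noteq> 0" "AE z in circle_haar. F j z = (\<Sum>i\<le>j. c i * G i z)" using tri[OF less.prems] by blast
    define h where "h = (\<lambda>i. if i = j then F j else G i)"
    define a where "a = (\<lambda>i. if i = j then 1 / c j else - c i / c j)"
    have "(\<lambda>z. \<Sum>i\<le>j. a i * h i z) \<in> circle_span N F"
      by (rule circle_span_sum) (use less in \<open>auto simp: h_def intro: circle_span_self\<close>)
    moreover have "AE z in circle_haar. G j z = (\<Sum>i\<le>j. a i * h i z)"
      using c(2)
    proof eventually_elim
      case (elim z)
      have s: "(\<Sum>i\<le>j. f i) = f j + (\<Sum>i<j. f i)" for f :: "nat \<Rightarrow> complex"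
        by (simp add: lessThan_Suc_atMost[symmetric] add.commute)
      have "(\<Sum>i<j. a i * h i z) = - (\<Sum>i<j. c i * G i z) / c j"
        by (simp add: a_def h_def sum_divide_distrib sum_negf)
      then have "(\<Sum>i\<le>j. a i * h i z) = F j z / c j - (\<Sum>i<j. c i * G i z) / c j"
        unfolding s by (simp add: a_def h_def)
      also have "\<dots> = G j z" unfolding elim s using c(1) by (simp add: field_simps)
      finally show ?case by simp
    qed
    ultimately show ?case by (rule circle_span_cong_AE)
  qed
qed

section \<open>Finite sums and the kernel\<close>

lemma pochhammer_minus_of_nat:
  "pochhammer (- of_nat k) b = (-1) ^ b * fact b * (of_nat (k choose b) :: complex)"
  using gbinomial_pochhammer[of "of_nat k :: complex" b]
  by (simp add: binomial_gbinomial power_mult_distrib[symmetric] flip: mult.assoc)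

text \<open>The identity (a choose k) (k choose b) = (a choose b) (a - b choose k - b) leaves the
  alternating sum of row a - b of Pascal's triangle, which vanishes unless a = b.\<close>

lemma alternating_sum_choose_choose:
  "(\<Sum>k\<le>a. (-1) ^ k * of_nat (a choose k) * of_nat (k choose b)) = (if a = b then (-1) ^ b else (0 :: complex))"
proof (cases "b \<le> a")
  case False
  then show ?thesis by (auto intro!: sum.neutral)
next
  case True
  have "(\<Sum>k\<le>a. (-1) ^ k * of_nat (a choose k) * of_nat (k choose b)) =
      (\<Sum>k\<in>{b..a}. (-1) ^ k * of_nat (a choose k) * of_nat (k choose b) :: complex)"
    by (rule sum.mono_neutral_right) (auto simp: not_le)
  also have "\<dots> = (\<Sum>i\<le>a - b. (-1) ^ (i + b) * of_nat (a choose (i + b)) * of_nat ((i + b) choose b))"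
    by (rule sum.reindex_bij_witness[of _ "\<lambda>i. i + b" "\<lambda>k. k - b"]) (use True in auto)
  also have "\<dots> = (\<Sum>i\<le>a - b. ((-1) ^ b * of_nat (a choose b)) * ((-1) ^ i * of_nat ((a - b) choose i)))"
  proof (rule sum.cong[OF refl])
    fix i assume "i \<in> {..a - b}"
    then have "(a choose (i + b)) * ((i + b) choose b) = (a choose b) * ((a - b) choose i)"
      using choose_mult[of b "i + b" a] True by simp
    from arg_cong[OF this, of "of_nat :: nat \<Rightarrow> complex"]
    show "(-1) ^ (i + b) * of_nat (a choose (i + b)) * of_nat ((i + b) choose b) =
        ((-1) ^ b * of_nat (a choose b)) * ((-1) ^ i * of_nat ((a - b) choose i) :: complex)"
      by (simp add: power_add mult_ac)
  qed
  also have "\<dots> = ((-1) ^ b * of_nat (a choose b)) * (\<Sum>i\<le>a - b. (-1) ^ i * of_nat ((a - b) choose i))"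
    by (rule sum_distrib_left[symmetric])
  also have "\<dots> = (if a = b then (-1) ^ b else 0)"
    using choose_alternating_sum[of "a - b", where ?'a=complex] True by auto
  finally show ?thesis .
qed

lemma biorthogonality_sum:
  "(\<Sum>k<a + 1. 1 / (fact (a - k) * fact k) * ((-1) ^ k * pochhammer (- of_nat k) b)) = (if a = b then 1 else (0 :: complex))"
proof -
  have "(\<Sum>k<a + 1. 1 / (fact (a - k) * fact k) * ((-1) ^ k * pochhammer (- of_nat k) b)) =
      (\<Sum>k\<le>a. ((-1) ^ b * fact b / fact a) * ((-1) ^ k * of_nat (a choose k) * of_nat (k choose b)) :: complex)"
  proof (rule sum.cong)
    fix k assume "k \<in> {..a}"
    then have "of_nat (a choose k) = (fact a / (fact k * fact (a - k)) :: complex)" by (simp add: binomial_fact)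
    then show "1 / (fact (a - k) * fact k) * ((-1) ^ k * pochhammer (- of_nat k) b) =
       ((-1) ^ b * fact b / fact a) * ((-1) ^ k * of_nat (a choose k) * of_nat (k choose b) :: complex)"
      by (simp add: pochhammer_minus_of_nat mult_ac)
  qed auto
  also have "\<dots> = ((-1) ^ b * fact b / fact a) * (if a = b then (-1) ^ b else 0)"
    unfolding sum_distrib_left[symmetric] alternating_sum_choose_choose ..
  finally show ?thesis by (simp flip: power_mult_distrib)
qed

text \<open>With y = x + k, P / (n! y) + P / (n+1)! = P (n + 1 + y) / ((n+1)! y), and n + 1 + y is
  the next Pochhammer factor. For x = - l the number y = k - l is the denominator in the
  kernel.\<close>

lemma pochhammer_telescope:
  fixes x :: complex
  assumes "x + of_nat k \<noteq> 0"
  shows "(\<Sum>i\<le>n. pochhammer x (k + i) / fact i) = pochhammer x (Suc (k + n)) / (fact n * (x + of_nat k))"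
proof (induction n)
  case 0
  then show ?case using assms by (simp add: pochhammer_Suc)
next
  case (Suc n)
  have "(\<Sum>i\<le>Suc n. pochhammer x (k + i) / fact i) =
     pochhammer x (Suc (k + n)) / (fact n * (x + of_nat k)) + pochhammer x (Suc (k + n)) / fact (Suc n)"
    using Suc by simp
  also have "\<dots> = pochhammer x (Suc (k + n)) * (of_nat (Suc n) + (x + of_nat k)) / (fact (Suc n) * (x + of_nat k))"
  proof -
    have "P / (F * y) + P / (m * F) = P * (m + y) / ((m * F) * y)"
      if "F \<noteq> 0" "m \<noteq> 0" "y \<noteq> 0" for P F m y :: complex
      using that by (simp add: field_simps)
    from this[OF fact_nonzero _ assms, of "of_nat (Suc n)"] show ?thesis
      unfolding fact_Suc using of_nat_neq_0[of n, where ?'a=complex] by blast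
  qed
  also have "of_nat (Suc n) + (x + of_nat k) = x + of_nat (Suc (k + n))" by simp
  also have "pochhammer x (Suc (k + n)) * (x + of_nat (Suc (k + n))) = pochhammer x (Suc (k + Suc n))"
    by (simp add: pochhammer_Suc)
  finally show ?case .
qed

section \<open>Coefficients of the kernel\<close>

text \<open>The part of the coefficient of z^k in P_j that depends on j; the remaining factor, a
  multiple of 1 / (k! S w(k)), leaves the sum over j. The value 0 for k > j lets all sums run over
  the same range j < N.\<close>

definition kernel_coeff :: "nat \<Rightarrow> nat \<Rightarrow> complex" where
  "kernel_coeff k j = (if k \<le> j then 1 / fact (j - k) else 0)"

lemma kernel_coeff_sum:
  assumes "k < N"
  shows "(\<Sum>j<N. kernel_coeff k j * pochhammer x j) = (\<Sum>i\<le>N - 1 - k. pochhammer x (k + i) / fact i)"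
proof -
  have "(\<Sum>j<N. kernel_coeff k j * pochhammer x j) = (\<Sum>j\<in>{k..<N}. kernel_coeff k j * pochhammer x j)"
    by (rule sum.mono_neutral_right) (auto simp: kernel_coeff_def)
  also have "\<dots> = (\<Sum>i\<le>N - 1 - k. pochhammer x (k + i) / fact i)"
    by (rule sum.reindex_bij_witness[of _ "\<lambda>i. k + i" "\<lambda>j. j - k"]) (use assms in \<open>auto simp: kernel_coeff_def\<close>)
  finally show ?thesis .
qed

lemma pochhammer_minus_of_int_eq_0: "0 \<le> l \<Longrightarrow> l < int n \<Longrightarrow> pochhammer (- of_int l :: complex) n = 0"
  using pochhammer_of_nat_eq_0_iff[of "nat l" n, where ?'a=complex] by simp

text \<open>The kernel minus the geometric sum, frequency by frequency. For l = k only j = k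
  contributes and the subtracted term cancels it; for the other l in J_N the telescoped product
  contains the factor 0; outside J_N telescoping produces the factor 1 / (k - l).\<close>

lemma kernel_coeff_Gamma_ratio:
  assumes k: "k < N"
  shows "(\<Sum>j<N. kernel_coeff k j * Gamma_ratio j l) - (if l = int k then (-1) ^ k * fact k else 0) =
    (if l \<in> index_set N then 0 else Gamma_ratio N l / (fact (N - 1 - k) * of_int (int k - l)))"
proof (cases "l = int k")
  case True
  have "(\<Sum>i\<le>N - 1 - k. pochhammer (- of_nat k :: complex) (k + i) / fact i) = (\<Sum>i\<le>N - 1 - k. if i = 0 then (-1) ^ k * fact k else 0)"
    by (intro sum.cong refl) (auto simp: pochhammer_minus_of_nat)
  then show ?thesis
    using True k by (simp add: Gamma_ratio_def kernel_coeff_sum index_set_def)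
next
  case False
  have "- of_int l + of_nat k = (of_int (int k - l) :: complex)" by simp
  moreover have "(of_int (int k - l) :: complex) \<noteq> 0" using False unfolding of_int_eq_0_iff by simp
  ultimately have "(\<Sum>j<N. kernel_coeff k j * Gamma_ratio j l) = pochhammer (- of_int l) (Suc (k + (N - 1 - k))) / (fact (N - 1 - k) * of_int (int k - l))"
    unfolding Gamma_ratio_def kernel_coeff_sum[OF k] using pochhammer_telescope[of "- of_int l" k "N - 1 - k"] by simp
  moreover have "Suc (k + (N - 1 - k)) = N" using k by simp
  ultimately show ?thesis
    using False pochhammer_minus_of_int_eq_0[of l N] by (auto simp: Gamma_ratio_def index_set_def)
qed

lemma spherical_sum:
  assumes "\<And>i. i \<in> A \<Longrightarrow> integrable circle_haar (f i)"
  shows "spherical (\<lambda>z. \<Sum>i\<in>A. a i * f i z) l = (\<Sum>i\<in>A. a i * spherical (f i) l)"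
proof -
  have "spherical (\<lambda>z. \<Sum>i\<in>A. a i * f i z) l = (LINT z|circle_haar. (\<Sum>i\<in>A. a i * (z powi l * f i z)))"
    unfolding spherical_def by (simp add: sum_distrib_left mult_ac)
  also have "\<dots> = (\<Sum>i\<in>A. (LINT z|circle_haar. a i * (z powi l * f i z)))"
    by (rule Bochner_Integration.integral_sum) (intro integrable_mult_right circle_integrable_monom_mult assms)
  finally show ?thesis by (simp add: spherical_def)
qed

lemma integrable_powi: "integrable circle_haar (\<lambda>z. z powi l)"
proof -
  interpret prob_space circle_haar by (rule prob_space_circle_haar)
  show ?thesis
    using circle_integrable_monom_mult[of "\<lambda>_. 1" l] by simp
qed

text \<open>The exponent is negative because \<open>spherical\<close> pairs with z^l; as functions
  of the second variable, the summands of the geometric sum are multiples of these powers.\<close>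

lemma spherical_powi: "spherical (\<lambda>z. z powi (- k)) l = (if l = k then 1 else 0)"
proof -
  have "spherical (\<lambda>z. z powi (- k)) l = spherical (\<lambda>_. 1) (l - k)"
    unfolding spherical_def
  proof (rule Bochner_Integration.integral_cong[OF refl])
    fix z assume "z \<in> space circle_haar"
    then have "z \<noteq> 0" by auto
    then show "z powi l * z powi (- k) = z powi (l - k) * 1" by (simp add: power_int_diff power_int_minus divide_inverse)
  qed
  also have "\<dots> = Fourier_coeff (\<lambda>_. 1) (l - k)"
    by (rule spherical_eq_Fourier_coeff) simp
  finally show ?thesis by (simp add: Fourier_coeff_const)
qed

text \<open>\<open>infsum\<close> has the value 0 on a family that is not summable, so summability
  for every t > 0 is asserted beside the limits. With the geometric sum subtracted, the kernel
  formula is a limit of the double series alone, and its existence is part of the claim.\<close>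

theorem proposition19:
  fixes N :: nat and \<omega> :: "complex \<Rightarrow> complex"
  assumes "N \<ge> 1" and "cyclic_polya_weight N \<omega>"
  shows "(biorthonormal_pair N \<omega> (polya_P \<omega>) (polya_Q \<omega>)) \<and>
     (\<forall>j<N. \<forall>t>0. \<forall>z\<^sub>2\<in>sphere 0 1. Q_term N \<omega> j t z\<^sub>2 summable_on - index_set j) \<and>
     (\<forall>j<N. AE z\<^sub>2 in circle_haar.
           ((\<lambda>t. \<Sum>\<^sub>\<infinity>l\<in>- index_set j. Q_term N \<omega> j t z\<^sub>2 l) \<longlongrightarrow> polya_Q \<omega> j z\<^sub>2) (at_right 0)) \<and>
     (\<forall>k<N. \<forall>t>0. \<forall>z\<^sub>1\<in>sphere 0 1. \<forall>z\<^sub>2\<in>sphere 0 1.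
           kernel_term N \<omega> t z\<^sub>1 z\<^sub>2 k summable_on - index_set N) \<and>
     (AE z\<^sub>2 in circle_haar. \<forall>z\<^sub>1\<in>sphere 0 1.
           ((\<lambda>t. \<Sum>k<N. \<Sum>\<^sub>\<infinity>l\<in>- index_set N. kernel_term N \<omega> t z\<^sub>1 z\<^sub>2 k l) \<longlongrightarrow>
              polya_kernel N \<omega> z\<^sub>1 z\<^sub>2 - (\<Sum>k<N. (z\<^sub>1 * inverse z\<^sub>2) ^ k)) (at_right 0))"
proof -
  have w: "\<omega> \<in> L1_circle_smooth N" using assms(2) by (simp add: cyclic_polya_weight_def)
  have S: "spherical \<omega> (int k) \<noteq> 0" if "k < N" for k
    using assms(2) that by (auto simp: cyclic_polya_weight_def)
  note Qi = polya_Q_spherical(1)[OF w]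
  note Qs = polya_Q_spherical(2)[OF w]
  have Qt: "Q_term N \<omega> j t z l = spherical (polya_Q \<omega> j) l * z powi (- l) * regulator N t l" if "j < N" for j t z l
    by (simp add: Q_term_def Qs[OF that])

  have bi: "biorthonormal_pair N \<omega> (polya_P \<omega>) (polya_Q \<omega>)"
    unfolding biorthonormal_pair_def
  proof (intro conjI allI impI)
    show "circle_span N (polya_Q \<omega>) = circle_span N (polya_w \<omega>)"
      by (rule circle_span_triangular) (rule polya_Q_triangular[OF w])
    show "circle_span N (polya_P \<omega>) = circle_span N (\<lambda>j z. z ^ j)"
    proof (rule circle_span_triangular)
      fix j assume "j < N"
      define c where "c = (\<lambda>i. 1 / (fact (j - i) * fact i) * ((-1) ^ i / spherical \<omega> (int i)))"
      have "polya_P \<omega> j z = (\<Sum>i\<le>j. c i * z ^ i)" for z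
      proof -
        have "1 / (fact (j - i) * fact i) * ((- z) ^ i / spherical \<omega> (int i)) = c i * z ^ i" for i
          by (simp add: c_def power_minus[of z])
        then show ?thesis by (simp add: polya_P_def lessThan_Suc_atMost)
      qed
      moreover have "c j \<noteq> 0" using S[OF \<open>j < N\<close>] by (simp add: c_def)
      ultimately show "\<exists>c. c j \<noteq> 0 \<and> (AE z in circle_haar. polya_P \<omega> j z = (\<Sum>i\<le>j. c i * z ^ i))"
        by (intro exI[of _ c]) simp
    qed
    fix a b assume a: "a < N" and b: "b < N"
    define e where "e = (\<lambda>k. 1 / (fact (a - k) * fact k) * ((-1) ^ k / spherical \<omega> (int k)))"
    have "has_bochner_integral circle_haar (\<lambda>z. \<Sum>k<a + 1. e k * (z powi (int k) * polya_Q \<omega> b z))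
        (\<Sum>k<a + 1. e k * spherical (polya_Q \<omega> b) (int k))"
      unfolding spherical_def
      by (intro has_bochner_integral_sum has_bochner_integral_mult_right has_bochner_integral_integrable
          circle_integrable_monom_mult Qi[OF b])
    moreover have "(\<lambda>z. \<Sum>k<a + 1. e k * (z powi (int k) * polya_Q \<omega> b z)) = (\<lambda>z. polya_P \<omega> a z * polya_Q \<omega> b z)"
    proof
      fix z
      have "e k * (z powi (int k) * polya_Q \<omega> b z) = 1 / (fact (a - k) * fact k) * ((- z) ^ k / spherical \<omega> (int k)) * polya_Q \<omega> b z" for k
        by (simp add: e_def power_minus[of z])
      then show "(\<Sum>k<a + 1. e k * (z powi (int k) * polya_Q \<omega> b z)) = polya_P \<omega> a z * polya_Q \<omega> b z"
        unfolding polya_P_def sum_distrib_right by simp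
    qed
    moreover have "(\<Sum>k<a + 1. e k * spherical (polya_Q \<omega> b) (int k)) = (if a = b then 1 else 0)"
    proof -
      have "e k * spherical (polya_Q \<omega> b) (int k) = 1 / (fact (a - k) * fact k) * ((-1) ^ k * pochhammer (- of_nat k) b)" if "k < a + 1" for k
        using S[of k] that a by (simp add: e_def Qs[OF b] Gamma_ratio_def)
      then show ?thesis using biorthogonality_sum[of a b] by simp
    qed
    ultimately show "has_bochner_integral circle_haar (\<lambda>z. polya_P \<omega> a z * polya_Q \<omega> b z) (if a = b then 1 else 0)"
      by simp
  qed

  have Qsum: "Q_term N \<omega> j t z\<^sub>2 summable_on - index_set j" if "j < N" "t > 0" "z\<^sub>2 \<in> sphere 0 1" for j t z\<^sub>2
  proof -
    have "Q_term N \<omega> j t z\<^sub>2 summable_on UNIV"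
      unfolding Qt[OF that(1), abs_def] by (rule regulated_series_summable[OF assms(1) Qi[OF that(1)] that(2,3)])
    then show ?thesis by (rule summable_on_subset_banach) simp
  qed

  have Qlim: "AE z\<^sub>2 in circle_haar.
      ((\<lambda>t. \<Sum>\<^sub>\<infinity>l\<in>- index_set j. Q_term N \<omega> j t z\<^sub>2 l) \<longlongrightarrow> polya_Q \<omega> j z\<^sub>2) (at_right 0)" if j: "j < N" for j
  proof -
    \<comment> \<open>For l in J_j the Gamma ratio vanishes, so the sum may run over all integers
      and becomes the regulated Fourier series of Q_j.\<close>
    have "(\<Sum>\<^sub>\<infinity>l\<in>- index_set j. Q_term N \<omega> j t z l) = (\<Sum>\<^sub>\<infinity>l. spherical (polya_Q \<omega> j) l * z powi (- l) * regulator N t l)" for t z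
    proof (rule infsum_cong_neutral)
      fix l assume "l \<in> UNIV - - index_set j"
      then show "spherical (polya_Q \<omega> j) l * z powi (- l) * regulator N t l = 0"
        by (simp add: Qs[OF j] Gamma_ratio_def index_set_def pochhammer_minus_of_int_eq_0)
    qed (auto simp: Qt[OF j])
    then show ?thesis using regulated_series_tendsto_AE[OF assms(1) Qi[OF j]] by simp
  qed

  \<comment> \<open>For fixed k this carries the dependence on z_2 of the kernel minus the geometric
    sum, which equals the sum of \<open>C k\<close> at z_1 times \<open>G k\<close> at z_2, with
    \<open>C\<close> defined below. The subtracted power removes exactly the frequency l = k, so
    that no frequency in J_N remains.\<close>
  define G where "G = (\<lambda>k z. (\<Sum>j<N. kernel_coeff k j * polya_Q \<omega> j z) - (spherical \<omega> (int k) * ((-1) ^ k * fact k)) * z powi (- int k))"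
  have Gi: "integrable circle_haar (G k)" for k
    unfolding G_def
    by (intro Bochner_Integration.integrable_diff Bochner_Integration.integrable_sum integrable_mult_right Qi integrable_powi) auto
  have Gs: "spherical (G k) l = (if l \<in> index_set N then 0 else Gamma_ratio N l / (fact (N - 1 - k) * of_int (int k - l)) * spherical \<omega> l)"
    if k: "k < N" for k l
  proof -
    define b where "b = spherical \<omega> (int k) * ((-1) ^ k * fact k)"
    have i1: "integrable circle_haar (\<lambda>z. \<Sum>j<N. kernel_coeff k j * polya_Q \<omega> j z)"
      by (intro Bochner_Integration.integrable_sum integrable_mult_right Qi) auto
    have i2: "integrable circle_haar (\<lambda>z. z powi (- int k))" by (rule integrable_powi)
    have "spherical (G k) l = (LINT z|circle_haar. z powi l * (\<Sum>j<N. kernel_coeff k j * polya_Q \<omega> j z) - b * (z powi l * z powi (- int k)))"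
      unfolding spherical_def G_def b_def by (simp add: algebra_simps)
    also have "\<dots> = spherical (\<lambda>z. \<Sum>j<N. kernel_coeff k j * polya_Q \<omega> j z) l - b * spherical (\<lambda>z. z powi (- int k)) l"
      unfolding spherical_def
      using circle_integrable_monom_mult[OF i1, of l] circle_integrable_monom_mult[OF i2, of l] by simp
    also have "spherical (\<lambda>z. \<Sum>j<N. kernel_coeff k j * polya_Q \<omega> j z) l = (\<Sum>j<N. kernel_coeff k j * spherical (polya_Q \<omega> j) l)"
      by (rule spherical_sum) (use Qi in auto)
    also have "\<dots> = (\<Sum>j<N. kernel_coeff k j * Gamma_ratio j l) * spherical \<omega> l"
      by (simp add: Qs sum_distrib_right mult.assoc)
    also have "(\<Sum>j<N. kernel_coeff k j * Gamma_ratio j l) * spherical \<omega> l - b * spherical (\<lambda>z. z powi (- int k)) l =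
       ((\<Sum>j<N. kernel_coeff k j * Gamma_ratio j l) - (if l = int k then (-1) ^ k * fact k else 0)) * spherical \<omega> l"
      unfolding spherical_powi by (simp add: b_def algebra_simps)
    finally show ?thesis unfolding kernel_coeff_Gamma_ratio[OF k] by simp
  qed
  define C where "C = (\<lambda>k z. (- z) ^ k / (fact k * spherical \<omega> (int k)))"
  have kt: "kernel_term N \<omega> t z\<^sub>1 z\<^sub>2 k l = C k z\<^sub>1 * (spherical (G k) l * z\<^sub>2 powi (- l) * regulator N t l)"
    if k: "k < N" and l: "l \<in> - index_set N" for t z\<^sub>1 z\<^sub>2 k l
  proof -
    have "N - k = Suc (N - 1 - k)" using k by simp
    then have "Gamma (of_nat (N - k)) = (fact (N - 1 - k) :: complex)"
      using Gamma_fact[of "N - 1 - k", where ?'a=complex] by simp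
    moreover have "Gamma (of_nat (k + 1)) = (fact k :: complex)"
      using Gamma_fact[of k, where ?'a=complex] by (simp add: add.commute)
    ultimately show ?thesis
      using l by (simp add: kernel_term_def Gs[OF k] C_def mult_ac)
  qed
  have Gsum: "(\<lambda>l. spherical (G k) l * z\<^sub>2 powi (- l) * regulator N t l) summable_on UNIV" if "t > 0" "z\<^sub>2 \<in> sphere 0 1" for k t z\<^sub>2
    by (rule regulated_series_summable[OF assms(1) Gi that])
  have Ksum: "kernel_term N \<omega> t z\<^sub>1 z\<^sub>2 k summable_on - index_set N" if "k < N" "t > 0" "z\<^sub>2 \<in> sphere 0 1" for k t z\<^sub>1 z\<^sub>2
  proof -
    have "(\<lambda>l. C k z\<^sub>1 * (spherical (G k) l * z\<^sub>2 powi (- l) * regulator N t l)) summable_on - index_set N"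
      by (intro summable_on_cmult_right summable_on_subset_banach[OF Gsum[OF that(2,3)]]) simp
    then show ?thesis by (rule summable_on_cong[THEN iffD1, rotated]) (simp add: kt[OF that(1)])
  qed
  have Kinf: "(\<Sum>\<^sub>\<infinity>l\<in>- index_set N. kernel_term N \<omega> t z\<^sub>1 z\<^sub>2 k l) =
      C k z\<^sub>1 * (\<Sum>\<^sub>\<infinity>l. spherical (G k) l * z\<^sub>2 powi (- l) * regulator N t l)" if k: "k < N" for k t z\<^sub>1 z\<^sub>2
  proof -
    have "(\<Sum>\<^sub>\<infinity>l\<in>- index_set N. kernel_term N \<omega> t z\<^sub>1 z\<^sub>2 k l) =
        (\<Sum>\<^sub>\<infinity>l. C k z\<^sub>1 * (spherical (G k) l * z\<^sub>2 powi (- l) * regulator N t l))"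
      \<comment> \<open>The coefficients of \<open>G k\<close> vanish on J_N, so the sum over the
        complement is the whole regulated Fourier series.\<close>
      by (rule infsum_cong_neutral) (auto simp: kt[OF k] Gs[OF k])
    then show ?thesis by (simp add: infsum_cmult_right')
  qed
  have kernel: "(\<Sum>k<N. C k z\<^sub>1 * G k z\<^sub>2) = polya_kernel N \<omega> z\<^sub>1 z\<^sub>2 - (\<Sum>k<N. (z\<^sub>1 * inverse z\<^sub>2) ^ k)" for z\<^sub>1 z\<^sub>2
  proof -
    have "(\<Sum>k<N. C k z\<^sub>1 * (\<Sum>j<N. kernel_coeff k j * polya_Q \<omega> j z\<^sub>2)) = (\<Sum>k<N. \<Sum>j<N. C k z\<^sub>1 * kernel_coeff k j * polya_Q \<omega> j z\<^sub>2)"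
      by (simp add: sum_distrib_left mult.assoc)
    also have "\<dots> = (\<Sum>j<N. \<Sum>k<N. C k z\<^sub>1 * kernel_coeff k j * polya_Q \<omega> j z\<^sub>2)" by (rule sum.swap)
    also have "\<dots> = polya_kernel N \<omega> z\<^sub>1 z\<^sub>2"
      unfolding polya_kernel_def polya_P_def sum_distrib_right[symmetric]
    proof (rule sum.cong[OF refl])
      fix j assume "j \<in> {..<N}"
      have "(\<Sum>k<N. C k z\<^sub>1 * kernel_coeff k j) = (\<Sum>k<j + 1. C k z\<^sub>1 * kernel_coeff k j)"
        by (rule sum.mono_neutral_right) (use \<open>j \<in> {..<N}\<close> in \<open>auto simp: kernel_coeff_def\<close>)
      also have "\<dots> = (\<Sum>k<j + 1. 1 / (fact (j - k) * fact k) * ((- z\<^sub>1) ^ k / spherical \<omega> (int k)))"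
        by (intro sum.cong refl) (auto simp: kernel_coeff_def C_def)
      finally show "(\<Sum>k<N. C k z\<^sub>1 * kernel_coeff k j) * polya_Q \<omega> j z\<^sub>2 =
         (\<Sum>k<j + 1. 1 / (fact (j - k) * fact k) * ((- z\<^sub>1) ^ k / spherical \<omega> (int k))) * polya_Q \<omega> j z\<^sub>2" by simp
    qed
    finally have 1: "(\<Sum>k<N. C k z\<^sub>1 * (\<Sum>j<N. kernel_coeff k j * polya_Q \<omega> j z\<^sub>2)) = polya_kernel N \<omega> z\<^sub>1 z\<^sub>2" .
    have "C k z\<^sub>1 * ((spherical \<omega> (int k) * ((-1) ^ k * fact k)) * z\<^sub>2 powi (- int k)) = (z\<^sub>1 * inverse z\<^sub>2) ^ k" if "k < N" for k
    proof -
      have "(- z\<^sub>1) ^ k * (-1) ^ k = z\<^sub>1 ^ k" by (simp flip: power_mult_distrib)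
      then show ?thesis
        using S[OF that] by (simp add: C_def power_int_minus power_mult_distrib power_inverse)
    qed
    then have "(\<Sum>k<N. C k z\<^sub>1 * ((spherical \<omega> (int k) * ((-1) ^ k * fact k)) * z\<^sub>2 powi (- int k))) = (\<Sum>k<N. (z\<^sub>1 * inverse z\<^sub>2) ^ k)"
      by simp
    then show ?thesis
      unfolding G_def right_diff_distrib sum_subtractf 1 by simp
  qed
  \<comment> \<open>Finitely many exceptional sets, one for each k, all chosen before z_1
    enters.\<close>
  have "AE z\<^sub>2 in circle_haar. \<forall>k\<in>{..<N}. ((\<lambda>t. \<Sum>\<^sub>\<infinity>l. spherical (G k) l * z\<^sub>2 powi (- l) * regulator N t l) \<longlongrightarrow> G k z\<^sub>2) (at_right 0)"
    by (rule AE_finite_allI) (auto intro: regulated_series_tendsto_AE[OF assms(1) Gi])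
  then have Klim: "AE z\<^sub>2 in circle_haar. \<forall>z\<^sub>1\<in>sphere 0 1.
           ((\<lambda>t. \<Sum>k<N. \<Sum>\<^sub>\<infinity>l\<in>- index_set N. kernel_term N \<omega> t z\<^sub>1 z\<^sub>2 k l) \<longlongrightarrow>
              polya_kernel N \<omega> z\<^sub>1 z\<^sub>2 - (\<Sum>k<N. (z\<^sub>1 * inverse z\<^sub>2) ^ k)) (at_right 0)"
  proof eventually_elim
    case (elim z\<^sub>2)
    show ?case
    proof
      fix z\<^sub>1 :: complex assume "z\<^sub>1 \<in> sphere 0 1"
      have "((\<lambda>t. \<Sum>k<N. C k z\<^sub>1 * (\<Sum>\<^sub>\<infinity>l. spherical (G k) l * z\<^sub>2 powi (- l) * regulator N t l)) \<longlongrightarrow> (\<Sum>k<N. C k z\<^sub>1 * G k z\<^sub>2)) (at_right 0)"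
        using elim by (intro tendsto_sum tendsto_mult tendsto_const) auto
      then show "((\<lambda>t. \<Sum>k<N. \<Sum>\<^sub>\<infinity>l\<in>- index_set N. kernel_term N \<omega> t z\<^sub>1 z\<^sub>2 k l) \<longlongrightarrow>
              polya_kernel N \<omega> z\<^sub>1 z\<^sub>2 - (\<Sum>k<N. (z\<^sub>1 * inverse z\<^sub>2) ^ k)) (at_right 0)"
        unfolding kernel by (simp add: Kinf)
    qed
  qed
  show ?thesis using bi Qsum Qlim Ksum Klim by blast
qed

end
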